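(* For every positive integer $N$ there exists a topologically convex stacked polyhedron such that every valid edge unfolding of it (into possibly multiple non-self-overlapping pieces) has at least $N$ pieces.
   Context: A polyhedron is a compact subset of $\mathbb{R}^3$ whose boundary surface is a closed embedded surface made of finitely many planar polygonal faces meeting edge-to-edge. It is topologically convex if its surface is homeomorphic to a sphere and its graph of vertices and edges is a 3-vertex-connected planar graph. A stacked polyhedron is one that can be formed from a single tetrahedron by repeatedly gluing a new tetrahedron onto a single triangular face of the current stacked polyhedron, face to face, so that the result is again a polyhedron. An edge unfolding (possibly into multiple pieces) is specified by a set of edges (the cut edges). Cutting the surface along them separates it into connected pieces. The unfolding is valid if each piece can be laid out isometrically in the plane, face by face, as a simple (non-self-overlapping) polygon. *)

theory Defs
  imports "HOL-Analysis.Analysis"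
begin

text \<open>Triangulated surfaces in R^3. A (stacked) polyhedron is represented by a
vertex placement p :: nat => real^3 on the vertex indices {..<n}, a set F of
triangular faces (3-element sets of vertex indices) and the solid S.\<close>

definition tri_edges :: "nat set set \<Rightarrow> nat set set" where
  "tri_edges F = {e. \<exists>f\<in>F. e \<subseteq> f \<and> card e = 2}"

definition is_tri_polyhedron ::
  "(nat \<Rightarrow> real^3) \<Rightarrow> nat \<Rightarrow> nat set set \<Rightarrow> (real^3) set \<Rightarrow> bool" where
  "is_tri_polyhedron p n F S \<longleftrightarrow>
     compact S \<and> finite F \<and> inj_on p {..<n} \<and> \<Union>F = {..<n} \<and>
     (\<forall>f\<in>F. card f = 3 \<and> \<not> collinear (p ` f)) \<and>
     frontier S = (\<Union>f\<in>F. convex hull (p ` f)) \<and>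
     (\<forall>f\<in>F. \<forall>g\<in>F. convex hull (p ` f) \<inter> convex hull (p ` g) = convex hull (p ` (f \<inter> g))) \<and>
     (\<forall>e\<in>tri_edges F. card {f\<in>F. e \<subseteq> f} = 2)"

inductive stacked ::
  "(nat \<Rightarrow> real^3) \<Rightarrow> nat \<Rightarrow> nat set set \<Rightarrow> (real^3) set \<Rightarrow> bool" for p where
  base: "\<not> coplanar {p 0, p 1, p 2, p 3} \<Longrightarrow>
    stacked p 4 {{0,1,2},{0,1,3},{0,2,3},{1,2,3}} (convex hull {p 0, p 1, p 2, p 3})"
| step: "stacked p n F S \<Longrightarrow> {a,b,c} \<in> F \<Longrightarrow>
    \<not> coplanar {p a, p b, p c, p n} \<Longrightarrow>
    interior (convex hull {p a, p b, p c, p n}) \<inter> S = {} \<Longrightarrow>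
    is_tri_polyhedron p (Suc n) ((F - {{a,b,c}}) \<union> {{a,b,n},{a,c,n},{b,c,n}})
      (S \<union> convex hull {p a, p b, p c, p n}) \<Longrightarrow>
    stacked p (Suc n) ((F - {{a,b,c}}) \<union> {{a,b,n},{a,c,n},{b,c,n}})
      (S \<union> convex hull {p a, p b, p c, p n})"

text \<open>The triangles are the genuine (maximal planar) faces: no two triangles
sharing an edge are coplanar.\<close>

definition faces_are_triangles :: "(nat \<Rightarrow> real^3) \<Rightarrow> nat set set \<Rightarrow> bool" where
  "faces_are_triangles p F \<longleftrightarrow>
     (\<forall>f\<in>F. \<forall>g\<in>F. f \<noteq> g \<and> card (f \<inter> g) = 2 \<longrightarrow> \<not> coplanar (p ` (f \<union> g)))"

definition poly_adj :: "nat set set \<Rightarrow> nat \<Rightarrow> nat \<Rightarrow> bool" where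
  "poly_adj F i j \<longleftrightarrow> {i, j} \<in> tri_edges F"

definition three_connected :: "nat set \<Rightarrow> (nat \<Rightarrow> nat \<Rightarrow> bool) \<Rightarrow> bool" where
  "three_connected V adj \<longleftrightarrow> finite V \<and> card V \<ge> 4 \<and>
     (\<forall>X \<subseteq> V. card X \<le> 2 \<longrightarrow>
        (\<forall>u\<in>V - X. \<forall>v\<in>V - X.
           (\<lambda>x y. adj x y \<and> x \<in> V - X \<and> y \<in> V - X)\<^sup>*\<^sup>* u v))"

definition topologically_convex ::
  "(nat \<Rightarrow> real^3) \<Rightarrow> nat \<Rightarrow> nat set set \<Rightarrow> (real^3) set \<Rightarrow> bool" where
  "topologically_convex p n F S \<longleftrightarrow>
     frontier S homeomorphic sphere (0::real^3) 1 \<and> three_connected {..<n} (poly_adj F)"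

definition uncut_adj :: "nat set set \<Rightarrow> nat set set \<Rightarrow> nat set \<Rightarrow> nat set \<Rightarrow> bool" where
  "uncut_adj F C f g \<longleftrightarrow> f \<in> F \<and> g \<in> F \<and> f \<noteq> g \<and> card (f \<inter> g) = 2 \<and> f \<inter> g \<notin> C"

definition pieces :: "nat set set \<Rightarrow> nat set set \<Rightarrow> nat set set set" where
  "pieces F C = {{g \<in> F. (uncut_adj F C)\<^sup>*\<^sup>* f g} | f. f \<in> F}"

text \<open>A layout q of piece P places each face f isometrically in the plane
(q f i is the position of vertex i of face f); faces glued along an uncut
edge agree on it; the layout is injective on the cut-open piece (two corners
land on the same point only if they are the same vertex and are connected
around that vertex through uncut edges); triangles meet only in their common
points; and the union is a simple polygon (a topological closed disk).\<close>

definition valid_layout ::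
  "(nat \<Rightarrow> real^3) \<Rightarrow> nat set set \<Rightarrow> nat set set \<Rightarrow> nat set set
     \<Rightarrow> (nat set \<Rightarrow> nat \<Rightarrow> real^2) \<Rightarrow> bool" where
  "valid_layout p F C P q \<longleftrightarrow>
     (\<forall>f\<in>P. \<forall>i\<in>f. \<forall>j\<in>f. dist (q f i) (q f j) = dist (p i) (p j)) \<and>
     (\<forall>f\<in>P. \<forall>g\<in>P. uncut_adj F C f g \<longrightarrow> (\<forall>i\<in>f \<inter> g. q f i = q g i)) \<and>
     (\<forall>f\<in>P. \<forall>g\<in>P. \<forall>i\<in>f. \<forall>j\<in>g. q f i = q g j \<longrightarrow>
        i = j \<and> (\<lambda>x y. uncut_adj F C x y \<and> i \<in> x \<inter> y)\<^sup>*\<^sup>* f g) \<and>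
     (\<forall>f\<in>P. \<forall>g\<in>P. convex hull (q f ` f) \<inter> convex hull (q g ` g)
                     = convex hull (q f ` f \<inter> q g ` g)) \<and>
     (\<Union>f\<in>P. convex hull (q f ` f)) homeomorphic cball (0::real^2) 1"

definition valid_edge_unfolding ::
  "(nat \<Rightarrow> real^3) \<Rightarrow> nat set set \<Rightarrow> nat set set \<Rightarrow> bool" where
  "valid_edge_unfolding p F C \<longleftrightarrow>
     C \<subseteq> tri_edges F \<and> (\<forall>P\<in>pieces F C. \<exists>q. valid_layout p F C P q)"

end

theory Submission
  imports Defs
begin

text \<open>On a triangle \<open>abc\<close> put a ``hat'' of three stacked tetrahedra: a vertex \<open>x\<close> over \<open>abc\<close>, then \<open>y\<close>
over \<open>abx\<close>, then \<open>z\<close> over \<open>axy\<close>. The vertices are placed so that the four consecutive face angles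
at \<open>x\<close> other than \<open>xyz\<close>, and the three at \<open>y\<close> other than \<open>xyz\<close>, add up to more than \<open>2\<pi>\<close>: take
limit positions in the plane of \<open>abc\<close>, where the sums strictly exceed \<open>2\<pi>\<close>, and perturb. The faces
of a fan that is cut nowhere inside are laid out around a common point without overlap, so each of
the fans at \<open>x\<close> and \<open>y\<close> must be cut, and so must the tip \<open>z\<close>, which is not flat. This forces four of
the nine edges of the hat to be cut. Now put a hat on each of the \<open>2n - 4\<close> faces of a stacked
polyhedron with \<open>n\<close> vertices. Then \<open>7(2n - 4)\<close> faces are joined across at most
\<open>5(2n - 4) + (3n - 6)\<close> uncut edges, which leaves at least \<open>n - 2\<close> pieces.\<close>

section \<open>Oriented volume and tetrahedra\<close>

text \<open>The count dictates how much a hat must force. Base edges number 3/2 per face, so seven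
  faces joined across six hat edges would prove nothing, whereas five gain two per hat. Three
  vertices to be relieved do not give four cuts by themselves, as a cut \<open>xy\<close> serves two
  of them. Hence the fans are too wide even without \<open>xyz\<close>: cutting edges of
  \<open>xyz\<close> alone relieves neither \<open>x\<close> nor \<open>y\<close>. One of
  \<open>xa\<close>, \<open>xb\<close>, \<open>xc\<close>, one of \<open>ya\<close>,
  \<open>yb\<close> and one edge at \<open>z\<close> must be cut; the fourth cut is
  \<open>xy\<close> itself or is forced by the detour through \<open>xyz\<close>.

  The excess comes from \<open>z\<close>, the only vertex that keeps a positive height in the limit.
  The flat angles around \<open>x\<close> sum to 2 pi, and so do those around \<open>y\<close> in
  the triangle \<open>abx\<close>. Replacing the arm \<open>xy\<close> by the arm to
  \<open>z\<close>, above the midpoint of \<open>xy\<close>, widens the angle with \<open>xa\<close>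
  or \<open>ya\<close> if that angle is acute. To make both acute, \<open>y\<close> is put on the
  base of an isosceles triangle with apex \<open>a\<close>, whose base starts at \<open>x\<close>,
  beyond the midpoint of the base.

  The solids are not convex, so each hat is confined to a low tetrahedron over its face that meets
  the solid in this face only.\<close>

definition orient :: "real^3 \<Rightarrow> real^3 \<Rightarrow> real^3 \<Rightarrow> real^3 \<Rightarrow> real" where
  "orient a b c d = cross3 (b - a) (c - a) \<bullet> (d - a)"

text \<open>The bracket is the determinant of the coefficient matrix, so this is multiplicativity of
  determinants. It turns every volume below into arithmetic with coordinates.\<close>

lemma triple_combination:
  fixes U V W :: "real^3"
  shows "cross3 (b1 *\<^sub>R U + c1 *\<^sub>R V + d1 *\<^sub>R W) (b2 *\<^sub>R U + c2 *\<^sub>R V + d2 *\<^sub>R W)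
      \<bullet> (b3 *\<^sub>R U + c3 *\<^sub>R V + d3 *\<^sub>R W)
    = (b1 * (c2 * d3 - d2 * c3) - c1 * (b2 * d3 - d2 * b3) + d1 * (b2 * c3 - c2 * b3))
      * (cross3 U V \<bullet> W)"
  by (simp add: cross3_simps)

text \<open>With \<open>cramer_point\<close> this is Cramer's rule in homogeneous form: putting
  \<open>x\<close> in place of one vertex of \<open>abcz\<close> yields the barycentric coordinate
  of \<open>x\<close> at that vertex, multiplied by \<open>orient a b c z\<close>.\<close>

lemma orient_sum:
  "orient a b c z = orient x b c z + orient a x c z + orient a b x z + orient a b c x"
  by (simp add: orient_def cross3_simps)

lemma cramer_point:
  "orient a b c z *\<^sub>R x = orient x b c z *\<^sub>R a + orient a x c z *\<^sub>R b
     + orient a b x z *\<^sub>R c + orient a b c x *\<^sub>R z"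
  by (simp add: orient_def vec_eq_iff forall_3 cross3_simps)

lemma orient_combination:
  assumes "u + v + w + t = 1"
  shows "orient a b c (u *\<^sub>R a + v *\<^sub>R b + w *\<^sub>R c + t *\<^sub>R z) = t * orient a b c z"
    and "orient a b (u *\<^sub>R a + v *\<^sub>R b + w *\<^sub>R c + t *\<^sub>R z) z = w * orient a b c z"
    and "orient a (u *\<^sub>R a + v *\<^sub>R b + w *\<^sub>R c + t *\<^sub>R z) c z = v * orient a b c z"
    and "orient (u *\<^sub>R a + v *\<^sub>R b + w *\<^sub>R c + t *\<^sub>R z) b c z = u * orient a b c z"
proof -
  define x where "x = u *\<^sub>R a + v *\<^sub>R b + w *\<^sub>R c + t *\<^sub>R z"
  define U V W where "U = b - a" and "V = c - a" and "W = z - a"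
  have u: "u = 1 - v - w - t" using assms by simp
  have x: "x - a = v *\<^sub>R U + w *\<^sub>R V + t *\<^sub>R W"
    unfolding x_def u U_def V_def W_def by (simp add: algebra_simps)
  have o: "orient a b c z = cross3 U V \<bullet> W"
    unfolding orient_def U_def V_def W_def ..
  show 1: "orient a b c x = t * orient a b c z"
    using triple_combination[of 1 U 0 V 0 W 0 1 0 v w t]
    unfolding o unfolding orient_def x unfolding U_def V_def W_def by simp
  show 2: "orient a b x z = w * orient a b c z"
    using triple_combination[of 1 U 0 V 0 W v w t 0 0 1]
    unfolding o unfolding orient_def x unfolding U_def V_def W_def by simp
  show 3: "orient a x c z = v * orient a b c z"
    using triple_combination[of v U w V t W 0 1 0 0 0 1]
    unfolding o unfolding orient_def x unfolding U_def V_def W_def by simp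
  show "orient x b c z = u * orient a b c z"
    using orient_sum[of a b c z x] 1 2 3 unfolding u by (simp add: algebra_simps)
qed

lemma affine_hull_3_orient:
  assumes "x \<in> affine hull {a,b,c}" shows "orient a b c x = 0"
proof -
  obtain u v w where "x = u *\<^sub>R a + v *\<^sub>R b + w *\<^sub>R c" "u + v + w = 1"
    using assms by (auto simp: affine_hull_3)
  then show ?thesis using orient_combination(1)[of u v w 0 a b c 0] by simp
qed

lemma orient_imp_not_coplanar:
  assumes "orient a b c d \<noteq> 0" shows "\<not> coplanar {a,b,c,d}"
proof
  assume "coplanar {a,b,c,d}"
  then obtain u v w where s: "{a,b,c,d} \<subseteq> affine hull {u,v,w}" unfolding coplanar_def by blast
  have "\<exists>s t. x = u + s *\<^sub>R (v-u) + t *\<^sub>R (w-u)" if xin: "x \<in> affine hull {u,v,w}" for x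
  proof -
    obtain r s t where "x = r *\<^sub>R u + s *\<^sub>R v + t *\<^sub>R w" "r + s + t = 1"
      using xin unfolding affine_hull_3 by blast
    then have "r = 1 - s - t" "x = r *\<^sub>R u + s *\<^sub>R v + t *\<^sub>R w" by auto
    then have "x = (1 - s - t) *\<^sub>R u + s *\<^sub>R v + t *\<^sub>R w" by simp
    then have "x = u + s *\<^sub>R (v-u) + t *\<^sub>R (w-u)" by (simp add: algebra_simps)
    then show ?thesis by blast
  qed
  with s obtain s0 t0 s1 t1 s2 t2 s3 t3 where
    "a = u + s0 *\<^sub>R (v-u) + t0 *\<^sub>R (w-u)" "b = u + s1 *\<^sub>R (v-u) + t1 *\<^sub>R (w-u)"
    "c = u + s2 *\<^sub>R (v-u) + t2 *\<^sub>R (w-u)" "d = u + s3 *\<^sub>R (v-u) + t3 *\<^sub>R (w-u)"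
    by (meson insert_subset)
  note e = this
  have "b - a = (s1-s0) *\<^sub>R (v-u) + (t1-t0) *\<^sub>R (w-u) + 0 *\<^sub>R 0"
    "c - a = (s2-s0) *\<^sub>R (v-u) + (t2-t0) *\<^sub>R (w-u) + 0 *\<^sub>R 0"
    "d - a = (s3-s0) *\<^sub>R (v-u) + (t3-t0) *\<^sub>R (w-u) + 0 *\<^sub>R 0"
    unfolding e by (simp_all add: algebra_simps)
  then have "orient a b c d = 0" unfolding orient_def by (simp only: triple_combination) simp
  with assms show False by simp
qed

lemma cross_0_imp_collinear:
  assumes "cross3 (b - a) (c - a) = 0" shows "collinear {a,b,c}"
proof -
  have "collinear {0, b - a, c - a}" using assms by (simp add: cross_eq_0)
  then have "collinear {b, a, c}" by (subst collinear_3) (simp_all add: NO_MATCH_def)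
  then show ?thesis by (simp add: insert_commute)
qed

text \<open>The normal vector supplies a fourth vertex \<open>a + N\<close> of a nondegenerate
  tetrahedron. The coordinate of \<open>d\<close> at that vertex is \<open>orient a b c d\<close> up
  to a factor, so it vanishes, and the other three coordinates express \<open>d\<close> by
  \<open>a\<close>, \<open>b\<close>, \<open>c\<close>.\<close>

lemma orient_eq_0_affine_hull:
  assumes "\<not> collinear {a,b,c}" "orient a b c d = 0" shows "d \<in> affine hull {a,b,c}"
proof -
  define N where "N = cross3 (b - a) (c - a)"
  have N0: "N \<noteq> 0" using assms(1) cross_0_imp_collinear unfolding N_def by blast
  have NN: "N \<bullet> N \<noteq> 0" using N0 by simp
  have o: "orient a b c (a + N) = N \<bullet> N" by (simp add: orient_def N_def)
  have "orient a b c (a+N) *\<^sub>R d = orient d b c (a+N) *\<^sub>R a + orient a d c (a+N) *\<^sub>R b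
     + orient a b d (a+N) *\<^sub>R c" using cramer_point[of a b c "a+N" d] assms(2) by simp
  moreover have "orient a b c (a+N) = orient d b c (a+N) + orient a d c (a+N) + orient a b d (a+N)"
    using orient_sum[of a b c "a+N" d] assms(2) by simp
  ultimately have 1: "(N\<bullet>N) *\<^sub>R d = orient d b c (a+N) *\<^sub>R a + orient a d c (a+N) *\<^sub>R b
     + orient a b d (a+N) *\<^sub>R c" and 2: "(N\<bullet>N) = orient d b c (a+N) + orient a d c (a+N) + orient a b d (a+N)"
    unfolding o by auto
  have "d = (1/(N\<bullet>N)) *\<^sub>R ((N\<bullet>N) *\<^sub>R d)" using NN by simp
  also have "\<dots> = (orient d b c (a+N)/(N\<bullet>N)) *\<^sub>R a + (orient a d c (a+N)/(N\<bullet>N)) *\<^sub>R b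
     + (orient a b d (a+N)/(N\<bullet>N)) *\<^sub>R c" unfolding 1 by (simp add: scaleR_add_right)
  finally show "d \<in> affine hull {a,b,c}" unfolding affine_hull_3
    using 2 NN by (auto simp: add_divide_distrib[symmetric] intro!: exI)
qed

lemma orient_eq_0_coplanar:
  assumes "orient a b c d = 0" shows "coplanar {a,b,c,d}"
proof (cases "collinear {a,b,c}")
  case True
  then obtain u v where "{a,b,c} \<subseteq> affine hull {u,v}" by (meson collinear_affine_hull)
  also have "\<dots> \<subseteq> affine hull {u,v,d}" by (rule hull_mono) auto
  finally have "{a,b,c,d} \<subseteq> affine hull {u,v,d}" by (auto simp: hull_inc)
  then show ?thesis unfolding coplanar_def by blast
next
  case False
  from orient_eq_0_affine_hull[OF False assms] show ?thesis
    unfolding coplanar_def by (intro exI[of _ a] exI[of _ b] exI[of _ c]) (auto simp: hull_inc)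
qed

lemma coplanar_iff_orient: "coplanar {a,b,c,d} \<longleftrightarrow> orient a b c d = 0"
  using orient_imp_not_coplanar orient_eq_0_coplanar by blast

lemma exists_orient:
  assumes "\<not> collinear {a,b,c}" obtains N where "N \<noteq> 0" "N \<bullet> (b - a) = 0" "N \<bullet> (c - a) = 0"
    "\<And>t. orient a b c (a + t *\<^sub>R N) = t * (N \<bullet> N)"
proof
  show "cross3 (b-a) (c-a) \<bullet> (b - a) = 0" "cross3 (b-a) (c-a) \<bullet> (c - a) = 0" by (simp_all add: dot_cross_self)
  show "orient a b c (a + t *\<^sub>R cross3 (b-a) (c-a)) = t * (cross3 (b-a) (c-a) \<bullet> cross3 (b-a) (c-a))" for t
    by (simp add: orient_def)
  show "cross3 (b-a) (c-a) \<noteq> 0" using assms cross_0_imp_collinear by blast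
qed

lemma affine_independent_orient:
  assumes "orient a b c d \<noteq> 0"
  shows "\<not> affine_dependent {a,b,c,d}" "distinct [a,b,c,d]"
proof -
  show d: "distinct [a,b,c,d]" using assms by (auto simp: orient_def dot_cross_self cross_refl)
  have nc: "\<not> coplanar {a,b,c,d}" using assms by (rule orient_imp_not_coplanar)
  show "\<not> affine_dependent {a,b,c,d}"
  proof
    assume "affine_dependent {a,b,c,d}"
    then obtain x where x: "x \<in> {a,b,c,d}" "x \<in> affine hull ({a,b,c,d} - {x})"
      unfolding affine_dependent_def by blast
    have "coplanar (affine hull ({a,b,c,d} - {x}))"
      unfolding coplanar_affine_hull_coplanar
    proof (rule coplanar_small)
      show "finite ({a,b,c,d} - {x})" by simp
      show "card ({a,b,c,d} - {x}) \<le> 3" using d x(1) by auto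
    qed
    moreover have "{a,b,c,d} \<subseteq> affine hull ({a,b,c,d} - {x})"
      using x(2) hull_subset[of "{a,b,c,d} - {x}" affine] by blast
    ultimately show False using nc coplanar_subset by blast
  qed
qed

section \<open>Tetrahedra in barycentric coordinates and separation by a plane\<close>

lemma convex_hull_4:
  fixes a b c d :: "'a::real_vector"
  shows "convex hull {a,b,c,d} = {u *\<^sub>R a + v *\<^sub>R b + w *\<^sub>R c + t *\<^sub>R d | u v w t. 0 \<le> u \<and> 0 \<le> v \<and> 0 \<le> w \<and> 0 \<le> t \<and> u + v + w + t = 1}"
  (is "?L = ?R")
proof -
  have 1: "?R \<subseteq> ?L"
  proof clarify
    fix u v w t :: real assume h: "0 \<le> u" "0 \<le> v" "0 \<le> w" "0 \<le> t" "u + v + w + t = 1"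
    have "(\<Sum>i\<in>{..<4}. [u,v,w,t] ! i *\<^sub>R [a,b,c,d] ! i) \<in> convex hull {a,b,c,d}"
      by (rule convex_sum) (use h in \<open>auto simp: lessThan_nat_numeral lessThan_Suc nth_Cons' hull_inc\<close>)
    then show "u *\<^sub>R a + v *\<^sub>R b + w *\<^sub>R c + t *\<^sub>R d \<in> convex hull {a,b,c,d}"
      by (simp add: lessThan_nat_numeral lessThan_Suc algebra_simps)
  qed
  have 2: "?L \<subseteq> ?R"
  proof (rule hull_minimal)
    show "{a,b,c,d} \<subseteq> ?R"
    proof -
      have "a \<in> ?R" by (rule CollectI, rule exI[of _ 1], rule exI[of _ 0], rule exI[of _ 0], rule exI[of _ 0]) simp
      moreover have "b \<in> ?R" by (rule CollectI, rule exI[of _ 0], rule exI[of _ 1], rule exI[of _ 0], rule exI[of _ 0]) simp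
      moreover have "c \<in> ?R" by (rule CollectI, rule exI[of _ 0], rule exI[of _ 0], rule exI[of _ 1], rule exI[of _ 0]) simp
      moreover have "d \<in> ?R" by (rule CollectI, rule exI[of _ 0], rule exI[of _ 0], rule exI[of _ 0], rule exI[of _ 1]) simp
      ultimately show ?thesis by blast
    qed
    show "convex ?R"
    proof (rule convexI)
      fix x y and s r :: real assume "x \<in> ?R" "y \<in> ?R" and sr: "0 \<le> s" "0 \<le> r" "s + r = 1"
      then obtain u v w t u' v' w' t' where
        x: "x = u *\<^sub>R a + v *\<^sub>R b + w *\<^sub>R c + t *\<^sub>R d" "0 \<le> u" "0 \<le> v" "0 \<le> w" "0 \<le> t" "u + v + w + t = 1" and
        y: "y = u' *\<^sub>R a + v' *\<^sub>R b + w' *\<^sub>R c + t' *\<^sub>R d" "0 \<le> u'" "0 \<le> v'" "0 \<le> w'" "0 \<le> t'" "u' + v' + w' + t' = 1"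
        by auto
      have "s *\<^sub>R x + r *\<^sub>R y = (s * u+r * u') *\<^sub>R a + (s * v+r * v') *\<^sub>R b + (s * w+r * w') *\<^sub>R c + (s * t+r * t') *\<^sub>R d"
        by (simp add: x(1) y(1) algebra_simps)
      moreover have "(s * u+r * u') + (s * v+r * v') + (s * w+r * w') + (s * t+r * t') = s * (u+v+w+t) + r * (u'+v'+w'+t')"
        by (simp add: algebra_simps)
      then have "(s * u+r * u') + (s * v+r * v') + (s * w+r * w') + (s * t+r * t') = 1" using x(6) y(6) sr by simp
      ultimately show "s *\<^sub>R x + r *\<^sub>R y \<in> ?R"
        using sr x(2-5) y(2-5) by (blast intro: add_nonneg_nonneg mult_nonneg_nonneg)
    qed
  qed
  show ?thesis using 1 2 by (rule equalityI[rotated])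
qed

lemma convex_hull_4I:
  fixes a b c d :: "'a::real_vector"
  assumes "0 \<le> u" "0 \<le> v" "0 \<le> w" "0 \<le> t" "u + v + w + t = 1"
  shows "u *\<^sub>R a + v *\<^sub>R b + w *\<^sub>R c + t *\<^sub>R d \<in> convex hull {a,b,c,d}"
  unfolding convex_hull_4
  by (rule CollectI, rule exI[of _ u], rule exI[of _ v], rule exI[of _ w], rule exI[of _ t]) (simp add: assms)

text \<open>The four quotients are the barycentric coordinates of \<open>x\<close>. Dividing by
  \<open>orient a b c z\<close> makes their signs independent of the orientation of the
  tetrahedron.\<close>

lemma in_tetrahedron_iff:
  assumes D: "orient a b c z \<noteq> 0"
  shows "x \<in> convex hull {a,b,c,z} \<longleftrightarrow>
    0 \<le> orient x b c z / orient a b c z \<and> 0 \<le> orient a x c z / orient a b c z \<and>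
    0 \<le> orient a b x z / orient a b c z \<and> 0 \<le> orient a b c x / orient a b c z"
proof
  assume "x \<in> convex hull {a,b,c,z}"
  then obtain u v w t where x: "x = u *\<^sub>R a + v *\<^sub>R b + w *\<^sub>R c + t *\<^sub>R z"
    and nn: "0 \<le> u" "0 \<le> v" "0 \<le> w" "0 \<le> t" and s: "u + v + w + t = 1"
    unfolding convex_hull_4 by blast
  show "0 \<le> orient x b c z / orient a b c z \<and> 0 \<le> orient a x c z / orient a b c z \<and>
    0 \<le> orient a b x z / orient a b c z \<and> 0 \<le> orient a b c x / orient a b c z"
    unfolding x orient_combination[OF s] using D nn by simp
next
  assume h: "0 \<le> orient x b c z / orient a b c z \<and> 0 \<le> orient a x c z / orient a b c z \<and>
    0 \<le> orient a b x z / orient a b c z \<and> 0 \<le> orient a b c x / orient a b c z"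
  define k where "k = orient a b c z"
  have k: "k \<noteq> 0" using D k_def by simp
  have "x = (1/k) *\<^sub>R (k *\<^sub>R x)" using k by simp
  also have "k *\<^sub>R x = orient x b c z *\<^sub>R a + orient a x c z *\<^sub>R b
     + orient a b x z *\<^sub>R c + orient a b c x *\<^sub>R z" unfolding k_def by (rule cramer_point)
  also have "(1/k) *\<^sub>R \<dots> = (orient x b c z / orient a b c z) *\<^sub>R a + (orient a x c z / orient a b c z) *\<^sub>R b
     + (orient a b x z / orient a b c z) *\<^sub>R c + (orient a b c x / orient a b c z) *\<^sub>R z"
    unfolding k_def[symmetric] by (simp add: scaleR_add_right)
  finally have e: "x = (orient x b c z / orient a b c z) *\<^sub>R a + (orient a x c z / orient a b c z) *\<^sub>R b
     + (orient a b x z / orient a b c z) *\<^sub>R c + (orient a b c x / orient a b c z) *\<^sub>R z" .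
  have "orient x b c z / orient a b c z + orient a x c z / orient a b c z
     + orient a b x z / orient a b c z + orient a b c x / orient a b c z = 1"
    using D orient_sum[of a b c z x] by (simp add: add_divide_distrib[symmetric])
  then show "x \<in> convex hull {a,b,c,z}"
    using h by (subst e, intro convex_hull_4I) auto
qed

text \<open>A weighted mean of values that are all at least \<open>k\<close> can be at most
  \<open>k\<close> only if every vertex with a larger value has weight 0.\<close>

lemma convex_hull_Int_halfspace:
  fixes l :: "'a::real_vector \<Rightarrow> real"
  assumes fin: "finite A" and l: "linear l" and A: "\<And>v. v \<in> A \<Longrightarrow> k \<le> l v"
  shows "convex hull A \<inter> {x. l x \<le> k} \<subseteq> convex hull {v\<in>A. l v = k}"
proof clarify
  fix x assume "x \<in> convex hull A" and x: "l x \<le> k"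
  then obtain u where u: "\<And>v. v\<in>A \<Longrightarrow> 0 \<le> u v" "sum u A = 1" "(\<Sum>v\<in>A. u v *\<^sub>R v) = x"
    unfolding convex_hull_finite[OF fin] by auto
  have "l x = (\<Sum>v\<in>A. u v * l v)" unfolding u(3)[symmetric] by (simp add: linear_sum[OF l] linear_cmul[OF l])
  then have "(\<Sum>v\<in>A. u v * (l v - k)) \<le> 0" using x u(2)
    by (simp add: algebra_simps sum_subtractf flip: sum_distrib_left)
  moreover have nn: "\<And>v. v\<in>A \<Longrightarrow> 0 \<le> u v * (l v - k)" using A u(1) by simp
  ultimately have "(\<Sum>v\<in>A. u v * (l v - k)) = 0" by (meson order_antisym sum_nonneg)
  then have z: "\<And>v. v\<in>A \<Longrightarrow> l v \<noteq> k \<Longrightarrow> u v = 0"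
    using sum_nonneg_eq_0_iff[OF fin nn] by auto
  have "sum u {v\<in>A. l v = k} = sum u A" "(\<Sum>v\<in>{v\<in>A. l v = k}. u v *\<^sub>R v) = (\<Sum>v\<in>A. u v *\<^sub>R v)"
    by (intro sum.mono_neutral_left; use fin in \<open>auto simp: z\<close>)+
  then show "x \<in> convex hull {v\<in>A. l v = k}" using fin u by (subst convex_hull_finite) (auto intro!: exI[of _ u])
qed

text \<open>The plane \<open>abc\<close> separates the two hulls, so a common point lies in it, and
  on each side only the vertices in that plane can contribute. The factor \<open>s\<close> selects
  the side, which covers both orientations at once.\<close>

lemma convex_hull_Int_separated:
  assumes fin: "finite A" "finite B"
    and A: "\<And>v. v \<in> A \<Longrightarrow> 0 \<le> s * orient a b c v" and B: "\<And>v. v \<in> B \<Longrightarrow> s * orient a b c v \<le> 0"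
  shows "convex hull A \<inter> convex hull B
    \<subseteq> convex hull {v\<in>A. s * orient a b c v = 0} \<inter> convex hull {v\<in>B. s * orient a b c v = 0}"
proof -
  define N where "N = s *\<^sub>R cross3 (b - a) (c - a)"
  have o: "s * orient a b c v = N \<bullet> v - N \<bullet> a" for v
    unfolding orient_def N_def by (simp add: inner_diff_right right_diff_distrib)
  have l: "linear (\<lambda>x. N \<bullet> x)" "linear (\<lambda>x. - (N \<bullet> x))"
    by (simp_all add: bounded_linear.linear bounded_linear_inner_right bounded_linear_minus)
  have "convex hull B \<subseteq> {x. N \<bullet> x \<le> N \<bullet> a}" using B o by (intro hull_minimal) (auto simp: convex_halfspace_le)
  moreover have "convex hull A \<subseteq> {x. N \<bullet> x \<ge> N \<bullet> a}" using A o by (intro hull_minimal) (auto simp: convex_halfspace_ge)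
  moreover have "convex hull A \<inter> {x. N \<bullet> x \<le> N \<bullet> a} \<subseteq> convex hull {v\<in>A. N \<bullet> v = N \<bullet> a}"
    by (rule convex_hull_Int_halfspace[OF fin(1) l(1)]) (use A o in auto)
  moreover have "convex hull B \<inter> {x. - (N \<bullet> x) \<le> - (N \<bullet> a)} \<subseteq> convex hull {v\<in>B. - (N \<bullet> v) = - (N \<bullet> a)}"
    by (rule convex_hull_Int_halfspace[OF fin(2) l(2)]) (use B o in auto)
  ultimately show ?thesis unfolding o by auto
qed

section \<open>Angles of a planar fan\<close>

definition angle_between :: "'a::real_inner \<Rightarrow> 'a \<Rightarrow> real" where
  "angle_between u v = arccos (u \<bullet> v / (norm u * norm v))"

lemma angle_between_arg:
  "- 1 \<le> u \<bullet> v / (norm u * norm v)" "u \<bullet> v / (norm u * norm v) \<le> 1"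
proof -
  have "\<bar>u \<bullet> v / (norm u * norm v)\<bar> \<le> 1"
    using Cauchy_Schwarz_ineq2[of u v] by (simp add: abs_mult divide_le_eq_1 zero_less_mult_iff) (metis abs_norm_cancel abs_mult mult_eq_0_iff norm_eq_zero)
  then show "- 1 \<le> u \<bullet> v / (norm u * norm v)" "u \<bullet> v / (norm u * norm v) \<le> 1" by linarith+
qed

lemma angle_between_commute: "angle_between u v = angle_between v u"
  by (simp add: angle_between_def inner_commute mult.commute)

lemma planar_polar:
  fixes u :: "real^2"
  assumes "u \<noteq> 0"
  obtains \<alpha> where "0 \<le> \<alpha>" "\<alpha> < 2 * pi" "u $ 1 = norm u * cos \<alpha>" "u $ 2 = norm u * sin \<alpha>"
proof -
  have n: "norm u > 0" using assms by simp
  have "(u$1)\<^sup>2 + (u$2)\<^sup>2 = (norm u)\<^sup>2"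
    by (simp add: norm_vec_def L2_set_def sum_2 power2_eq_square)
  then have "(u$1 / norm u)\<^sup>2 + (u$2 / norm u)\<^sup>2 = 1"
    using n by (simp add: power_divide add_divide_distrib[symmetric])
  then obtain \<alpha> where "0 \<le> \<alpha>" "\<alpha> < 2 * pi" "u$1 / norm u = cos \<alpha>" "u$2 / norm u = sin \<alpha>"
    by (metis sincos_total_2pi)
  with n show ?thesis by (intro that[of \<alpha>]) (simp_all add: field_simps)
qed

definition direction :: "real \<Rightarrow> real^2" where
  "direction t = vector [cos t, sin t]"

lemma direction_nth [simp]: "direction t $ 1 = cos t" "direction t $ 2 = sin t"
  by (simp_all add: direction_def)

lemma polar_direction:
  fixes u :: "real^2"
  assumes "u \<noteq> 0"
  obtains \<alpha> where "0 \<le> \<alpha>" "\<alpha> < 2 * pi" "u = norm u *\<^sub>R direction \<alpha>"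
proof -
  obtain \<alpha> where "0 \<le> \<alpha>" "\<alpha> < 2 * pi" "u $ 1 = norm u * cos \<alpha>" "u $ 2 = norm u * sin \<alpha>"
    using planar_polar[OF assms] .
  then show ?thesis by (intro that[of \<alpha>]) (simp_all add: vec_eq_iff forall_2)
qed

text \<open>The sign of the sine says that \<open>v\<close> is reached from \<open>u\<close>
  counterclockwise by less than a half turn; the angle then equals \<beta> - \<alpha> modulo a full
  turn, and the directions in between are positive combinations of \<open>u\<close> and
  \<open>v\<close>.\<close>

lemma sector_oriented:
  fixes u v :: "real^2"
  assumes u: "u = norm u *\<^sub>R direction \<alpha>" "u \<noteq> 0" and v: "v = norm v *\<^sub>R direction \<beta>" "v \<noteq> 0"
    and s: "0 < sin (\<beta> - \<alpha>)"
  shows "0 < angle_between u v" "angle_between u v < pi"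
    and "\<And>\<tau>. 0 < \<tau> \<Longrightarrow> \<tau> < angle_between u v \<Longrightarrow> \<exists>x>0. \<exists>y>0. direction (\<alpha> + \<tau>) = x *\<^sub>R u + y *\<^sub>R v"
proof -
  define \<gamma> where "\<gamma> = angle_between u v"
  have nz: "norm u > 0" "norm v > 0" using u v by auto
  have "u \<bullet> v = norm u * norm v * (direction \<alpha> \<bullet> direction \<beta>)"
    by (subst u(1), subst v(1)) simp
  also have "direction \<alpha> \<bullet> direction \<beta> = cos (\<beta> - \<alpha>)"
    by (simp add: inner_vec_def sum_2 cos_diff)
  finally have g: "\<gamma> = arccos (cos (\<beta> - \<alpha>))"
    using nz by (simp add: \<gamma>_def angle_between_def)
  have cg: "cos \<gamma> = cos (\<beta> - \<alpha>)" unfolding g by (simp add: cos_arccos)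
  have g0: "0 \<le> \<gamma>" "\<gamma> \<le> pi" unfolding g by (simp_all add: arccos_lbound arccos_ubound)
  have "sin \<gamma> = sqrt (1 - (cos (\<beta> - \<alpha>))\<^sup>2)" unfolding g by (rule sin_arccos) simp_all
  also have "1 - (cos (\<beta> - \<alpha>))\<^sup>2 = (sin (\<beta> - \<alpha>))\<^sup>2" by (simp add: sin_squared_eq)
  finally have sg: "sin \<gamma> = sin (\<beta> - \<alpha>)" using s by simp
  have "\<gamma> \<noteq> 0" "\<gamma> \<noteq> pi" using sg s by auto
  then show "0 < angle_between u v" "angle_between u v < pi" using g0 \<gamma>_def by auto
  have c: "cos \<beta> = cos (\<alpha> + \<gamma>)" "sin \<beta> = sin (\<alpha> + \<gamma>)"
  proof -
    have "\<beta> = \<alpha> + (\<beta> - \<alpha>)" by simp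
    then have "cos \<beta> = cos \<alpha> * cos (\<beta> - \<alpha>) - sin \<alpha> * sin (\<beta> - \<alpha>)"
      "sin \<beta> = sin \<alpha> * cos (\<beta> - \<alpha>) + cos \<alpha> * sin (\<beta> - \<alpha>)"
      by (metis cos_add, metis sin_add)
    then show "cos \<beta> = cos (\<alpha> + \<gamma>)" "sin \<beta> = sin (\<alpha> + \<gamma>)"
      by (simp_all add: cos_add sin_add cg sg)
  qed
  show "\<exists>x>0. \<exists>y>0. direction (\<alpha> + \<tau>) = x *\<^sub>R u + y *\<^sub>R v" if t: "0 < \<tau>" "\<tau> < angle_between u v" for \<tau>
  proof -
    \<comment> \<open>The coefficients come from the identity that sin \<gamma> times the direction
      \<alpha> + \<tau> is sin (\<gamma> - \<tau>) times the direction \<alpha> plus sin \<tau>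
      times the direction \<alpha> + \<gamma>.\<close>
    define A where "A = sin (\<gamma> - \<tau>) / (sin \<gamma> * norm u)"
    define B where "B = sin \<tau> / (sin \<gamma> * norm v)"
    have sp: "sin \<gamma> > 0" using s sg by simp
    have "sin (\<gamma> - \<tau>) > 0" "sin \<tau> > 0" using t g0 \<gamma>_def by (auto intro!: sin_gt_zero)
    then have "A > 0" "B > 0" unfolding A_def B_def using sp nz by auto
    moreover have "direction (\<alpha> + \<tau>) = A *\<^sub>R u + B *\<^sub>R v"
    proof -
      have "A *\<^sub>R u = (sin (\<gamma> - \<tau>) / sin \<gamma>) *\<^sub>R direction \<alpha>" "B *\<^sub>R v = (sin \<tau> / sin \<gamma>) *\<^sub>R direction \<beta>"
        using nz by (subst u(1), simp add: A_def) (subst v(1), use nz in \<open>simp add: B_def\<close>)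
      moreover have "sin \<gamma> * cos (\<alpha> + \<tau>) = sin (\<gamma> - \<tau>) * cos \<alpha> + sin \<tau> * cos (\<alpha> + \<gamma>)"
        "sin \<gamma> * sin (\<alpha> + \<tau>) = sin (\<gamma> - \<tau>) * sin \<alpha> + sin \<tau> * sin (\<alpha> + \<gamma>)"
        by (simp_all add: cos_add sin_add sin_diff algebra_simps)
      then have "cos (\<alpha> + \<tau>) = sin (\<gamma> - \<tau>) / sin \<gamma> * cos \<alpha> + sin \<tau> / sin \<gamma> * cos \<beta>"
        "sin (\<alpha> + \<tau>) = sin (\<gamma> - \<tau>) / sin \<gamma> * sin \<alpha> + sin \<tau> / sin \<gamma> * sin \<beta>"
        unfolding c using sp by (simp_all add: field_simps)
      ultimately show ?thesis by (simp add: vec_eq_iff forall_2)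
    qed
    ultimately show ?thesis by blast
  qed
qed

text \<open>Since \<open>angle_between\<close> is unoriented, the counterclockwise arc starts at
  \<open>u\<close> or at \<open>v\<close>, depending on the sign of a sine. Only its starting angle
  is returned.\<close>

lemma sector_directions:
  fixes u v :: "real^2"
  assumes indep: "\<And>x y. x *\<^sub>R u + y *\<^sub>R v = 0 \<Longrightarrow> x = 0 \<and> y = 0"
  obtains \<alpha> where "0 \<le> \<alpha>" "\<alpha> < 2 * pi" "0 < angle_between u v" "angle_between u v < pi"
    "\<And>\<tau>. 0 < \<tau> \<Longrightarrow> \<tau> < angle_between u v \<Longrightarrow> \<exists>x>0. \<exists>y>0. direction (\<alpha> + \<tau>) = x *\<^sub>R u + y *\<^sub>R v"
proof -
  have nz: "u \<noteq> 0" "v \<noteq> 0" using indep[of 1 0] indep[of 0 1] by auto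
  obtain \<alpha> where a: "0 \<le> \<alpha>" "\<alpha> < 2 * pi" "u = norm u *\<^sub>R direction \<alpha>" using polar_direction[OF nz(1)] .
  obtain \<beta> where b: "0 \<le> \<beta>" "\<beta> < 2 * pi" "v = norm v *\<^sub>R direction \<beta>" using polar_direction[OF nz(2)] .
  have "sin (\<beta> - \<alpha>) \<noteq> 0"
  proof
    assume "sin (\<beta> - \<alpha>) = 0"
    then have e: "sin \<beta> * cos \<alpha> = cos \<beta> * sin \<alpha>" by (simp add: sin_diff)
    have "direction \<beta> = cos (\<beta> - \<alpha>) *\<^sub>R direction \<alpha>"
    proof -
      have "cos \<beta> = (cos \<beta> * cos \<alpha> + sin \<beta> * sin \<alpha>) * cos \<alpha>" "sin \<beta> = (cos \<beta> * cos \<alpha> + sin \<beta> * sin \<alpha>) * sin \<alpha>"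
        using e sin_cos_squared_add[of \<alpha>] by (algebra, algebra)
      then show ?thesis by (simp add: vec_eq_iff forall_2 cos_diff)
    qed
    then have "v = (norm v * cos (\<beta> - \<alpha>)) *\<^sub>R direction \<alpha>" using b(3) by simp
    then have "norm u *\<^sub>R v = (norm v * cos (\<beta> - \<alpha>)) *\<^sub>R norm u *\<^sub>R direction \<alpha>"
      by (metis mult.commute scaleR_scaleR)
    then have "(norm v * cos (\<beta> - \<alpha>)) *\<^sub>R u + (- norm u) *\<^sub>R v = 0" using a(3) by simp
    then show False using indep nz by fastforce
  qed
  then consider "sin (\<beta> - \<alpha>) > 0" | "sin (\<alpha> - \<beta>) > 0" using sin_minus[of "\<beta> - \<alpha>"] by fastforce
  then show ?thesis
  proof cases
    case 1
    show ?thesis using that[OF a(1,2)] sector_oriented[OF a(3) nz(1) b(3) nz(2) 1] by blast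
  next
    case 2
    note s = sector_oriented[OF b(3) nz(2) a(3) nz(1) 2]
    show ?thesis
    proof (rule that[OF b(1,2)])
      show "0 < angle_between u v" "angle_between u v < pi" using s(1,2) by (simp_all add: angle_between_commute)
      show "\<exists>x>0. \<exists>y>0. direction (\<beta> + \<tau>) = x *\<^sub>R u + y *\<^sub>R v" if "0 < \<tau>" "\<tau> < angle_between u v" for \<tau>
        using s(3)[of \<tau>] that by (metis add.commute angle_between_commute)
    qed
  qed
qed

text \<open>An arc may wrap around past the angle \<open>2\<pi>\<close>; it is cut there into two intervals.\<close>

lemma disjoint_arcs_sum_le:
  fixes \<alpha> \<gamma> :: "'i \<Rightarrow> real"
  assumes fin: "finite I"
    and \<alpha>: "\<And>i. i \<in> I \<Longrightarrow> 0 \<le> \<alpha> i \<and> \<alpha> i < 2 * pi" and \<gamma>: "\<And>i. i \<in> I \<Longrightarrow> 0 < \<gamma> i \<and> \<gamma> i < pi"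
    and disj: "\<And>i j s t. i \<in> I \<Longrightarrow> j \<in> I \<Longrightarrow> i \<noteq> j \<Longrightarrow> 0 < s \<Longrightarrow> s < \<gamma> i \<Longrightarrow> 0 < t \<Longrightarrow> t < \<gamma> j
       \<Longrightarrow> direction (\<alpha> i + s) \<noteq> direction (\<alpha> j + t)"
  shows "(\<Sum>i\<in>I. \<gamma> i) \<le> 2 * pi"
proof -
  define A where "A = (\<lambda>i. {\<alpha> i <..< min (\<alpha> i + \<gamma> i) (2*pi)} \<union> {0 <..< \<alpha> i + \<gamma> i - 2*pi})"
  have Ad: "\<exists>s. 0 < s \<and> s < \<gamma> i \<and> direction x = direction (\<alpha> i + s)" if i: "i \<in> I" and x: "x \<in> A i" for i x
  proof -
    from x consider "\<alpha> i < x" "x < \<alpha> i + \<gamma> i" | "0 < x" "x < \<alpha> i + \<gamma> i - 2*pi" unfolding A_def by auto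
    then show ?thesis
    proof cases
      case 1 then show ?thesis by (intro exI[of _ "x - \<alpha> i"]) auto
    next
      case 2
      have "direction x = direction (x + 2 * pi)" by (simp add: direction_def)
      then show ?thesis using 2 \<alpha>[OF i] \<gamma>[OF i] by (intro exI[of _ "x + 2*pi - \<alpha> i"]) auto
    qed
  qed
  have dA: "disjoint_family_on A I"
    unfolding disjoint_family_on_def using Ad disj by (metis disjoint_iff)
  have m: "A i \<in> sets lborel" "emeasure lborel (A i) \<noteq> \<infinity>" "measure lborel (A i) = \<gamma> i" if i: "i \<in> I" for i
  proof -
    show "A i \<in> sets lborel" unfolding A_def by simp
    have s: "A i \<subseteq> {0..2*pi}" unfolding A_def using \<alpha>[OF i] \<gamma>[OF i] by auto
    show "emeasure lborel (A i) \<noteq> \<infinity>" using emeasure_mono[OF s, of lborel] by (auto simp: top_unique)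
    have fm: "emeasure lborel {p<..<q::real} \<noteq> \<infinity>" for p q
      using emeasure_bounded_finite[of "{p<..<q}"] by auto
    have "measure lborel (A i) = measure lborel {\<alpha> i <..< min (\<alpha> i + \<gamma> i) (2*pi)} + measure lborel {0 <..< \<alpha> i + \<gamma> i - 2*pi}"
      unfolding A_def by (rule measure_Union) (use \<alpha>[OF i] \<gamma>[OF i] fm in auto)
    also have "\<dots> = \<gamma> i" using \<alpha>[OF i] \<gamma>[OF i] by (cases "\<alpha> i + \<gamma> i \<le> 2 * pi") auto
    finally show "measure lborel (A i) = \<gamma> i" .
  qed
  have "(\<Sum>i\<in>I. \<gamma> i) = (\<Sum>i\<in>I. measure lborel (A i))" using m by simp
  also have "\<dots> = measure lborel (\<Union>i\<in>I. A i)"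
    by (rule measure_finite_Union[symmetric]) (use fin m dA in auto)
  also have "\<dots> \<le> measure lborel {0..2*pi}"
  proof (rule measure_mono_fmeasurable)
    show "(\<Union>i\<in>I. A i) \<subseteq> {0..2*pi}" unfolding A_def using \<alpha> \<gamma> by fastforce
    show "(\<Union>i\<in>I. A i) \<in> sets lborel" using fin m by auto
    show "{0..2*pi} \<in> fmeasurable lborel" by (simp add: fmeasurable_def)
  qed
  finally show ?thesis by simp
qed

text \<open>If two open sectors had a common direction, a short vector in it would lie in both
  triangles and yet on neither of the two sides of the first triangle at \<open>c0\<close>, against
  \<open>disj\<close>. So the sectors are disjoint arcs of directions.\<close>

lemma planar_fan_angle_sum:
  fixes u v :: "'i \<Rightarrow> real^2" and c0 :: "real^2"
  assumes fin: "finite I"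
    and indep: "\<And>i x y. i \<in> I \<Longrightarrow> x *\<^sub>R u i + y *\<^sub>R v i = 0 \<Longrightarrow> x = 0 \<and> y = 0"
    and disj: "\<And>i j. i \<in> I \<Longrightarrow> j \<in> I \<Longrightarrow> i \<noteq> j \<Longrightarrow>
      convex hull {c0, c0 + u i, c0 + v i} \<inter> convex hull {c0, c0 + u j, c0 + v j}
        \<subseteq> convex hull {c0, c0 + u i} \<or>
      convex hull {c0, c0 + u i, c0 + v i} \<inter> convex hull {c0, c0 + u j, c0 + v j}
        \<subseteq> convex hull {c0, c0 + v i}"
  shows "(\<Sum>i\<in>I. angle_between (u i) (v i)) \<le> 2 * pi"
proof -
  have "\<exists>\<alpha>. 0 \<le> \<alpha> \<and> \<alpha> < 2 * pi \<and> 0 < angle_between (u i) (v i) \<and> angle_between (u i) (v i) < pi \<and>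
    (\<forall>\<tau>. 0 < \<tau> \<longrightarrow> \<tau> < angle_between (u i) (v i) \<longrightarrow> (\<exists>x>0. \<exists>y>0. direction (\<alpha> + \<tau>) = x *\<^sub>R u i + y *\<^sub>R v i))"
    if "i \<in> I" for i
    using sector_directions[of "u i" "v i"] indep[OF that] by metis
  then obtain \<alpha> where \<alpha>: "\<And>i. i \<in> I \<Longrightarrow> 0 \<le> \<alpha> i \<and> \<alpha> i < 2 * pi \<and> 0 < angle_between (u i) (v i) \<and> angle_between (u i) (v i) < pi"
    "\<And>i \<tau>. i \<in> I \<Longrightarrow> 0 < \<tau> \<Longrightarrow> \<tau> < angle_between (u i) (v i) \<Longrightarrow> \<exists>x>0. \<exists>y>0. direction (\<alpha> i + \<tau>) = x *\<^sub>R u i + y *\<^sub>R v i"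
    by metis
  show ?thesis
  proof (rule disjoint_arcs_sum_le[OF fin, of \<alpha>])
    fix i j s t
    assume i: "i \<in> I" and j: "j \<in> I" and ij: "i \<noteq> j" and s: "0 < s" "s < angle_between (u i) (v i)"
      and t: "0 < t" "t < angle_between (u j) (v j)"
    show "direction (\<alpha> i + s) \<noteq> direction (\<alpha> j + t)"
    proof
      assume e: "direction (\<alpha> i + s) = direction (\<alpha> j + t)"
      obtain x y where xy: "x > 0" "y > 0" "direction (\<alpha> i + s) = x *\<^sub>R u i + y *\<^sub>R v i" using \<alpha>(2)[OF i s] by blast
      obtain x' y' where xy': "x' > 0" "y' > 0" "direction (\<alpha> i + s) = x' *\<^sub>R u j + y' *\<^sub>R v j"
        using \<alpha>(2)[OF j t] e by metis
      \<comment> \<open>All four scaled coefficients sum to 1, so each of the two pairs sums to less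
        than 1 and the point \<open>w\<close> belongs to both triangles.\<close>
      define k where "k = 1 / (x + y + x' + y')"
      have k: "k > 0" "k * (x + y + x' + y') = 1" unfolding k_def using xy xy' by auto
      define w where "w = c0 + (k * x) *\<^sub>R u i + (k * y) *\<^sub>R v i"
      have w': "w = c0 + (k * x') *\<^sub>R u j + (k * y') *\<^sub>R v j"
      proof -
        have "w = c0 + k *\<^sub>R direction (\<alpha> i + s)" unfolding w_def xy(3) by (simp add: scaleR_add_right)
        then show ?thesis unfolding xy'(3) by (simp add: scaleR_add_right)
      qed
      have tri: "c0 + p *\<^sub>R a + q *\<^sub>R b \<in> convex hull {c0, c0 + a, c0 + b}" if "0 \<le> p" "0 \<le> q" "p + q \<le> 1" for p q :: real and a b :: "real^2"
      proof -
        have "c0 + p *\<^sub>R a + q *\<^sub>R b = (1 - p - q) *\<^sub>R c0 + p *\<^sub>R (c0 + a) + q *\<^sub>R (c0 + b)" by (simp add: algebra_simps)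
        moreover have "0 \<le> 1 - p - q" using that by simp
        ultimately show ?thesis unfolding convex_hull_3 using that
          by (intro CollectI exI[of _ "1-p-q"] exI[of _ p] exI[of _ q]) auto
      qed
      have ks: "k * x + k * y + k * x' + k * y' = 1" "k*x>0" "k*y>0" "k*x'>0" "k*y'>0" using k xy xy' by (simp_all add: algebra_simps)
      have "w \<in> convex hull {c0, c0 + u i, c0 + v i}" unfolding w_def by (rule tri) (use ks in linarith)+
      moreover have "w \<in> convex hull {c0, c0 + u j, c0 + v j}" unfolding w' by (rule tri) (use ks in linarith)+
      ultimately have "w \<in> convex hull {c0, c0 + u i} \<or> w \<in> convex hull {c0, c0 + v i}" using disj[OF i j ij] by blast
      then show False
      proof
        assume "w \<in> convex hull {c0, c0 + u i}"
        then obtain r where "w = c0 + r *\<^sub>R u i" by (auto simp: convex_hull_2_alt)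
        then have "(k * x - r) *\<^sub>R u i + (k * y) *\<^sub>R v i = 0" unfolding w_def by (simp add: algebra_simps)
        then show False using indep[OF i] ks by fastforce
      next
        assume "w \<in> convex hull {c0, c0 + v i}"
        then obtain r where "w = c0 + r *\<^sub>R v i" by (auto simp: convex_hull_2_alt)
        then have "(k * x) *\<^sub>R u i + (k * y - r) *\<^sub>R v i = 0" unfolding w_def by (simp add: algebra_simps)
        then show False using indep[OF i] ks by fastforce
      qed
    qed
  qed (use \<alpha>(1) in auto)
qed

section \<open>Counting pieces\<close>

definition joined :: "('a \<Rightarrow> 'a \<Rightarrow> bool) \<Rightarrow> 'a set \<Rightarrow> 'a set set" where
  "joined R F = {{g \<in> F. R\<^sup>*\<^sup>* f g} | f. f \<in> F}"

lemma joined_image: "joined R F = (\<lambda>f. {g \<in> F. R\<^sup>*\<^sup>* f g}) ` F"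
  unfolding joined_def by blast

lemma finite_joined: "finite F \<Longrightarrow> finite (joined R F)"
  by (simp add: joined_image)

lemma rtranclp_symp: "symp R \<Longrightarrow> R\<^sup>*\<^sup>* x y \<Longrightarrow> R\<^sup>*\<^sup>* y x"
  by (metis symp_rtranclp sympD)

text \<open>A new link merges at most the class of \<open>a\<close> with the class of
  \<open>b\<close>. Once the class of \<open>a\<close> is set aside, sending an
  \<open>R\<close>-class to the \<open>R'\<close>-class around it is injective.\<close>

lemma card_joined_add_link:
  fixes R R' :: "'a \<Rightarrow> 'a \<Rightarrow> bool"
  assumes fin: "finite F" and sR: "symp R" and pF: "a \<in> F" "b \<in> F"
    and R': "\<And>x y. R' x y \<Longrightarrow> R x y \<or> (x = a \<and> y = b) \<or> (x = b \<and> y = a)"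
    and sR': "symp R'" and sub: "\<And>x y. R x y \<Longrightarrow> R' x y"
  shows "card (joined R F) \<le> card (joined R' F) + 1"
proof -
  let ?c = "\<lambda>f. {g \<in> F. R\<^sup>*\<^sup>* f g}" and ?c' = "\<lambda>f. {g \<in> F. R'\<^sup>*\<^sup>* f g}"
  have le: "R'\<^sup>*\<^sup>* x y" if "R\<^sup>*\<^sup>* x y" for x y
    using that sub by (metis (no_types, lifting) mono_rtranclp)
  \<comment> \<open>Cut the path at its uses of the new link: the part before the first use ends in
    \<open>a\<close> or \<open>b\<close>, and the part after the last use starts there.\<close>
  have path: "R\<^sup>*\<^sup>* x y \<or> (R\<^sup>*\<^sup>* x a \<or> R\<^sup>*\<^sup>* x b) \<and> (R\<^sup>*\<^sup>* a y \<or> R\<^sup>*\<^sup>* b y)" if "R'\<^sup>*\<^sup>* x y" for x y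
    using that
  proof (induction rule: rtranclp_induct)
    case base then show ?case by simp
  next
    case (step y z)
    from R'[OF step(2)] show ?case
    proof (elim disjE)
      assume "R y z" then show ?thesis using step.IH by (meson rtranclp.rtrancl_into_rtrancl)
    next
      assume "y = a \<and> z = b" then show ?thesis using step.IH by blast
    next
      assume "y = b \<and> z = a" then show ?thesis using step.IH by blast
    qed
  qed
  have eqc: "?c x = ?c y" if "R\<^sup>*\<^sup>* x y" for x y
    using that rtranclp_symp[OF sR] by (metis (no_types, lifting) rtranclp_trans)
  \<comment> \<open>The choice of a representative is harmless: \<open>hc\<close> only records that
    it lies in the same \<open>R\<close>-class.\<close>
  define h where "h = (\<lambda>X. ?c' (SOME x. x \<in> X))"
  have hc: "\<exists>y. y \<in> F \<and> R\<^sup>*\<^sup>* x y \<and> h (?c x) = ?c' y" if "x \<in> F" for x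
  proof -
    have "x \<in> ?c x" using that by simp
    then have "(SOME y. y \<in> ?c x) \<in> ?c x" by (rule someI)
    then show ?thesis unfolding h_def by blast
  qed
  have "card (joined R F - {?c a}) \<le> card (joined R' F)"
  proof (rule card_inj_on_le[where f = h])
    show "finite (joined R' F)" by (rule finite_joined[OF fin])
    have "h X \<in> joined R' F" if "X \<in> joined R F" for X
    proof -
      from that obtain x where x: "x \<in> F" "X = ?c x" unfolding joined_def by blast
      from hc[OF x(1)] obtain y where "y \<in> F" "h (?c x) = ?c' y" by blast
      then show ?thesis unfolding joined_def x(2) by blast
    qed
    then show "h ` (joined R F - {?c a}) \<subseteq> joined R' F" by (intro image_subsetI) simp
    show "inj_on h (joined R F - {?c a})"
    proof (rule inj_onI)
      fix X Y assume X: "X \<in> joined R F - {?c a}" and Y: "Y \<in> joined R F - {?c a}" and e: "h X = h Y"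
      obtain x where x: "x \<in> F" "X = ?c x" using X unfolding joined_def by blast
      obtain y where y: "y \<in> F" "Y = ?c y" using Y unfolding joined_def by blast
      obtain x' where x': "x' \<in> F" "R\<^sup>*\<^sup>* x x'" "h X = ?c' x'" using hc[OF x(1)] x(2) by blast
      obtain y' where y': "y' \<in> F" "R\<^sup>*\<^sup>* y y'" "h Y = ?c' y'" using hc[OF y(1)] y(2) by blast
      have X': "X = ?c x'" and Y': "Y = ?c y'" using eqc x y x'(2) y'(2) by blast+
      have "y' \<in> ?c' x'" using e x'(3) y'(3) y'(1) by auto
      then have "R'\<^sup>*\<^sup>* x' y'" by simp
      from path[OF this] show "X = Y"
      proof
        assume "R\<^sup>*\<^sup>* x' y'" then show ?thesis using eqc X' Y' by blast
      next
        assume h: "(R\<^sup>*\<^sup>* x' a \<or> R\<^sup>*\<^sup>* x' b) \<and> (R\<^sup>*\<^sup>* a y' \<or> R\<^sup>*\<^sup>* b y')"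
        have "\<not> R\<^sup>*\<^sup>* x' a" using eqc X X' by blast
        moreover have "\<not> R\<^sup>*\<^sup>* a y'" using eqc[of a y'] Y Y' by blast
        ultimately have "R\<^sup>*\<^sup>* x' b" "R\<^sup>*\<^sup>* b y'" using h by blast+
        then show ?thesis using eqc X' Y' by blast
      qed
    qed
  qed
  moreover have "card (joined R F) \<le> card (joined R F - {?c a}) + 1"
    by (metis card_Diff_singleton card_Diff_singleton_if diff_le_self le_diff_conv add.commute le_add1 le_trans order_refl)
  ultimately show ?thesis by simp
qed

text \<open>Without labels every element is its own class, and each label merges at most two classes
  because \<open>two\<close> lets it link a single pair. This is the bound by vertices minus edges
  on the number of components of a graph.\<close>

lemma card_joined_ge:
  fixes link :: "'e \<Rightarrow> 'a \<Rightarrow> 'a \<Rightarrow> bool"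
  assumes fin: "finite F" "finite U" and sym: "\<And>e. symp (link e)"
    and uniq: "\<And>e x y. e \<in> U \<Longrightarrow> link e x y \<Longrightarrow> x \<in> F \<and> y \<in> F"
    and two: "\<And>e x y x' y'. e \<in> U \<Longrightarrow> link e x y \<Longrightarrow> link e x' y' \<Longrightarrow> {x',y'} = {x,y}"
  shows "card F \<le> card (joined (\<lambda>x y. \<exists>e\<in>U. link e x y) F) + card U"
  using fin(2) uniq two
proof (induction U rule: finite_induct)
  case empty
  have "joined (\<lambda>x y. \<exists>e\<in>{}. link e x y) F = (\<lambda>f. {f}) ` F"
  proof -
    have "(\<lambda>x y. \<exists>e\<in>({}::'e set). link e x y)\<^sup>*\<^sup>* f g \<longleftrightarrow> f = g" for f g
      by (auto elim: rtranclp.cases)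
    then show ?thesis unfolding joined_image by auto
  qed
  then show ?case by (simp add: card_image)
next
  case (insert e U)
  let ?R = "\<lambda>x y. \<exists>e\<in>U. link e x y" and ?R' = "\<lambda>x y. \<exists>e'\<in>insert e U. link e' x y"
  have IH: "card F \<le> card (joined ?R F) + card U"
    by (rule insert.IH) (use insert.prems in blast)+
  have sR: "symp ?R" "symp ?R'" using sym by (auto simp: symp_def)
  have "card (joined ?R F) \<le> card (joined ?R' F) + 1"
  proof (cases "\<exists>a b. link e a b")
    case True
    then obtain a b where ab: "link e a b" by blast
    have abF: "a \<in> F" "b \<in> F" using insert.prems(1)[of e a b] ab by auto
    show ?thesis
    proof (rule card_joined_add_link[OF fin(1) sR(1) abF _ sR(2)])
      fix x y assume "?R' x y"
      then show "?R x y \<or> (x = a \<and> y = b) \<or> (x = b \<and> y = a)"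
        using insert.prems(2)[of e a b x y] ab by (auto simp: doubleton_eq_iff)
    qed auto
  next
    case False
    then have "?R' = ?R" by (intro ext) auto
    then show ?thesis by simp
  qed
  then show ?case using IH insert.hyps by simp
qed

text \<open>The faces are the vertices of the dual graph and the uncut edges its links. A link is
  labelled by the intersection of its two faces, and since an edge lies in exactly two faces its
  label stands for one pair.\<close>

lemma card_pieces_ge:
  assumes fin: "finite F" and c3: "\<And>f. f \<in> F \<Longrightarrow> card f = 3"
    and two: "\<And>e. e \<in> tri_edges F \<Longrightarrow> card {f\<in>F. e \<subseteq> f} = 2"
    and finE: "finite (tri_edges F)"
  shows "card F \<le> card (pieces F C) + card (tri_edges F - C)"
proof -
  define link where "link = (\<lambda>e f g. f \<in> F \<and> g \<in> F \<and> f \<noteq> g \<and> f \<inter> g = e)"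
  have "uncut_adj F C = (\<lambda>x y. \<exists>e\<in>tri_edges F - C. link e x y)"
  proof (intro ext iffI)
    fix x y assume "uncut_adj F C x y"
    then have "x \<inter> y \<in> tri_edges F - C" "link (x \<inter> y) x y"
      unfolding uncut_adj_def link_def tri_edges_def by blast+
    then show "\<exists>e\<in>tri_edges F - C. link e x y" by blast
  next
    fix x y assume "\<exists>e\<in>tri_edges F - C. link e x y"
    then show "uncut_adj F C x y" unfolding uncut_adj_def link_def tri_edges_def by auto
  qed
  then have "pieces F C = joined (\<lambda>x y. \<exists>e\<in>tri_edges F - C. link e x y) F"
    unfolding pieces_def joined_def by simp
  moreover have "card F \<le> card (joined (\<lambda>x y. \<exists>e\<in>tri_edges F - C. link e x y) F) + card (tri_edges F - C)"
  proof (rule card_joined_ge[OF fin])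
    show "finite (tri_edges F - C)" using finE by simp
    show "symp (link e)" for e unfolding link_def symp_def by blast
    show "x \<in> F \<and> y \<in> F" if "link e x y" for e x y using that unfolding link_def by blast
    show "{x',y'} = {x,y}" if e: "e \<in> tri_edges F - C" and l: "link e x y" "link e x' y'" for e x y x' y'
    proof -
      have c: "card {f\<in>F. e \<subseteq> f} = 2" using two e by blast
      then have f: "finite {f\<in>F. e \<subseteq> f}" by (metis card.infinite zero_neq_numeral)
      have "{x,y} \<subseteq> {f\<in>F. e \<subseteq> f}" "{x',y'} \<subseteq> {f\<in>F. e \<subseteq> f}" using l unfolding link_def by auto
      moreover have "card {x,y} = 2" "card {x',y'} = 2" using l unfolding link_def by auto
      ultimately have "{x,y} = {f\<in>F. e \<subseteq> f}" "{x',y'} = {f\<in>F. e \<subseteq> f}"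
        using card_subset_eq[OF f] c by metis+
      then show ?thesis by simp
    qed
  qed
  ultimately show ?thesis by simp
qed

section \<open>A hat has at least four cut edges\<close>

abbreviation "corner_angle p j i k \<equiv> angle_between (p j - p i) (p k - (p i :: real^3))"

section \<open>Layouts of the faces around a vertex\<close>

definition around :: "nat set set \<Rightarrow> nat set set \<Rightarrow> nat \<Rightarrow> nat set \<Rightarrow> nat set \<Rightarrow> bool" where
  "around F C i = (\<lambda>x y. uncut_adj F C x y \<and> i \<in> x \<inter> y)\<^sup>*\<^sup>*"

lemma around_sym: "around F C i f g \<Longrightarrow> around F C i g f"
  unfolding around_def by (rule rtranclp_symp) (auto simp: symp_def uncut_adj_def Int_commute)

lemma around_trans: "around F C i f g \<Longrightarrow> around F C i g h \<Longrightarrow> around F C i f h"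
  unfolding around_def by (rule rtranclp_trans)

lemma around_refl: "around F C i f f"
  unfolding around_def by simp

lemma around_step:
  assumes "{i,j,k} \<in> F" "{i,j,l} \<in> F" "distinct [i,j,k,l]" "{i,j} \<notin> C"
  shows "around F C i {i,j,k} {i,j,l}"
proof -
  have e: "{i,j,k} \<inter> {i,j,l} = {i,j}" "{i,j,k} \<noteq> {i,j,l}" using assms(3) by auto
  then have "uncut_adj F C {i,j,k} {i,j,l}" using assms unfolding uncut_adj_def e(1) by simp
  then show ?thesis unfolding around_def by (intro r_into_rtranclp) simp
qed

lemma valid_layout_dist:
  assumes "valid_layout p F C P q" "f \<in> P" "i \<in> f" "j \<in> f"
  shows "dist (q f i) (q f j) = dist (p i) (p j)"
  using assms(1)[unfolded valid_layout_def, THEN conjunct1] assms(2-4) by (elim ballE) auto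

lemma valid_layout_agree:
  assumes "valid_layout p F C P q" "f \<in> P" "g \<in> P" "uncut_adj F C f g" "i \<in> f \<inter> g"
  shows "q f i = q g i"
  using assms(1)[unfolded valid_layout_def, THEN conjunct2, THEN conjunct1, rule_format, OF assms(2-5)] .

lemma valid_layout_inj:
  assumes "valid_layout p F C P q" "f \<in> P" "g \<in> P" "i \<in> f" "j \<in> g" "q f i = q g j"
  shows "i = j"
  using assms(1)[unfolded valid_layout_def, THEN conjunct2, THEN conjunct2, THEN conjunct1, rule_format, OF assms(2-6)]
  by (rule conjunct1)

lemma valid_layout_Int:
  assumes "valid_layout p F C P q" "f \<in> P" "g \<in> P"
  shows "convex hull (q f ` f) \<inter> convex hull (q g ` g) = convex hull (q f ` f \<inter> q g ` g)"
  using assms(1)[unfolded valid_layout_def, THEN conjunct2, THEN conjunct2, THEN conjunct2, THEN conjunct1, rule_format, OF assms(2-3)] .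

text \<open>Crossing an uncut edge at \<open>i\<close> keeps the planar position of
  \<open>i\<close>. Hence all faces reached by turning around \<open>i\<close> belong to one piece
  and share one planar point, the centre of the fan.\<close>

lemma around_layout:
  assumes v: "valid_edge_unfolding p F C" and f: "f \<in> F" and i: "i \<in> f"
  obtains P q where "valid_layout p F C P q" "\<And>g. around F C i f g \<Longrightarrow> g \<in> P \<and> q g i = q f i \<and> i \<in> g"
proof -
  define P where "P = {g \<in> F. (uncut_adj F C)\<^sup>*\<^sup>* f g}"
  have "P \<in> pieces F C" unfolding P_def pieces_def using f by blast
  then obtain q where q: "valid_layout p F C P q" using v unfolding valid_edge_unfolding_def by blast
  have fP: "f \<in> P" unfolding P_def using f by simp
  have "g \<in> P \<and> q g i = q f i \<and> i \<in> g" if "around F C i f g" for g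
    using that unfolding around_def
  proof (induction rule: rtranclp_induct)
    case base show ?case using fP i by simp
  next
    case (step g h)
    then have u: "uncut_adj F C g h" "i \<in> g \<inter> h" by auto
    then have hP: "h \<in> P" using step.IH unfolding P_def uncut_adj_def by (auto intro: rtranclp.rtrancl_into_rtrancl simp: uncut_adj_def)
    then have "q g i = q h i" using valid_layout_agree[OF q _ _ u] step.IH by simp
    then show ?case using hP step.IH u by simp
  qed
  then show ?thesis using that q by blast
qed

lemma isometry_inner:
  fixes a b c :: "'a::real_inner" and a' b' c' :: "'b::real_inner"
  assumes "dist a b = dist a' b'" "dist a c = dist a' c'" "dist b c = dist b' c'"
  shows "(b - a) \<bullet> (c - a) = (b' - a') \<bullet> (c' - a')"
proof -
  have e: "(b - a) \<bullet> (c - a) = ((dist a b)\<^sup>2 + (dist a c)\<^sup>2 - (dist b c)\<^sup>2) / 2" for a b c :: "'c::real_inner"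
    by (simp add: dist_norm power2_norm_eq_inner inner_diff_left inner_diff_right inner_commute)
  show ?thesis unfolding e assms ..
qed

text \<open>The layout carries the fan to planar triangles with a common corner and the same angles.
  Two different faces of the fan differ in a vertex other than \<open>i\<close>; its image is no
  corner of the other triangle, so the triangles meet within a side at the common corner, as
  \<open>planar_fan_angle_sum\<close> demands.\<close>

lemma fan_angle_sum:
  assumes v: "valid_edge_unfolding p F C"
    and fin: "finite J" and f0: "f0 \<in> F" "i \<in> f0"
    and J: "\<And>j k. (j,k) \<in> J \<Longrightarrow> distinct [i,j,k] \<and> \<not> collinear {p i, p j, p k} \<and> around F C i f0 {i,j,k}"
    and inj: "inj_on (\<lambda>(j,k). {i,j,k}) J"
  shows "(\<Sum>(j,k)\<in>J. corner_angle p j i k) \<le> 2 * pi"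
proof -
  obtain P q where q: "valid_layout p F C P q"
    and P: "\<And>g. around F C i f0 g \<Longrightarrow> g \<in> P \<and> q g i = q f0 i \<and> i \<in> g"
    using around_layout[OF v f0] by blast
  define A where "A = q f0 i"
  define face where "face = (\<lambda>(j,k). {i,j,k})"
  define u where "u = (\<lambda>t. q (face t) (fst t) - A)"
  define w where "w = (\<lambda>t. q (face t) (snd t) - A)"
  have faceP: "face t \<in> P" "q (face t) i = A" if t: "t \<in> J" for t
  proof -
    have "around F C i f0 (face t)" using J[of "fst t" "snd t"] t by (simp add: face_def case_prod_beta)
    from P[OF this] show "face t \<in> P" "q (face t) i = A" unfolding A_def by auto
  qed
  have iso: "dist (q f r) (q f s) = dist (p r) (p s)" if "f \<in> P" "r \<in> f" "s \<in> f" for f r s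
    by (rule valid_layout_dist[OF q that])
  have inn: "u t \<bullet> u t = (p (fst t) - p i) \<bullet> (p (fst t) - p i)"
    "u t \<bullet> w t = (p (fst t) - p i) \<bullet> (p (snd t) - p i)"
    "w t \<bullet> w t = (p (snd t) - p i) \<bullet> (p (snd t) - p i)" if t: "t \<in> J" for t
  proof -
    have m: "i \<in> face t" "fst t \<in> face t" "snd t \<in> face t" by (simp_all add: face_def case_prod_beta)
    note d = iso[OF faceP(1)[OF t]]
    show "u t \<bullet> u t = (p (fst t) - p i) \<bullet> (p (fst t) - p i)"
      "u t \<bullet> w t = (p (fst t) - p i) \<bullet> (p (snd t) - p i)"
      "w t \<bullet> w t = (p (snd t) - p i) \<bullet> (p (snd t) - p i)"
      unfolding u_def w_def faceP(2)[OF t, symmetric] using d m by (intro isometry_inner; simp)+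
  qed
  have "(\<Sum>t\<in>J. angle_between (u t) (w t)) \<le> 2 * pi"
  proof (rule planar_fan_angle_sum[OF fin, where ?c0.0 = A])
    fix t x y assume t: "t \<in> J" and z: "x *\<^sub>R u t + y *\<^sub>R w t = 0"
    define a where "a = p (fst t) - p i"
    define b where "b = p (snd t) - p i"
    \<comment> \<open>Linear independence passes from space to the plane through the Gram matrix:
      the squared length of a combination depends only on inner products, and these are
      preserved.\<close>
    have quad: "(x *\<^sub>R a + y *\<^sub>R b) \<bullet> (x *\<^sub>R a + y *\<^sub>R b) = x * x * (a \<bullet> a) + 2 * x * y * (a \<bullet> b) + y * y * (b \<bullet> b)"
      for a b :: "'c::real_inner"
      by (simp add: inner_add_left inner_add_right inner_commute[of b a]) (simp add: algebra_simps)
    have "(x *\<^sub>R a + y *\<^sub>R b) \<bullet> (x *\<^sub>R a + y *\<^sub>R b) = (x *\<^sub>R u t + y *\<^sub>R w t) \<bullet> (x *\<^sub>R u t + y *\<^sub>R w t)"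
      unfolding quad inn[OF t] a_def b_def ..
    then have ab: "x *\<^sub>R a + y *\<^sub>R b = 0" using z by simp
    have nc: "\<not> collinear {p i, p (fst t), p (snd t)}" using J[of "fst t" "snd t"] t by simp
    have "collinear {0, a, b}" if "x \<noteq> 0 \<or> y \<noteq> 0"
    proof (cases "x = 0")
      case True
      then have "b = 0" using ab that by simp
      then show ?thesis by (simp add: insert_commute)
    next
      case False
      then have "a = (1 / x) *\<^sub>R (x *\<^sub>R a)" by simp
      also have "x *\<^sub>R a = (- y) *\<^sub>R b" using ab by (simp add: eq_neg_iff_add_eq_0)
      finally have "a = (- y / x) *\<^sub>R b" by simp
      then show ?thesis by (metis collinear_lemma insert_commute)
    qed
    moreover have "collinear {p i, p (fst t), p (snd t)}" if "collinear {0, a, b}"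
    proof -
      have "collinear {p (fst t), p i, p (snd t)}"
        using that unfolding a_def b_def by (subst collinear_3) (simp_all add: NO_MATCH_def)
      then show ?thesis by (simp add: insert_commute)
    qed
    ultimately show "x = 0 \<and> y = 0" using nc by blast
  next
    fix s t assume st: "s \<in> J" "t \<in> J" "s \<noteq> t"
    have hs: "q (face r) ` face r = {A, A + u r, A + w r}" if "r \<in> J" for r
      using faceP(2)[OF that] unfolding u_def w_def by (auto simp: face_def case_prod_beta)
    define X where "X = q (face s) ` face s \<inter> q (face t) ` face t"
    have I: "convex hull {A, A + u s, A + w s} \<inter> convex hull {A, A + u t, A + w t} = convex hull X"
      unfolding X_def hs[OF st(1), symmetric] hs[OF st(2), symmetric]
      by (rule valid_layout_Int[OF q faceP(1)[OF st(1)] faceP(1)[OF st(2)]])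
    have ne: "face s \<noteq> face t" using inj_onD[OF inj _ st(1,2)] st(3) unfolding face_def by argo
    have c3: "card (face r) = 3" if "r \<in> J" for r
      using J[of "fst r" "snd r"] that by (simp add: face_def case_prod_beta)
    \<comment> \<open>Both faces have three vertices, so distinctness yields a vertex of
      \<open>s\<close> outside \<open>t\<close>; the injectivity clause of the layout keeps its
      image out of \<open>X\<close>.\<close>
    have "\<not> face s \<subseteq> face t"
      using ne c3[OF st(1)] c3[OF st(2)] by (metis card.infinite card_subset_eq zero_neq_numeral)
    then obtain m where m: "m \<in> face s" "m \<notin> face t" by blast
    have mX: "q (face s) m \<notin> X"
    proof
      assume "q (face s) m \<in> X"
      then obtain m' where "m' \<in> face t" "q (face s) m = q (face t) m'" unfolding X_def by auto
      then have "m = m'" using valid_layout_inj[OF q faceP(1)[OF st(1)] faceP(1)[OF st(2)] m(1)] by blast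
      with \<open>m' \<in> face t\<close> m(2) show False by simp
    qed
    have "i \<in> face t" by (simp add: face_def case_prod_beta)
    then have "m = fst s \<or> m = snd s" using m by (auto simp: face_def case_prod_beta)
    then have "A + u s \<notin> X \<or> A + w s \<notin> X" using mX unfolding u_def w_def by auto
    moreover have "X \<subseteq> {A, A + u s, A + w s}" unfolding X_def hs[OF st(1)] by blast
    ultimately have "X \<subseteq> {A, A + u s} \<or> X \<subseteq> {A, A + w s}" by blast
    then show "convex hull {A, A + u s, A + w s} \<inter> convex hull {A, A + u t, A + w t} \<subseteq> convex hull {A, A + u s} \<or>
      convex hull {A, A + u s, A + w s} \<inter> convex hull {A, A + u t, A + w t} \<subseteq> convex hull {A, A + w s}"
      unfolding I by (meson hull_mono)
  qed
  moreover have "(\<Sum>t\<in>J. angle_between (u t) (w t)) = (\<Sum>(j,k)\<in>J. corner_angle p j i k)"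
  proof (rule sum.cong)
    fix t assume t: "t \<in> J"
    show "angle_between (u t) (w t) = (case t of (j,k) \<Rightarrow> corner_angle p j i k)"
      unfolding angle_between_def case_prod_beta norm_eq_sqrt_inner inn[OF t] ..
  qed simp
  ultimately show ?thesis by simp
qed

text \<open>The expression is the Gram determinant, which vanishes because three vectors in a plane
  are dependent. In space \<open>gram_triple\<close> evaluates the same expression to the squared
  volume.\<close>

lemma planar_gram_zero:
  fixes u v w :: "real^2"
  shows "(u \<bullet> u) * ((v \<bullet> v) * (w \<bullet> w) - (v \<bullet> w) * (v \<bullet> w)) - (u \<bullet> v) * ((u \<bullet> v) * (w \<bullet> w) - (v \<bullet> w) * (u \<bullet> w))
    + (u \<bullet> w) * ((u \<bullet> v) * (v \<bullet> w) - (v \<bullet> v) * (u \<bullet> w)) = 0"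
  by (simp add: inner_vec_def sum_2 algebra_simps)

lemma gram_triple:
  fixes u v w :: "real^3"
  shows "(u \<bullet> u) * ((v \<bullet> v) * (w \<bullet> w) - (v \<bullet> w) * (v \<bullet> w)) - (u \<bullet> v) * ((u \<bullet> v) * (w \<bullet> w) - (v \<bullet> w) * (u \<bullet> w))
    + (u \<bullet> w) * ((u \<bullet> v) * (v \<bullet> w) - (v \<bullet> v) * (u \<bullet> w)) = (cross3 u v \<bullet> w)\<^sup>2"
proof -
  have "\<exists>a1 a2 a3 b1 b2 b3 c1 c2 c3. u$1 = a1 \<and> u$2=a2 \<and> u$3=a3 \<and> v$1=b1 \<and> v$2=b2 \<and> v$3=b3 \<and> w$1=c1 \<and> w$2=c2 \<and> w$3=c3" by blast
  then obtain a1 a2 a3 b1 b2 b3 c1 c2 c3 where e: "u$1 = a1" "u$2=a2" "u$3=a3" "v$1=b1" "v$2=b2" "v$3=b3" "w$1=c1" "w$2=c2" "w$3=c3" by blast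
  show ?thesis unfolding cross3_def inner_vec_def sum_3 e vector_3 inner_real_def power2_eq_square by (simp add: e algebra_simps)
qed

text \<open>With all three edges at \<open>z\<close> uncut, every pair among \<open>z\<close>,
  \<open>a\<close>, \<open>b\<close>, \<open>c\<close> lies in one of the three faces laid out
  together. All six distances are therefore realised in the plane, and the Gram determinant of the
  three edge vectors vanishes.\<close>

lemma tip_not_flat:
  assumes v: "valid_edge_unfolding p F C"
    and F: "{z,a,b} \<in> F" and d: "distinct [z,a,b,c]"
    and ar: "around F C z {z,a,b} {z,a,c}" "around F C z {z,a,b} {z,b,c}"
    and unc: "{z,a} \<notin> C" "{z,b} \<notin> C" "{z,c} \<notin> C" and F': "{z,a,c} \<in> F" "{z,b,c} \<in> F"
  shows "orient (p z) (p a) (p b) (p c) = 0"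
proof -
  obtain P q where q: "valid_layout p F C P q"
    and P: "\<And>g. around F C z {z,a,b} g \<Longrightarrow> g \<in> P \<and> q g z = q {z,a,b} z \<and> z \<in> g"
    using around_layout[OF v F] by blast
  define A where "A = q {z,a,b} z"
  have mem: "{z,a,b} \<in> P" "{z,a,c} \<in> P" "{z,b,c} \<in> P" using P around_refl ar by blast+
  have iso: "dist (q f r) (q f s) = dist (p r) (p s)" if "f \<in> P" "r \<in> f" "s \<in> f" for f r s
    by (rule valid_layout_dist[OF q that])
  have adj: "uncut_adj F C {z,a,b} {z,a,c}" "uncut_adj F C {z,a,b} {z,b,c}" "uncut_adj F C {z,a,c} {z,b,c}"
  proof -
    have "{z,a,b} \<inter> {z,a,c} = {z,a}" "{z,a,b} \<inter> {z,b,c} = {z,b}" "{z,a,c} \<inter> {z,b,c} = {z,c}" using d by auto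
    then show "uncut_adj F C {z,a,b} {z,a,c}" "uncut_adj F C {z,a,b} {z,b,c}" "uncut_adj F C {z,a,c} {z,b,c}"
      unfolding uncut_adj_def using F F' unc d by auto
  qed
  have agree: "q f r = q g r" if "f \<in> P" "g \<in> P" "uncut_adj F C f g" "r \<in> f \<inter> g" for f g r
    by (rule valid_layout_agree[OF q that])
  have e: "q {z,a,b} z = q {z,a,c} z" "q {z,b,c} z = q {z,a,c} z" "q {z,a,b} a = q {z,a,c} a" "q {z,a,b} b = q {z,b,c} b" "q {z,a,c} c = q {z,b,c} c"
    using agree[OF mem(1,2) adj(1), of z] agree[OF mem(2,3) adj(3), of z] agree[OF mem(1,2) adj(1), of a]
       agree[OF mem(1,3) adj(2), of b] agree[OF mem(2,3) adj(3), of c] by auto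
  define u v w where "u = q {z,a,c} a - q {z,a,c} z" and "v = q {z,b,c} b - q {z,a,c} z" and "w = q {z,a,c} c - q {z,a,c} z"
  define u' v' w' where "u' = p a - p z" and "v' = p b - p z" and "w' = p c - p z"
  have "dist (q {z,a,c} z) (q {z,a,c} a) = dist (p z) (p a)" "dist (q {z,a,c} z) (q {z,a,c} c) = dist (p z) (p c)"
     "dist (q {z,a,c} a) (q {z,a,c} c) = dist (p a) (p c)" using iso[OF mem(2)] by auto
  moreover have "dist (q {z,a,c} z) (q {z,b,c} b) = dist (p z) (p b)" "dist (q {z,b,c} b) (q {z,a,c} c) = dist (p b) (p c)"
    using iso[OF mem(3), of z b] iso[OF mem(3), of b c] e by auto
  moreover have "dist (q {z,a,c} a) (q {z,b,c} b) = dist (p a) (p b)" using iso[OF mem(1), of a b] e by auto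
  ultimately have "u \<bullet> u = u' \<bullet> u'" "v \<bullet> v = v' \<bullet> v'" "w \<bullet> w = w' \<bullet> w'" "u \<bullet> v = u' \<bullet> v'" "v \<bullet> w = v' \<bullet> w'" "u \<bullet> w = u' \<bullet> w'"
    unfolding u_def v_def w_def u'_def v'_def w'_def by (intro isometry_inner; simp)+
  then have "(cross3 u' v' \<bullet> w')\<^sup>2 = 0"
    using planar_gram_zero[of u v w] unfolding gram_triple[symmetric] by simp
  then show ?thesis unfolding orient_def u'_def v'_def w'_def by simp
qed

section \<open>The combinatorics of a hat\<close>

definition hat_faces :: "nat \<Rightarrow> nat \<Rightarrow> nat \<Rightarrow> nat \<Rightarrow> nat \<Rightarrow> nat \<Rightarrow> nat set set" where
  "hat_faces a b c x y z = {{x,b,c}, {x,a,c}, {x,b,y}, {y,a,b}, {x,y,z}, {x,a,z}, {y,a,z}}"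

text \<open>The sides of the base triangle \<open>abc\<close> are left out: neighbouring hats share
  them, so they are counted once with the base polyhedron.\<close>

definition hat_edges :: "nat \<Rightarrow> nat \<Rightarrow> nat \<Rightarrow> nat \<Rightarrow> nat \<Rightarrow> nat \<Rightarrow> nat set set" where
  "hat_edges a b c x y z = {{x,a}, {x,b}, {x,c}, {y,a}, {y,b}, {x,y}, {x,z}, {y,z}, {z,a}}"

definition hat_shape :: "(nat \<Rightarrow> real^3) \<Rightarrow> nat \<Rightarrow> nat \<Rightarrow> nat \<Rightarrow> nat \<Rightarrow> nat \<Rightarrow> nat \<Rightarrow> bool" where
  "hat_shape p a b c x y z \<longleftrightarrow>
     2 * pi < corner_angle p z x a + corner_angle p a x c + corner_angle p c x b + corner_angle p b x y \<and>
     2 * pi < corner_angle p z y a + corner_angle p a y b + corner_angle p b y x \<and>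
     orient (p z) (p a) (p x) (p y) \<noteq> 0"

text \<open>Around \<open>x\<close> the faces are \<open>xza\<close>, \<open>xac\<close>,
  \<open>xcb\<close>, \<open>xby\<close>, \<open>xyz\<close>, separated by \<open>xa\<close>,
  \<open>xc\<close>, \<open>xb\<close>, \<open>xy\<close>, \<open>xz\<close> in this order. The
  first four do not fit together in the plane, so one of \<open>xa\<close>, \<open>xc\<close>,
  \<open>xb\<close> is cut; if \<open>xy\<close> and \<open>xz\<close> are uncut, the way round
  through \<open>xyz\<close> forces a second cut among these three. The same reasoning applies to
  the four faces around \<open>y\<close>, and the tip \<open>z\<close> needs a cut of its
  own.\<close>

lemma hat_uncut_le_5:
  assumes v: "valid_edge_unfolding p F C" and H: "hat_faces a b c x y z \<subseteq> F" and d: "distinct [a,b,c,x,y,z]"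
    and nc: "\<And>f. f \<in> F \<Longrightarrow> \<not> collinear (p ` f)" and hat: "hat_shape p a b c x y z"
  shows "card (hat_edges a b c x y z - C) \<le> 5"
proof -
  have ne: "a \<noteq> b" "a \<noteq> c" "a \<noteq> x" "a \<noteq> y" "a \<noteq> z" "b \<noteq> c" "b \<noteq> x" "b \<noteq> y" "b \<noteq> z"
    "c \<noteq> x" "c \<noteq> y" "c \<noteq> z" "x \<noteq> y" "x \<noteq> z" "y \<noteq> z" using d by auto
  have inF: "{x,b,c} \<in> F" "{x,a,c} \<in> F" "{x,b,y} \<in> F" "{y,a,b} \<in> F" "{x,y,z} \<in> F" "{x,a,z} \<in> F" "{y,a,z} \<in> F"
    using H unfolding hat_faces_def by auto
  \<comment> \<open>Only membership in one fan counts here, whichever way round \<open>x\<close> the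
    faces are connected; \<open>X1\<close> to \<open>X4\<close> list the ways.\<close>
  have X: "\<not> (around F C x {x,z,a} {x,a,c} \<and> around F C x {x,z,a} {x,c,b} \<and> around F C x {x,z,a} {x,b,y})"
  proof
    assume ar: "around F C x {x,z,a} {x,a,c} \<and> around F C x {x,z,a} {x,c,b} \<and> around F C x {x,z,a} {x,b,y}"
    have "(\<Sum>(j,k)\<in>{(z,a),(a,c),(c,b),(b,y)}. corner_angle p j x k) \<le> 2 * pi"
    proof (rule fan_angle_sum[OF v, where ?f0.0 = "{x,z,a}"])
      show "{x,z,a} \<in> F" using inF by (simp add: insert_commute)
      have "{x,z,a} \<noteq> {x,a,c}" "{x,z,a} \<noteq> {x,c,b}" "{x,z,a} \<noteq> {x,b,y}"
        by (rule notI, drule arg_cong[where f = "\<lambda>S. z \<in> S"], use d in auto)+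
      moreover have "{x,a,c} \<noteq> {x,c,b}" "{x,a,c} \<noteq> {x,b,y}"
        by (rule notI, drule arg_cong[where f = "\<lambda>S. a \<in> S"], use d in auto)+
      moreover have "{x,c,b} \<noteq> {x,b,y}"
        by (rule notI, drule arg_cong[where f = "\<lambda>S. c \<in> S"], use d in auto)
      ultimately show "inj_on (\<lambda>(j,k). {x,j,k}) {(z,a),(a,c),(c,b),(b,y)}" by (simp add: inj_on_def)
      show "distinct [x,j,k] \<and> \<not> collinear {p x, p j, p k} \<and> around F C x {x,z,a} {x,j,k}"
        if "(j,k) \<in> {(z,a),(a,c),(c,b),(b,y)}" for j k
        using that d ar around_refl[of F C x "{x,z,a}"] nc[OF inF(1)] nc[OF inF(2)] nc[OF inF(3)] nc[OF inF(6)]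
        by (auto simp: insert_commute)
    qed auto
    then show False using hat d unfolding hat_shape_def by simp
  qed
  have Y: "\<not> (around F C y {y,z,a} {y,a,b} \<and> around F C y {y,z,a} {y,b,x})"
  proof
    assume ar: "around F C y {y,z,a} {y,a,b} \<and> around F C y {y,z,a} {y,b,x}"
    have "(\<Sum>(j,k)\<in>{(z,a),(a,b),(b,x)}. corner_angle p j y k) \<le> 2 * pi"
    proof (rule fan_angle_sum[OF v, where ?f0.0 = "{y,z,a}"])
      show "{y,z,a} \<in> F" using inF by (simp add: insert_commute)
      have "{y,z,a} \<noteq> {y,a,b}" "{y,z,a} \<noteq> {y,b,x}"
        by (rule notI, drule arg_cong[where f = "\<lambda>S. z \<in> S"], use d in auto)+
      moreover have "{y,a,b} \<noteq> {y,b,x}"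
        by (rule notI, drule arg_cong[where f = "\<lambda>S. a \<in> S"], use d in auto)
      ultimately show "inj_on (\<lambda>(j,k). {y,j,k}) {(z,a),(a,b),(b,x)}" by (simp add: inj_on_def)
      show "distinct [y,j,k] \<and> \<not> collinear {p y, p j, p k} \<and> around F C y {y,z,a} {y,j,k}"
        if "(j,k) \<in> {(z,a),(a,b),(b,x)}" for j k
        using that d ar around_refl[of F C y "{y,z,a}"] nc[OF inF(4)] nc[OF inF(3)] nc[OF inF(7)]
        by (auto simp: insert_commute)
    qed auto
    then show False using hat d unfolding hat_shape_def by simp
  qed
  have Z: "\<not> ({x,z} \<notin> C \<and> {y,z} \<notin> C \<and> {z,a} \<notin> C)"
  proof
    assume u: "{x,z} \<notin> C \<and> {y,z} \<notin> C \<and> {z,a} \<notin> C"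
    have "around F C z {z,a,x} {z,a,y}"
      by (rule around_step) (use inF d u in \<open>auto simp: insert_commute\<close>)
    moreover have "around F C z {z,x,a} {z,x,y}"
      by (rule around_step) (use inF d u in \<open>auto simp: insert_commute\<close>)
    ultimately have "orient (p z) (p a) (p x) (p y) = 0"
      by (intro tip_not_flat[OF v]) (use inF d u in \<open>auto simp: insert_commute\<close>)
    then show False using hat unfolding hat_shape_def by simp
  qed
  have sx: "{x,a} \<notin> C \<Longrightarrow> around F C x {x,z,a} {x,a,c}" "{x,c} \<notin> C \<Longrightarrow> around F C x {x,a,c} {x,c,b}"
    "{x,b} \<notin> C \<Longrightarrow> around F C x {x,c,b} {x,b,y}" "{x,y} \<notin> C \<Longrightarrow> around F C x {x,b,y} {x,y,z}"
    "{x,z} \<notin> C \<Longrightarrow> around F C x {x,y,z} {x,z,a}"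
    using around_step[of x a z F c C] around_step[of x c a F b C] around_step[of x b c F y C]
      around_step[of x y b F z C] around_step[of x z y F a C] inF d by (auto simp: insert_commute)
  have sy: "{y,a} \<notin> C \<Longrightarrow> around F C y {y,z,a} {y,a,b}" "{y,b} \<notin> C \<Longrightarrow> around F C y {y,a,b} {y,b,x}"
    "{x,y} \<notin> C \<Longrightarrow> around F C y {y,b,x} {y,x,z}" "{y,z} \<notin> C \<Longrightarrow> around F C y {y,x,z} {y,z,a}"
    using around_step[of y a z F b C] around_step[of y b a F x C] around_step[of y x b F z C]
      around_step[of y z x F a C] inF d by (auto simp: insert_commute)
  \<comment> \<open>Indicators of uncut edges turn the prohibited combinations into linear
    inequalities.\<close>
  define U where "U = (\<lambda>e. if e \<in> C then 0 else (1::nat))"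
  have U1: "U e \<le> 1" for e unfolding U_def by simp
  note T = around_trans and S = around_sym
  have X1: "\<not> ({x,a} \<notin> C \<and> {x,c} \<notin> C \<and> {x,b} \<notin> C)"
  proof (rule notI, elim conjE)
    assume h: "{x,a} \<notin> C" "{x,c} \<notin> C" "{x,b} \<notin> C"
    note 2 = T[OF sx(1)[OF h(1)] sx(2)[OF h(2)]]
    show False using X sx(1)[OF h(1)] 2 T[OF 2 sx(3)[OF h(3)]] by simp
  qed
  have X2: "\<not> ({x,c} \<notin> C \<and> {x,b} \<notin> C \<and> {x,y} \<notin> C \<and> {x,z} \<notin> C)"
  proof (rule notI, elim conjE)
    assume h: "{x,c} \<notin> C" "{x,b} \<notin> C" "{x,y} \<notin> C" "{x,z} \<notin> C"
    note 4 = T[OF S[OF sx(5)[OF h(4)]] S[OF sx(4)[OF h(3)]]]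
    note 3 = T[OF 4 S[OF sx(3)[OF h(2)]]]
    show False using X 4 3 T[OF 3 S[OF sx(2)[OF h(1)]]] by simp
  qed
  have X3: "\<not> ({x,a} \<notin> C \<and> {x,b} \<notin> C \<and> {x,y} \<notin> C \<and> {x,z} \<notin> C)"
  proof (rule notI, elim conjE)
    assume h: "{x,a} \<notin> C" "{x,b} \<notin> C" "{x,y} \<notin> C" "{x,z} \<notin> C"
    note 4 = T[OF S[OF sx(5)[OF h(4)]] S[OF sx(4)[OF h(3)]]]
    show False using X 4 T[OF 4 S[OF sx(3)[OF h(2)]]] sx(1)[OF h(1)] by simp
  qed
  have X4: "\<not> ({x,a} \<notin> C \<and> {x,c} \<notin> C \<and> {x,y} \<notin> C \<and> {x,z} \<notin> C)"
  proof (rule notI, elim conjE)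
    assume h: "{x,a} \<notin> C" "{x,c} \<notin> C" "{x,y} \<notin> C" "{x,z} \<notin> C"
    note 4 = T[OF S[OF sx(5)[OF h(4)]] S[OF sx(4)[OF h(3)]]]
    show False using X 4 sx(1)[OF h(1)] T[OF sx(1)[OF h(1)] sx(2)[OF h(2)]] by simp
  qed
  have Y1: "\<not> ({y,a} \<notin> C \<and> {y,b} \<notin> C)"
    using Y sy(1) T[OF sy(1) sy(2)] by blast
  have Y2: "\<not> ({y,b} \<notin> C \<and> {x,y} \<notin> C \<and> {y,z} \<notin> C)"
  proof (rule notI, elim conjE)
    assume h: "{y,b} \<notin> C" "{x,y} \<notin> C" "{y,z} \<notin> C"
    note 3 = T[OF S[OF sy(4)[OF h(3)]] S[OF sy(3)[OF h(2)]]]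
    show False using Y 3 T[OF 3 S[OF sy(2)[OF h(1)]]] by simp
  qed
  have Y3: "\<not> ({y,a} \<notin> C \<and> {x,y} \<notin> C \<and> {y,z} \<notin> C)"
  proof (rule notI, elim conjE)
    assume h: "{y,a} \<notin> C" "{x,y} \<notin> C" "{y,z} \<notin> C"
    show False using Y sy(1)[OF h(1)] T[OF S[OF sy(4)[OF h(3)]] S[OF sy(3)[OF h(2)]]] by simp
  qed
  have cx: "U {x,a} + U {x,c} + U {x,b} \<le> 2" "U {x,c} + U {x,b} + U {x,y} + U {x,z} \<le> 3"
    "U {x,a} + U {x,b} + U {x,y} + U {x,z} \<le> 3" "U {x,a} + U {x,c} + U {x,y} + U {x,z} \<le> 3"
    using X1 X2 X3 X4 unfolding U_def by (simp_all split: if_splits) blast+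
  have cy: "U {y,a} + U {y,b} \<le> 1" "U {y,b} + U {x,y} + U {y,z} \<le> 2" "U {y,a} + U {x,y} + U {y,z} \<le> 2"
    using Y1 Y2 Y3 unfolding U_def by (simp_all split: if_splits) blast+
  have cz: "U {x,z} + U {y,z} + U {z,a} \<le> 2" using Z unfolding U_def by (auto split: if_splits)
  have "card (hat_edges a b c x y z - C) = (\<Sum>e\<in>hat_edges a b c x y z. U e)"
  proof -
    have "(\<Sum>e\<in>hat_edges a b c x y z. U e) = (\<Sum>e\<in>hat_edges a b c x y z - C. 1)"
      unfolding U_def by (rule sum.mono_neutral_cong_right) (auto simp: hat_edges_def)
    then show ?thesis by simp
  qed
  also have "\<dots> = U {x,a} + U {x,b} + U {x,c} + U {y,a} + U {y,b} + U {x,y} + U {x,z} + U {y,z} + U {z,a}"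
    unfolding hat_edges_def by (simp add: doubleton_eq_iff ne ne[symmetric] add.assoc)
  \<comment> \<open>If \<open>xy\<close> is cut, three further cuts lie in the disjoint groups
    \<open>xa\<close>, \<open>xb\<close>, \<open>xc\<close>; \<open>ya\<close>, \<open>yb\<close>;
    and \<open>xz\<close>, \<open>yz\<close>, \<open>za\<close>. If it is uncut, two of
    \<open>ya\<close>, \<open>yb\<close>, \<open>yz\<close> and two of \<open>xa\<close>,
    \<open>xb\<close>, \<open>xc\<close>, \<open>xz\<close> are cut.\<close>
  also have "\<dots> \<le> 5"
  proof (cases "U {x,y} = 0")
    case True
    then show ?thesis using cx(1) cy(1) cz by linarith
  next
    case False
    then have xy: "U {x,y} = 1" using U1[of "{x,y}"] by simp
    have "U {y,a} + U {y,b} + U {y,z} \<le> 1"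
    proof (cases "U {y,z} = 0")
      case True then show ?thesis using cy(1) by simp
    next
      case False then show ?thesis using cy(2,3) xy by linarith
    qed
    moreover have "U {x,a} + U {x,b} + U {x,c} + U {x,z} \<le> 2"
    proof (cases "U {x,z} = 0")
      case True then show ?thesis using cx(1) by simp
    next
      case False
      then have xz: "U {x,z} = 1" using U1[of "{x,z}"] by simp
      have "U {x,a} + U {x,b} + U {x,c} \<le> 1"
        using cx(2-4) xy xz by linarith
      then show ?thesis using xz by simp
    qed
    ultimately show ?thesis using xy U1[of "{z,a}"] by linarith
  qed
  finally show ?thesis .
qed

section \<open>Gluing a tetrahedron to a solid\<close>

lemma continuous_on_orient [continuous_intros]:
  fixes f g h k :: "'a::t2_space \<Rightarrow> real^3"
  assumes "continuous_on X f" "continuous_on X g" "continuous_on X h" "continuous_on X k"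
  shows "continuous_on X (\<lambda>t. orient (f t) (g t) (h t) (k t))"
  unfolding orient_def using assms by (intro continuous_on_inner continuous_on_cross continuous_on_diff)

text \<open>At a relative interior point of the triangle the other three coordinates are positive,
  hence also nearby, so near \<open>y\<close> only the side of the plane decides membership.\<close>

lemma tetrahedron_neighbourhood:
  assumes D: "orient a b c z \<noteq> 0" and y: "y = u *\<^sub>R a + v *\<^sub>R b + w *\<^sub>R c" "0 < u" "0 < v" "0 < w" "u + v + w = 1"
  obtains r where "r > 0" "\<And>x. x \<in> ball y r \<Longrightarrow> 0 \<le> orient a b c x / orient a b c z \<Longrightarrow> x \<in> convex hull {a,b,c,z}"
proof -
  define A where "A = {x. 0 < orient x b c z / orient a b c z} \<inter> {x. 0 < orient a x c z / orient a b c z}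
     \<inter> {x. 0 < orient a b x z / orient a b c z}"
  have s: "u + v + w + 0 = 1" using y by simp
  have y': "y = u *\<^sub>R a + v *\<^sub>R b + w *\<^sub>R c + 0 *\<^sub>R z" using y by simp
  have "y \<in> A" unfolding A_def y' using orient_combination[OF s] D y(2-4) by simp
  moreover have "open A"
    unfolding A_def using D by (intro open_Int open_Collect_less continuous_intros) auto
  ultimately obtain r where r: "r > 0" "ball y r \<subseteq> A" using open_contains_ball by blast
  show ?thesis
  proof (rule that[OF r(1)])
    fix x assume "x \<in> ball y r" "0 \<le> orient a b c x / orient a b c z"
    then show "x \<in> convex hull {a,b,c,z}" using r(2) unfolding in_tetrahedron_iff[OF D] A_def by force
  qed
qed

lemma hull3_orient_0: "x \<in> convex hull {a,b,c} \<Longrightarrow> orient a b c x = 0"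
  using affine_hull_3_orient convex_hull_subset_affine_hull by blast

lemma orient_segment:
  "orient a b c ((1 - t) *\<^sub>R x + t *\<^sub>R y) = (1 - t) * orient a b c x + t * orient a b c y"
proof -
  have "(1 - t) *\<^sub>R x + t *\<^sub>R y - a = (1 - t) *\<^sub>R (x - a) + t *\<^sub>R (y - a)" by (simp add: algebra_simps)
  then show ?thesis unfolding orient_def by (simp add: inner_add_right)
qed

text \<open>If both apexes were on the same side, a point just above the centroid would lie in both
  tetrahedra, thus in the intersection with \<open>S\<close>, which is only the triangle; but it is
  off the plane.\<close>

lemma opposite_sides:
  assumes D: "orient a b c z \<noteq> 0" "orient a b c v \<noteq> 0"
    and KS: "convex hull {a,b,c,z} \<inter> S = convex hull {a,b,c}" and I: "convex hull {a,b,c,v} \<subseteq> S"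
  shows "orient a b c v / orient a b c z < 0"
proof (rule ccontr)
  assume "\<not> orient a b c v / orient a b c z < 0"
  then have pos: "orient a b c v / orient a b c z > 0" using D by (simp add: not_less order_less_le)
  define y where "y = (1/3) *\<^sub>R a + (1/3) *\<^sub>R b + (1/3) *\<^sub>R c"
  obtain r where r: "r > 0" "\<And>x. x \<in> ball y r \<Longrightarrow> 0 \<le> orient a b c x / orient a b c z \<Longrightarrow> x \<in> convex hull {a,b,c,z}"
    using tetrahedron_neighbourhood[OF D(1) y_def] by auto
  obtain s where s: "s > 0" "\<And>x. x \<in> ball y s \<Longrightarrow> 0 \<le> orient a b c x / orient a b c v \<Longrightarrow> x \<in> convex hull {a,b,c,v}"
    using tetrahedron_neighbourhood[OF D(2) y_def] by auto
  have y0: "orient a b c y = 0"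
    using orient_combination(1)[of "1/3" "1/3" "1/3" 0 a b c z] unfolding y_def by simp
  have "((\<lambda>t. (1 - t) *\<^sub>R y + t *\<^sub>R z) \<longlongrightarrow> (1 - 0) *\<^sub>R y + 0 *\<^sub>R z) (at_right 0)"
    by (intro tendsto_intros)
  then have "\<forall>\<^sub>F t in at_right 0. dist ((1 - t) *\<^sub>R y + t *\<^sub>R z) y < min r s"
    using tendstoD[of _ _ _ "min r s"] r(1) s(1) by fastforce
  moreover have "\<forall>\<^sub>F t in at_right (0::real). 0 < t" by (simp add: eventually_at_right_less)
  ultimately have "\<forall>\<^sub>F t in at_right 0. dist ((1 - t) *\<^sub>R y + t *\<^sub>R z) y < min r s \<and> 0 < t"
    by (rule eventually_conj)
  then obtain t where t: "dist ((1 - t) *\<^sub>R y + t *\<^sub>R z) y < min r s" "0 < t"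
    using eventually_happens trivial_limit_at_right_real by (metis (no_types, lifting))
  define x where "x = (1 - t) *\<^sub>R y + t *\<^sub>R z"
  have ox: "orient a b c x = t * orient a b c z" unfolding x_def orient_segment y0 by simp
  have xb: "x \<in> ball y r" "x \<in> ball y s" using t unfolding x_def by (auto simp: dist_commute)
  have "x \<in> convex hull {a,b,c,z}" using r(2)[OF xb(1)] ox D t by simp
  moreover have "0 \<le> orient a b c x / orient a b c v" unfolding ox using pos t D
    by (auto simp: zero_le_divide_iff zero_less_divide_iff zero_le_mult_iff mult_le_0_iff)
  then have "x \<in> convex hull {a,b,c,v}" using s(2)[OF xb(2)] by simp
  ultimately have "x \<in> convex hull {a,b,c}" using KS I by blast
  then show False using hull3_orient_0 ox t D by fastforce
qed

lemma frontier_tetrahedron: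
  assumes D: "orient a b c z \<noteq> 0"
  shows "frontier (convex hull {a,b,c,z}) = convex hull {a,b,c} \<union> convex hull {a,b,z} \<union> convex hull {a,c,z} \<union> convex hull {b,c,z}"
proof -
  have d: "distinct [a,b,c,z]" and i: "\<not> affine_dependent {a,b,c,z}" using affine_independent_orient[OF D] by auto
  have c: "card {a,b,c,z} = 4" using d by simp
  have e: "{a,b,c,z} - {a} = {b,c,z}" "{a,b,c,z} - {b} = {a,c,z}" "{a,b,c,z} - {c} = {a,b,z}" "{a,b,c,z} - {z} = {a,b,c}"
    using d by auto
  have "frontier (convex hull {a,b,c,z}) = \<Union>{convex hull ({a,b,c,z} - {x}) |x. x \<in> {a,b,c,z}}"
    using frontier_convex_hull_cases[OF i] c by simp
  also have "\<dots> = (\<Union>x\<in>{a,b,c,z}. convex hull ({a,b,c,z} - {x}))" by blast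
  finally show ?thesis unfolding UN_insert e by auto
qed

text \<open>The triangle \<open>abc\<close> disappears from the frontier because, next to a point of its relative
  interior, the new tetrahedron fills one side and the room inside \<open>S\<close> the other.\<close>

lemma frontier_Un_tetrahedron:
  assumes S: "closed S" and fS: "frontier S = convex hull {a,b,c} \<union> R"
    and RT: "R \<inter> convex hull {a,b,c} \<subseteq> convex hull {a,b} \<union> convex hull {a,c} \<union> convex hull {b,c}"
    and D: "orient a b c z \<noteq> 0" "orient a b c v \<noteq> 0"
    and KS: "convex hull {a,b,c,z} \<inter> S = convex hull {a,b,c}" and I: "convex hull {a,b,c,v} \<subseteq> S"
  shows "frontier (S \<union> convex hull {a,b,c,z}) = R \<union> (convex hull {a,b,z} \<union> convex hull {a,c,z} \<union> convex hull {b,c,z})"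
proof -
  define K where "K = convex hull {a,b,c,z}"
  define E where "E = convex hull {a,b,z} \<union> convex hull {a,c,z} \<union> convex hull {b,c,z}"
  have opp: "orient a b c v / orient a b c z < 0" using opposite_sides[OF D KS I] .
  have clK: "closed K" unfolding K_def by (simp add: compact_imp_closed finite_imp_compact_convex_hull)
  have clU: "closed (S \<union> K)" using S clK by (rule closed_Un)
  have fK: "frontier K = convex hull {a,b,c} \<union> E" unfolding K_def E_def frontier_tetrahedron[OF D(1)] by auto
  have bd: "convex hull {a,b} \<union> convex hull {a,c} \<union> convex hull {b,c} \<subseteq> E"
    unfolding E_def by (auto intro: hull_mono[THEN subsetD, rotated])
  have EK: "E \<subseteq> K" unfolding E_def K_def by (auto intro: hull_mono[THEN subsetD, rotated])
  have int: "x \<in> interior (S \<union> K)" if xT: "x \<in> convex hull {a,b,c}" and xE: "x \<notin> E" for x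
  proof -
    obtain u v' w where x: "x = u *\<^sub>R a + v' *\<^sub>R b + w *\<^sub>R c" "0 \<le> u" "0 \<le> v'" "0 \<le> w" "u + v' + w = 1"
      using xT unfolding convex_hull_3 by auto
    have "u \<noteq> 0" "v' \<noteq> 0" "w \<noteq> 0"
    proof -
      have "u = 0 \<Longrightarrow> x \<in> convex hull {b,c}" "v' = 0 \<Longrightarrow> x \<in> convex hull {a,c}" "w = 0 \<Longrightarrow> x \<in> convex hull {a,b}"
        using x unfolding convex_hull_2 by auto
      then show "u \<noteq> 0" "v' \<noteq> 0" "w \<noteq> 0" using xE bd by blast+
    qed
    then have pos: "0 < u" "0 < v'" "0 < w" using x by auto
    obtain r where r: "r > 0" "\<And>x'. x' \<in> ball x r \<Longrightarrow> 0 \<le> orient a b c x' / orient a b c z \<Longrightarrow> x' \<in> convex hull {a,b,c,z}"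
      using tetrahedron_neighbourhood[OF D(1) x(1) pos x(5)] by metis
    obtain s where s: "s > 0" "\<And>x'. x' \<in> ball x s \<Longrightarrow> 0 \<le> orient a b c x' / orient a b c v \<Longrightarrow> x' \<in> convex hull {a,b,c,v}"
      using tetrahedron_neighbourhood[OF D(2) x(1) pos x(5)] by metis
    have "ball x (min r s) \<subseteq> S \<union> K"
    proof
      fix x' assume b: "x' \<in> ball x (min r s)"
      have "0 \<le> orient a b c x' / orient a b c z \<or> 0 \<le> orient a b c x' / orient a b c v"
        using opp by (auto simp: zero_le_divide_iff divide_less_0_iff)
      then show "x' \<in> S \<union> K"
      proof
        assume "0 \<le> orient a b c x' / orient a b c z"
        then show ?thesis using r(2)[of x'] b unfolding K_def by simp
      next
        assume "0 \<le> orient a b c x' / orient a b c v"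
        then show ?thesis using s(2)[of x'] b I by auto
      qed
    qed
    then show ?thesis unfolding mem_interior using r(1) s(1) by (intro exI[of _ "min r s"]) simp
  qed
  have EU: "x \<in> frontier (S \<union> K)" if x: "x \<in> E" and o: "orient a b c x \<noteq> 0" for x
  proof -
    have xK: "x \<in> K" using x EK by blast
    have xS: "x \<notin> S" using xK KS o hull3_orient_0 unfolding K_def by blast
    have "x \<notin> interior (S \<union> K)"
    proof
      assume "x \<in> interior (S \<union> K)"
      then have "x \<in> interior (S \<union> K) \<inter> - S" using xS by simp
      moreover have "open (interior (S \<union> K) \<inter> - S)" using S by (intro open_Int) auto
      moreover have "interior (S \<union> K) \<inter> - S \<subseteq> K" using interior_subset[of "S \<union> K"] by auto
      ultimately have "x \<in> interior K" by (meson interiorI)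
      then show False using x fK unfolding frontier_def by blast
    qed
    then show ?thesis unfolding frontier_def using closure_subset[of "S \<union> K"] xK by blast
  qed
  have EU': "E \<subseteq> frontier (S \<union> K)"
  proof
    fix x assume x: "x \<in> E"
    show "x \<in> frontier (S \<union> K)"
    proof (cases "orient a b c x = 0")
      case False then show ?thesis using EU x by blast
    next
      case True
      \<comment> \<open>Points of \<open>E\<close> in the plane of \<open>abc\<close> are limits of
        points of \<open>E\<close> off that plane, obtained by sliding towards \<open>z\<close>, and
        the frontier is closed.\<close>
      have lim: "(\<lambda>n. (1 - inverse (real (Suc n))) *\<^sub>R x + inverse (real (Suc n)) *\<^sub>R z) \<longlonglongrightarrow> (1 - 0) *\<^sub>R x + 0 *\<^sub>R z"
        by (intro tendsto_intros LIMSEQ_inverse_real_of_nat)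
      have mem: "(1 - inverse (real (Suc n))) *\<^sub>R x + inverse (real (Suc n)) *\<^sub>R z \<in> frontier (S \<union> K)" for n
      proof (rule EU)
        define t where "t = inverse (real (Suc n))"
        have t: "0 < t" "t \<le> 1" unfolding t_def by (auto simp: inverse_le_1_iff)
        have "(1 - t) *\<^sub>R x + t *\<^sub>R z \<in> convex hull A" if "x \<in> convex hull A" "z \<in> A" for A
          using that t by (intro convexD_alt[OF convex_convex_hull, of x A z t]) (auto simp: hull_inc)
        then show "(1 - inverse (real (Suc n))) *\<^sub>R x + inverse (real (Suc n)) *\<^sub>R z \<in> E"
          using x unfolding E_def t_def[symmetric] by blast
        show "orient a b c ((1 - inverse (real (Suc n))) *\<^sub>R x + inverse (real (Suc n)) *\<^sub>R z) \<noteq> 0"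
          unfolding orient_segment True using D by simp
      qed
      have "closed (frontier (S \<union> K))" by simp
      from closed_sequentially[OF this, OF mem lim] show ?thesis by simp
    qed
  qed
  have "frontier (S \<union> K) = R \<union> E"
  proof (intro equalityI subsetI)
    fix x assume x: "x \<in> frontier (S \<union> K)"
    then have "x \<in> frontier S \<union> frontier K" using frontier_Un_subset by blast
    then have "x \<in> R \<union> E \<or> x \<in> convex hull {a,b,c}" using fS fK by auto
    then show "x \<in> R \<union> E" using int[of x] x unfolding frontier_def by blast
  next
    fix x assume "x \<in> R \<union> E"
    then show "x \<in> frontier (S \<union> K)"
    proof
      assume "x \<in> E" then show ?thesis using EU' by blast
    next
      assume xR: "x \<in> R"
      then have xf: "x \<in> frontier S" using fS by blast
      then have xS: "x \<in> S" using S frontier_subset_closed by blast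
      show ?thesis
      proof (cases "x \<in> K")
        case True
        then have "x \<in> convex hull {a,b,c}" using xS KS unfolding K_def by blast
        then show ?thesis using xR RT bd EU' by blast
      next
        case False
        have "x \<notin> interior (S \<union> K)"
        proof
          assume "x \<in> interior (S \<union> K)"
          then have "x \<in> interior (S \<union> K) \<inter> - K" using False by simp
          moreover have "open (interior (S \<union> K) \<inter> - K)" using clK by (intro open_Int) auto
          moreover have "interior (S \<union> K) \<inter> - K \<subseteq> S" using interior_subset[of "S \<union> K"] by auto
          ultimately have "x \<in> interior S" by (meson interiorI)
          then show False using xf unfolding frontier_def by blast
        qed
        then show ?thesis unfolding frontier_def using closure_subset[of "S \<union> K"] xS by blast
      qed
    qed
  qed
  then show ?thesis unfolding K_def E_def .
qed

text \<open>Both halves are extended by the identity on \<open>R\<close>: with barycentric coordinates on the triangle,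
  \<open>\<alpha>a + \<beta>b + \<gamma>c\<close> is pushed towards the apex by three times the smallest coordinate.\<close>

lemma homeomorphic_raise_triangle:
  assumes D: "orient a b c z \<noteq> 0" and R: "closed R"
    and RT: "R \<inter> convex hull {a,b,c} \<subseteq> convex hull {a,b} \<union> convex hull {a,c} \<union> convex hull {b,c}"
    and RE: "R \<inter> (convex hull {a,b,z} \<union> convex hull {a,c,z} \<union> convex hull {b,c,z}) \<subseteq> convex hull {a,b,c}"
  shows "(convex hull {a,b,c} \<union> R) homeomorphic
    ((convex hull {a,b,z} \<union> convex hull {a,c,z} \<union> convex hull {b,c,z}) \<union> R)"
proof -
  define T where "T = convex hull {a,b,c}"
  define E where "E = convex hull {a,b,z} \<union> convex hull {a,c,z} \<union> convex hull {b,c,z}"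
  define \<alpha> where "\<alpha> = (\<lambda>x. orient x b c z / orient a b c z)"
  define \<beta> where "\<beta> = (\<lambda>x. orient a x c z / orient a b c z)"
  define \<gamma> where "\<gamma> = (\<lambda>x. orient a b x z / orient a b c z)"
  define \<delta> where "\<delta> = (\<lambda>x. orient a b c x / orient a b c z)"
  define \<mu> where "\<mu> = (\<lambda>x. min (\<alpha> x) (min (\<beta> x) (\<gamma> x)))"
  define m where "m = (1/3) *\<^sub>R a + (1/3) *\<^sub>R b + (1/3) *\<^sub>R c"
  define g where "g = (\<lambda>x. x + (3 * \<mu> x) *\<^sub>R (z - m))"
  \<comment> \<open>On the triangle, \<open>g\<close> takes \<mu> from each of the three coordinates
    and gives 3 \<mu> to \<open>z\<close>. The height \<delta> of the image is therefore exactly the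
    multiple of \<open>z - m\<close> that has to be removed to get back.\<close>
  define h where "h = (\<lambda>x. x - \<delta> x *\<^sub>R (z - m))"
  have cont: "continuous_on X g" "continuous_on X h" for X
    unfolding g_def h_def \<mu>_def \<alpha>_def \<beta>_def \<gamma>_def \<delta>_def using D by (intro continuous_intros; simp)+
  have co: "\<alpha> x = u" "\<beta> x = v" "\<gamma> x = w" "\<delta> x = t"
    if "x = u *\<^sub>R a + v *\<^sub>R b + w *\<^sub>R c + t *\<^sub>R z" "u + v + w + t = 1" for x u v w t
    unfolding \<alpha>_def \<beta>_def \<gamma>_def \<delta>_def that(1) orient_combination[OF that(2)] using D by simp_all
  have Tco: "\<exists>u v w. x = u *\<^sub>R a + v *\<^sub>R b + w *\<^sub>R c + 0 *\<^sub>R z \<and> u + v + w + 0 = 1 \<and> 0 \<le> u \<and> 0 \<le> v \<and> 0 \<le> w" if "x \<in> T" for x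
    using that unfolding T_def convex_hull_3 by auto
  have Eco: "\<exists>u v w t. x = u *\<^sub>R a + v *\<^sub>R b + w *\<^sub>R c + t *\<^sub>R z \<and> u + v + w + t = 1 \<and> min u (min v w) = 0 \<and> 0 \<le> t" if "x \<in> E" for x
  proof -
    from that consider "x \<in> convex hull {a,b,z}" | "x \<in> convex hull {a,c,z}" | "x \<in> convex hull {b,c,z}" unfolding E_def by blast
    then show ?thesis
    proof cases
      case 1
      then obtain u v t where "x = u *\<^sub>R a + v *\<^sub>R b + t *\<^sub>R z" "0 \<le> u" "0 \<le> v" "0 \<le> t" "u + v + t = 1" unfolding convex_hull_3 by auto
      then show ?thesis by (intro exI[of _ u] exI[of _ v] exI[of _ 0] exI[of _ t]) auto
    next
      case 2
      then obtain u v t where "x = u *\<^sub>R a + v *\<^sub>R c + t *\<^sub>R z" "0 \<le> u" "0 \<le> v" "0 \<le> t" "u + v + t = 1" unfolding convex_hull_3 by auto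
      then show ?thesis by (intro exI[of _ u] exI[of _ 0] exI[of _ v] exI[of _ t]) auto
    next
      case 3
      then obtain u v t where "x = u *\<^sub>R b + v *\<^sub>R c + t *\<^sub>R z" "0 \<le> u" "0 \<le> v" "0 \<le> t" "u + v + t = 1" unfolding convex_hull_3 by auto
      then show ?thesis by (intro exI[of _ 0] exI[of _ u] exI[of _ v] exI[of _ t]) auto
    qed
  qed
  have gT: "g x \<in> E \<and> h (g x) = x" if xT: "x \<in> T" for x
  proof -
    obtain u v w where x: "x = u *\<^sub>R a + v *\<^sub>R b + w *\<^sub>R c + 0 *\<^sub>R z" "u + v + w + 0 = 1" "0 \<le> u" "0 \<le> v" "0 \<le> w"
      using Tco[OF xT] by blast
    define k where "k = min u (min v w)"
    have mx: "\<mu> x = k" unfolding \<mu>_def k_def co[OF x(1,2)] ..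
    have gx: "g x = (u - k) *\<^sub>R a + (v - k) *\<^sub>R b + (w - k) *\<^sub>R c + (3 * k) *\<^sub>R z"
      unfolding g_def mx m_def by (subst x(1)) (simp add: algebra_simps)
    have s: "(u - k) + (v - k) + (w - k) + 3 * k = 1" using x by simp
    have "h (g x) = x" unfolding h_def co(4)[OF gx s] unfolding g_def mx by simp
    moreover have "g x \<in> E"
    proof -
      have nn: "0 \<le> u - k" "0 \<le> v - k" "0 \<le> w - k" "0 \<le> 3 * k" using x(3-5) unfolding k_def by auto
      consider "u - k = 0" | "v - k = 0" | "w - k = 0" unfolding k_def by linarith
      then show ?thesis
      proof cases
        case 1
        then have "g x \<in> convex hull {b,c,z}" unfolding gx convex_hull_3 using nn s
          by (intro CollectI exI[of _ "v - k"] exI[of _ "w - k"] exI[of _ "3 * k"]) auto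
        then show ?thesis unfolding E_def by blast
      next
        case 2
        then have "g x \<in> convex hull {a,c,z}" unfolding gx convex_hull_3 using nn s
          by (intro CollectI exI[of _ "u - k"] exI[of _ "w - k"] exI[of _ "3 * k"]) auto
        then show ?thesis unfolding E_def by blast
      next
        case 3
        then have "g x \<in> convex hull {a,b,z}" unfolding gx convex_hull_3 using nn s
          by (intro CollectI exI[of _ "u - k"] exI[of _ "v - k"] exI[of _ "3 * k"]) auto
        then show ?thesis unfolding E_def by blast
      qed
    qed
    ultimately show ?thesis by simp
  qed
  have hE: "h x \<in> T \<and> g (h x) = x" if xE: "x \<in> E" for x
  proof -
    obtain u v w t where x: "x = u *\<^sub>R a + v *\<^sub>R b + w *\<^sub>R c + t *\<^sub>R z" "u + v + w + t = 1" "min u (min v w) = 0" "0 \<le> t"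
      using Eco[OF xE] by blast
    have hx: "h x = (u + t/3) *\<^sub>R a + (v + t/3) *\<^sub>R b + (w + t/3) *\<^sub>R c + 0 *\<^sub>R z"
      unfolding h_def co(4)[OF x(1,2)] m_def by (subst x(1)) (simp add: algebra_simps)
    have s: "(u + t/3) + (v + t/3) + (w + t/3) + 0 = 1" using x by simp
    have "\<mu> (h x) = min u (min v w) + t/3" unfolding \<mu>_def co[OF hx s] by linarith
    then have "3 * \<mu> (h x) = t" using x(3) by simp
    then have "g (h x) = x" unfolding g_def unfolding h_def co(4)[OF x(1,2)] by simp
    moreover have "0 \<le> u" "0 \<le> v" "0 \<le> w" using x(3) by linarith+
    then have "h x \<in> T" unfolding hx T_def convex_hull_3 using x(4) s
      by (intro CollectI exI[of _ "u + t/3"] exI[of _ "v + t/3"] exI[of _ "w + t/3"]) auto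
    ultimately show ?thesis by simp
  qed
  have gid: "g x = x" if "x \<in> R" "x \<in> T" for x
  proof -
    have "x \<in> convex hull {a,b} \<union> convex hull {a,c} \<union> convex hull {b,c}" using that RT unfolding T_def by blast
    then have "x \<in> E" unfolding E_def by (auto intro: hull_mono[THEN subsetD, rotated])
    then obtain u v w t where x: "x = u *\<^sub>R a + v *\<^sub>R b + w *\<^sub>R c + t *\<^sub>R z" "u + v + w + t = 1" "min u (min v w) = 0"
      using Eco by blast
    have "\<mu> x = 0" unfolding \<mu>_def co[OF x(1,2)] using x(3) .
    then show ?thesis unfolding g_def by simp
  qed
  have RE': "x \<in> T" if "x \<in> R" "x \<in> E" for x using RE that unfolding T_def E_def by blast
  have hid: "h x = x" if "x \<in> R" "x \<in> E" for x
    using gT[OF RE'[OF that]] gid[OF that(1) RE'[OF that]] by simp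
  have TE: "x \<in> E" if "x \<in> R" "x \<in> T" for x using gT[OF that(2)] gid[OF that] by simp
  have clT: "closed T" and clE: "closed E" unfolding T_def E_def
    by (simp_all add: compact_imp_closed finite_imp_compact_convex_hull closed_Un)
  define G where "G = (\<lambda>x. if x \<in> T then g x else x)"
  define H where "H = (\<lambda>x. if x \<in> E then h x else x)"
  have cG: "continuous_on (T \<union> R) G" unfolding G_def
    by (rule continuous_on_cases[OF clT R]) (use cont gid in \<open>auto intro: continuous_on_id\<close>)
  have cH: "continuous_on (E \<union> R) H" unfolding H_def
    by (rule continuous_on_cases[OF clE R]) (use cont hid in \<open>auto intro: continuous_on_id\<close>)
  have GH: "G x \<in> E \<union> R \<and> H (G x) = x" if x: "x \<in> T \<union> R" for x
  proof (cases "x \<in> T")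
    case True then show ?thesis using gT[OF True] unfolding G_def H_def by simp
  next
    case False then show ?thesis using x RE'[of x] unfolding G_def H_def by auto
  qed
  have HG: "H x \<in> T \<union> R \<and> G (H x) = x" if x: "x \<in> E \<union> R" for x
  proof (cases "x \<in> E")
    case True then show ?thesis using hE[OF True] unfolding G_def H_def by simp
  next
    case False then show ?thesis using x TE[of x] unfolding G_def H_def by auto
  qed
  have "homeomorphism (T \<union> R) (E \<union> R) G H"
    by (rule homeomorphismI[OF cG cH]) (use GH HG in blast)+
  then show ?thesis unfolding T_def E_def homeomorphic_def by blast
qed

section \<open>Stacking on a face\<close>

lemma doubleton_subset_triple:
  assumes "e \<subseteq> {a,b,c}" "card e = 2" shows "e = {a,b} \<or> e = {a,c} \<or> e = {b,c}"
proof -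
  obtain i j where "e = {i,j}" "i \<noteq> j" using assms(2) by (auto simp: card_2_iff)
  then show ?thesis using assms(1) by (auto simp: doubleton_eq_iff)
qed

lemma proper_subset_triple:
  assumes "s \<subset> {a,b,c}" shows "s \<subseteq> {a,b} \<or> s \<subseteq> {a,c} \<or> s \<subseteq> {b,c}"
  using assms by blast

lemma card_3_Int_psubset:
  assumes "card f = 3" "card g = 3" "f \<noteq> g" shows "f \<inter> g \<subset> g"
  using assms by (metis Int_lower1 Int_lower2 card.infinite card_subset_eq psubsetI zero_neq_numeral)

lemma Collect_filter_insert:
  "{f \<in> insert A F. P f} = (if P A then insert A {f \<in> F. P f} else {f \<in> F. P f})"
  by auto

text \<open>The combinatorial half of a stacking step, stated without positions: here
  \<open>n\<close> is any index not yet in use.\<close>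

locale stacking =
  fixes F :: "nat set set" and a b c n :: nat
  assumes fin: "finite F" and card3: "\<And>f. f \<in> F \<Longrightarrow> card f = 3"
    and two: "\<And>e. e \<in> tri_edges F \<Longrightarrow> card {f\<in>F. e \<subseteq> f} = 2"
    and face: "{a,b,c} \<in> F" and new: "n \<notin> \<Union>F"
begin

definition N where "N = {{a,b,n},{a,c,n},{b,c,n}}"
definition F' where "F' = (F - {{a,b,c}}) \<union> N"

lemma ne: "a \<noteq> b" "a \<noteq> c" "b \<noteq> c" "a \<noteq> n" "b \<noteq> n" "c \<noteq> n" "n \<noteq> a" "n \<noteq> b" "n \<noteq> c" "b \<noteq> a" "c \<noteq> a" "c \<noteq> b"
proof -
  have "card {a,b,c} = 3" using card3 face by blast
  then show "a \<noteq> b" "a \<noteq> c" "b \<noteq> c" "b \<noteq> a" "c \<noteq> a" "c \<noteq> b"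
    by (auto simp: card_insert_if split: if_splits)
  show "a \<noteq> n" "b \<noteq> n" "c \<noteq> n" "n \<noteq> a" "n \<noteq> b" "n \<noteq> c" using face new by blast+
qed

lemma N_props: "f \<in> N \<Longrightarrow> n \<in> f" "f \<in> N \<Longrightarrow> f \<subseteq> {a,b,c,n}" "f \<in> N \<Longrightarrow> card f = 3"
  by (auto simp: N_def ne)

text \<open>Two sets are told apart by an element that only one of them contains: \<open>b\<close>
  for the first pair and \<open>a\<close> for the other two.\<close>

lemma N_distinct: "{a,b,n} \<noteq> {a,c,n}" "{a,b,n} \<noteq> {b,c,n}" "{a,c,n} \<noteq> {b,c,n}"
  by (rule notI, drule arg_cong[where f = "\<lambda>S. b \<in> S"], simp add: ne)
    (rule notI, drule arg_cong[where f = "\<lambda>S. a \<in> S"], simp add: ne)+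

lemma N_F: "f \<in> N \<Longrightarrow> f \<notin> F" using N_props(1) new by blast

lemma finite_F': "finite F'" unfolding F'_def N_def using fin by simp

lemma card_F': "card F' = card F + 2"
proof -
  have "card N = 3" unfolding N_def by (simp add: N_distinct)
  moreover have "card F' = card (F - {{a,b,c}}) + card N" unfolding F'_def
    by (rule card_Un_disjoint) (use fin N_F in \<open>auto simp: N_def\<close>)
  moreover have "card F = Suc (card (F - {{a,b,c}}))" using fin face by (rule card.remove)
  ultimately show ?thesis by simp
qed

lemma edge_cases:
  assumes "e \<in> tri_edges F'"
  shows "e \<in> tri_edges F \<or> e \<in> {{a,n},{b,n},{c,n}}"
proof -
  obtain f where f: "f \<in> F'" "e \<subseteq> f" "card e = 2" using assms unfolding tri_edges_def by blast
  show ?thesis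
  proof (cases "f \<in> F")
    case True then show ?thesis using f unfolding tri_edges_def by blast
  next
    case False
    then have "f \<in> N" using f unfolding F'_def by blast
    then have "e \<subseteq> {a,b,n} \<or> e \<subseteq> {a,c,n} \<or> e \<subseteq> {b,c,n}" using f unfolding N_def by auto
    then have "e \<in> {{a,n},{b,n},{c,n}} \<or> e \<subseteq> {a,b,c}"
      using doubleton_subset_triple[OF _ f(3)] by blast
    then show ?thesis using face f(3) unfolding tri_edges_def by blast
  qed
qed

lemma edges_mono: "tri_edges F \<subseteq> tri_edges F'"
proof
  fix e assume "e \<in> tri_edges F"
  then obtain f where f: "f \<in> F" "e \<subseteq> f" "card e = 2" unfolding tri_edges_def by blast
  show "e \<in> tri_edges F'"
  proof (cases "f = {a,b,c}")
    case True
    then have "e = {a,b} \<or> e = {a,c} \<or> e = {b,c}" using doubleton_subset_triple f(2,3) by simp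
    then have "\<exists>g\<in>N. e \<subseteq> g" unfolding N_def by auto
    then show ?thesis using f(3) unfolding tri_edges_def F'_def by blast
  next
    case False then show ?thesis using f unfolding tri_edges_def F'_def by blast
  qed
qed

lemma new_edges: "{a,n} \<in> tri_edges F'" "{b,n} \<in> tri_edges F'" "{c,n} \<in> tri_edges F'"
  unfolding tri_edges_def F'_def N_def by (auto simp: ne)

lemma finite_edges: "finite (tri_edges F)"
proof -
  have "tri_edges F \<subseteq> Pow (\<Union>F)" unfolding tri_edges_def by blast
  moreover have "finite (\<Union>F)" using fin card3 by (metis card.infinite finite_Union zero_neq_numeral)
  ultimately show ?thesis by (meson finite_Pow_iff finite_subset)
qed

lemma card_edges: "card (tri_edges F') \<le> card (tri_edges F) + 3"
proof -
  have "tri_edges F' \<subseteq> tri_edges F \<union> {{a,n},{b,n},{c,n}}" using edge_cases by blast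
  then have "card (tri_edges F') \<le> card (tri_edges F \<union> {{a,n},{b,n},{c,n}})"
    using finite_edges by (intro card_mono) auto
  also have "\<dots> \<le> card (tri_edges F) + card {{a,n},{b,n},{c,n}}" by (rule card_Un_le)
  also have "card {{a,n},{b,n},{c,n}} \<le> 3" by (simp add: card_insert_if)
  finally show ?thesis by simp
qed

text \<open>An edge at the new vertex lies in two of the three new faces, a side of
  \<open>abc\<close> exchanges the removed face for one new face, and the faces at any other edge
  are unchanged.\<close>

lemma two_faces:
  assumes e: "e \<in> tri_edges F'" shows "card {f\<in>F'. e \<subseteq> f} = 2"
proof -
  have c2: "card e = 2" using e unfolding tri_edges_def by blast
  have split: "{f\<in>F'. e \<subseteq> f} = {f\<in>F - {{a,b,c}}. e \<subseteq> f} \<union> {f\<in>N. e \<subseteq> f}" unfolding F'_def by blast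
  show ?thesis
  proof (cases "n \<in> e")
    case True
    then have z: "{f\<in>F - {{a,b,c}}. e \<subseteq> f} = {}" using new by blast
    have "e \<in> {{a,n},{b,n},{c,n}}" using edge_cases[OF e] True new unfolding tri_edges_def by blast
    then have "card {f\<in>N. e \<subseteq> f} = 2"
      unfolding N_def Collect_filter_insert by (elim insertE emptyE) (simp_all add: ne N_distinct)
    then show ?thesis unfolding split z by (simp only: Un_empty_left)
  next
    case False
    show ?thesis
    proof (cases "e \<subseteq> {a,b,c}")
      case True
      then have eF: "e \<in> tri_edges F" using face c2 unfolding tri_edges_def by blast
      have "{f\<in>F - {{a,b,c}}. e \<subseteq> f} = {f\<in>F. e \<subseteq> f} - {{a,b,c}}" by blast
      then have 1: "card {f\<in>F - {{a,b,c}}. e \<subseteq> f} = 1"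
        using two[OF eF] True face fin by (simp add: card_Diff_singleton)
      from doubleton_subset_triple[OF True c2] have 2: "card {f\<in>N. e \<subseteq> f} = 1"
        unfolding N_def Collect_filter_insert by (elim disjE) (simp_all add: ne)
      have "card {f\<in>F'. e \<subseteq> f} = card {f\<in>F - {{a,b,c}}. e \<subseteq> f} + card {f\<in>N. e \<subseteq> f}"
        unfolding split by (rule card_Un_disjoint) (use fin N_F in \<open>auto simp: N_def\<close>)
      then show ?thesis using 1 2 by simp
    next
      case F: False
      have "{f\<in>N. e \<subseteq> f} = {}" using N_props(2) False F by blast
      then have "{f\<in>F - {{a,b,c}}. e \<subseteq> f} \<union> {f\<in>N. e \<subseteq> f} = {f\<in>F - {{a,b,c}}. e \<subseteq> f}" by (simp only: Un_empty_right)
      moreover have "{f\<in>F - {{a,b,c}}. e \<subseteq> f} = {f\<in>F. e \<subseteq> f}" using F by blast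
      moreover have "e \<in> tri_edges F" using edge_cases[OF e] False by blast
      then have "card {f\<in>F. e \<subseteq> f} = 2" by (rule two)
      ultimately show ?thesis unfolding split by (simp only:)
    qed
  qed
qed

text \<open>The new vertex has the three neighbours \<open>a\<close>, \<open>b\<close>,
  \<open>c\<close>, and two removed vertices cannot be all of them. Every remaining vertex is joined
  to a surviving neighbour \<open>w\<close>, old ones by hypothesis and the new one
  directly.\<close>

lemma three_connected_step:
  assumes tc: "three_connected {..<n} (poly_adj F)" and V: "\<Union>F = {..<n}"
  shows "three_connected {..<Suc n} (poly_adj F')"
proof -
  have abc: "a < n" "b < n" "c < n" using face V by blast+
  have adj: "poly_adj F i j \<Longrightarrow> poly_adj F' i j" for i j unfolding poly_adj_def using edges_mono by blast
  have sym: "poly_adj G i j \<Longrightarrow> poly_adj G j i" for G i j unfolding poly_adj_def by (simp add: insert_commute)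
  have nadj: "poly_adj F' n w" "poly_adj F' w n" if "w \<in> {a,b,c}" for w
    using that new_edges unfolding poly_adj_def by (auto simp: insert_commute)
  have conn: "(\<lambda>x y. poly_adj F' x y \<and> x \<in> {..<Suc n} - X \<and> y \<in> {..<Suc n} - X)\<^sup>*\<^sup>* u v"
    if X: "X \<subseteq> {..<Suc n}" "card X \<le> 2" and u: "u \<in> {..<Suc n} - X" and v: "v \<in> {..<Suc n} - X" for X u v
  proof -
    let ?R = "\<lambda>x y. poly_adj F' x y \<and> x \<in> {..<Suc n} - X \<and> y \<in> {..<Suc n} - X"
    have finX: "finite X" using X(1) finite_subset by blast
    have old: "?R\<^sup>*\<^sup>* s t" if st: "s \<in> {..<n} - X" "t \<in> {..<n} - X" for s t
    proof -
      have "card (X \<inter> {..<n}) \<le> 2" using X(2) finX by (meson card_mono inf_le1 le_trans)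
      then have "(\<lambda>x y. poly_adj F x y \<and> x \<in> {..<n} - (X \<inter> {..<n}) \<and> y \<in> {..<n} - (X \<inter> {..<n}))\<^sup>*\<^sup>* s t"
        using tc[unfolded three_connected_def, THEN conjunct2, THEN conjunct2, rule_format, of "X \<inter> {..<n}" s t] st
        by auto
      then show ?thesis by (rule rtranclp_mono[THEN predicate2D, rotated]) (use adj in auto)
    qed
    have "\<not> {a,b,c} \<subseteq> X"
    proof
      assume "{a,b,c} \<subseteq> X"
      then have "card {a,b,c} \<le> card X" using finX by (rule card_mono[rotated])
      then show False using ne X(2) by simp
    qed
    then obtain w where w: "w \<in> {a,b,c}" "w \<notin> X" by blast
    have wn: "w \<in> {..<n} - X" using w abc by auto
    have up: "?R\<^sup>*\<^sup>* s w" "?R\<^sup>*\<^sup>* w s" if s: "s \<in> {..<Suc n} - X" for s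
    proof -
      show "?R\<^sup>*\<^sup>* s w"
      proof (cases "s = n")
        case True then show ?thesis using nadj[OF w(1)] s wn by (intro r_into_rtranclp) auto
      next
        case False then show ?thesis using old[of s w] s wn by auto
      qed
      show "?R\<^sup>*\<^sup>* w s"
      proof (cases "s = n")
        case True then show ?thesis using nadj[OF w(1)] s wn by (intro r_into_rtranclp) auto
      next
        case False then show ?thesis using old[of w s] s wn by auto
      qed
    qed
    show ?thesis using up(1)[OF u] up(2)[OF v] by (rule rtranclp_trans)
  qed
  have "4 \<le> card {..<Suc n}" using tc unfolding three_connected_def by simp
  then show ?thesis unfolding three_connected_def using conn by simp
qed

end

text \<open>This stands in for an orientation of the surface: a tetrahedron inside \<open>S\<close>
  over each face shows on which side of the face the solid lies.\<close>

definition rooms :: "(nat \<Rightarrow> real^3) \<Rightarrow> nat set set \<Rightarrow> (real^3) set \<Rightarrow> bool" where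
  "rooms p F S \<longleftrightarrow> (\<forall>f\<in>F. \<exists>v. \<not> coplanar (insert v (p ` f)) \<and> convex hull (insert v (p ` f)) \<subseteq> S)"

text \<open>The invariant of the construction. The last two conjuncts are the Euler counts 2n - 4
  and 3n - 6, in additive form to avoid subtraction of natural numbers; for edges an upper bound is
  what the final count uses.\<close>

definition good :: "(nat \<Rightarrow> real^3) \<Rightarrow> nat \<Rightarrow> nat set set \<Rightarrow> (real^3) set \<Rightarrow> bool" where
  "good p n F S \<longleftrightarrow> stacked p n F S \<and> is_tri_polyhedron p n F S \<and> topologically_convex p n F S \<and>
     faces_are_triangles p F \<and> rooms p F S \<and> card F + 4 = 2 * n \<and> card (tri_edges F) + 6 \<le> 3 * n"

lemma is_tri_polyhedron_vertices: "is_tri_polyhedron p n F S \<Longrightarrow> \<Union>F = {..<n}"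
  unfolding is_tri_polyhedron_def by (elim conjE)

lemma stacked_vertices:
  assumes "stacked p n F S" shows "\<Union>F = {..<n}"
  using assms
proof cases
  case base
  have "{..<4} = {0,1,2,3::nat}" by auto
  then show ?thesis unfolding base by auto
next
  case (step n F S a b c)
  show ?thesis unfolding step(1,2) by (rule is_tri_polyhedron_vertices[OF step(8)])
qed

lemma is_tri_polyhedron_cong:
  assumes t: "is_tri_polyhedron p n F S" and e: "\<And>i. i < n \<Longrightarrow> p' i = p i"
  shows "is_tri_polyhedron p' n F S"
proof -
  have "\<Union>F = {..<n}" using t unfolding is_tri_polyhedron_def by blast
  then have 1: "p' ` f = p ` f" if "f \<in> F" for f using that e by (intro image_cong) auto
  have 2: "p' ` (f \<inter> g) = p ` (f \<inter> g)" if "f \<in> F" for f g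
    using that e \<open>\<Union>F = {..<n}\<close> by (intro image_cong) auto
  have 3: "inj_on p' {..<n} = inj_on p {..<n}" using e by (intro inj_on_cong) auto
  have 4: "(\<Union>f\<in>F. convex hull (p' ` f)) = (\<Union>f\<in>F. convex hull (p ` f))" using 1 by simp
  show ?thesis using t unfolding is_tri_polyhedron_def 3 4 using 1 2 by simp
qed

text \<open>Each new vertex updates \<open>p\<close> at a fresh index, while \<open>stacked\<close>
  is derived for one fixed \<open>p\<close>; so the earlier derivation has to be moved to the
  updated positions.\<close>

lemma stacked_cong:
  assumes "stacked p n F S" and "\<And>i. i < n \<Longrightarrow> p' i = p i"
  shows "stacked p' n F S"
  using assms
proof (induction rule: stacked.induct)
  case base
  then have "p' 0 = p 0" "p' 1 = p 1" "p' 2 = p 2" "p' 3 = p 3" by auto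
  then show ?case using stacked.base[of p'] base(1) by simp
next
  case (step n F S a b c)
  have st: "stacked p' n F S" using step by simp
  have "\<Union>F = {..<n}" using stacked_vertices step by blast
  then have "a < n" "b < n" "c < n" using step by auto
  then have e: "p' a = p a" "p' b = p b" "p' c = p c" "p' n = p n" using step.prems by auto
  have "stacked p' (Suc n) (F - {{a,b,c}} \<union> {{a,b,n},{a,c,n},{b,c,n}}) (S \<union> convex hull {p' a, p' b, p' c, p' n})"
    by (rule stacked.step[OF st step(2)])
      (use step e in \<open>auto intro: is_tri_polyhedron_cong\<close>)
  then show ?case unfolding e .
qed

lemma vertices_in_solid:
  assumes "is_tri_polyhedron p n F S" "i < n" shows "p i \<in> S"
proof -
  obtain f where f: "f \<in> F" "i \<in> f" using assms unfolding is_tri_polyhedron_def by blast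
  then have "p i \<in> convex hull (p ` f)" by (simp add: hull_inc)
  then have "p i \<in> frontier S" using assms(1) f unfolding is_tri_polyhedron_def by blast
  moreover have "compact S" using assms(1) unfolding is_tri_polyhedron_def by (rule conjunct1)
  then have "closed S" by (rule compact_imp_closed)
  ultimately show ?thesis using frontier_subset_closed[of S] by (rule_tac subsetD)
qed

lemma tetrahedron_hull_Int:
  assumes "orient a b c x \<noteq> 0" "s \<subseteq> {a,b,c,x}" "t \<subseteq> {a,b,c,x}"
  shows "convex hull s \<inter> convex hull t = convex hull (s \<inter> t)"
proof -
  have "\<not> affine_dependent (s \<union> t)"
    using affine_independent_orient(1)[OF assms(1)] assms(2,3) affine_dependent_subset by (metis Un_least)
  then show ?thesis by (rule convex_hull_Int[symmetric])
qed

text \<open>\<open>KS\<close> says that there is room for the new tetrahedron outside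
  \<open>S\<close>, and \<open>gen\<close> that no new face is coplanar with the old face across a
  side of \<open>abc\<close>. Everything else in the invariant follows from these and from the
  combinatorics of stacking.\<close>

lemma good_step:
  assumes G: "good p n F S" and f: "{a,b,c} \<in> F" and D: "orient (p a) (p b) (p c) x \<noteq> 0"
    and KS: "convex hull {p a, p b, p c, x} \<inter> S = convex hull {p a, p b, p c}"
    and gen: "\<And>g. g \<in> F \<Longrightarrow> g \<noteq> {a,b,c} \<Longrightarrow> card (g \<inter> {a,b,c}) = 2 \<Longrightarrow> x \<notin> affine hull (p ` g)"
  shows "good (p(n := x)) (Suc n) ((F - {{a,b,c}}) \<union> {{a,b,n},{a,c,n},{b,c,n}})
    (S \<union> convex hull {p a, p b, p c, x})"
proof -
  have T: "is_tri_polyhedron p n F S" and st: "stacked p n F S" and tc: "topologically_convex p n F S"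
    and ft: "faces_are_triangles p F" and rm: "rooms p F S" and cF: "card F + 4 = 2 * n" and cE: "card (tri_edges F) + 6 \<le> 3 * n"
    using G unfolding good_def by auto
  have cS: "compact S" and fin: "finite F" and inj: "inj_on p {..<n}" and U: "\<Union>F = {..<n}"
    and c3: "\<And>g. g \<in> F \<Longrightarrow> card g = 3" and nc: "\<And>g. g \<in> F \<Longrightarrow> \<not> collinear (p ` g)"
    and fr: "frontier S = (\<Union>g\<in>F. convex hull (p ` g))"
    and hI: "\<And>g h. g \<in> F \<Longrightarrow> h \<in> F \<Longrightarrow> convex hull (p ` g) \<inter> convex hull (p ` h) = convex hull (p ` (g \<inter> h))"
    and two: "\<And>e. e \<in> tri_edges F \<Longrightarrow> card {g\<in>F. e \<subseteq> g} = 2"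
    using T unfolding is_tri_polyhedron_def by simp_all
  interpret s: stacking F a b c n
    by unfold_locales (use fin c3 two f U in auto)
  define p' where "p' = p(n := x)"
  define K where "K = convex hull {p a, p b, p c, x}"
  define N where "N = {{a,b,n},{a,c,n},{b,c,n}}"
  define F' where "F' = (F - {{a,b,c}}) \<union> N"
  have N: "s.N = N" unfolding s.N_def N_def ..
  have F': "s.F' = F'" unfolding s.F'_def F'_def N ..
  have clS: "closed S" using cS by (rule compact_imp_closed)
  have abc: "a < n" "b < n" "c < n" using f U by blast+
  have pn: "p' n = x" "p' a = p a" "p' b = p b" "p' c = p c" "\<And>i. i < n \<Longrightarrow> p' i = p i" unfolding p'_def using abc by auto
  have pim: "p' ` g = p ` g" if "g \<subseteq> {..<n}" for g using that pn(5) by (intro image_cong) auto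
  have Fn: "g \<subseteq> {..<n}" if "g \<in> F" for g using that U by blast
  have Nim: "p' ` g \<subseteq> {p a, p b, p c, x}" if "g \<subseteq> {a,b,c,n}" for g using that pn by auto
  have Nsub: "g \<subseteq> {a,b,c,n}" if "g \<in> N" for g using that unfolding N_def by auto
  have Tim: "p' ` {a,b,c} = {p a, p b, p c}" "p ` {a,b,c} = {p a, p b, p c}" using pn by auto
  have xS: "x \<notin> S"
  proof
    assume "x \<in> S"
    then have "x \<in> convex hull {p a, p b, p c}" using KS hull_inc[of x "{p a, p b, p c, x}" convex] by blast
    then show False using hull3_orient_0 D by blast
  qed
  have xp: "x \<notin> p ` {..<n}" using vertices_in_solid[OF T] xS by blast
  have inj': "inj_on p' {..<Suc n}"
  proof -
    have "inj_on p' {..<n}" using inj pn(5) by (subst inj_on_cong[of _ _ p]) auto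
    moreover have "p' n \<notin> p' ` {..<n}" using xp pim[of "{..<n}"] pn(1) by simp
    ultimately show ?thesis by (simp add: lessThan_Suc)
  qed
  have imI: "p' ` (g \<inter> h) = p' ` g \<inter> p' ` h" if "g \<subseteq> {..<Suc n}" "h \<subseteq> {..<Suc n}" for g h
    using inj_on_image_Int[OF inj' that] .
  have sub4: "g \<subseteq> {..<Suc n}" if "g \<subseteq> {a,b,c,n}" for g using that abc by auto
  have subF: "g \<subseteq> {..<Suc n}" if "g \<in> F" for g using Fn[OF that] by auto
  have hN: "convex hull (p' ` g) \<inter> convex hull (p' ` h) = convex hull (p' ` (g \<inter> h))" if "g \<subseteq> {a,b,c,n}" "h \<subseteq> {a,b,c,n}" for g h
    unfolding imI[OF sub4[OF that(1)] sub4[OF that(2)]]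
    by (rule tetrahedron_hull_Int[OF D Nim[OF that(1)] Nim[OF that(2)]])
  \<comment> \<open>The new face lies in \<open>K\<close> and the old one in \<open>S\<close>, so
    they meet inside the base triangle. Intersecting with that triangle first leaves only
    intersections within the old complex or within one tetrahedron.\<close>
  have hNF: "convex hull (p' ` g) \<inter> convex hull (p' ` h) = convex hull (p' ` (g \<inter> h))" if g: "g \<in> N" and h: "h \<in> F - {{a,b,c}}" for g h
  proof -
    have hF: "h \<in> F" using h by simp
    have "convex hull (p' ` g) \<subseteq> K" unfolding K_def by (rule hull_mono[OF Nim[OF Nsub[OF g]]])
    moreover have "convex hull (p' ` h) \<subseteq> S"
      using hF fr clS frontier_subset_closed[of S] unfolding pim[OF Fn[OF hF]] by blast
    ultimately have "convex hull (p' ` g) \<inter> convex hull (p' ` h)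
      = (convex hull (p' ` g) \<inter> convex hull (p' ` {a,b,c})) \<inter> (convex hull (p ` {a,b,c}) \<inter> convex hull (p ` h))"
      using KS unfolding K_def Tim pim[OF Fn[OF hF]] by blast
    also have "\<dots> = convex hull (p' ` (g \<inter> {a,b,c})) \<inter> convex hull (p' ` ({a,b,c} \<inter> h))"
    proof -
      have 1: "convex hull (p' ` g) \<inter> convex hull (p' ` {a,b,c}) = convex hull (p' ` (g \<inter> {a,b,c}))"
        by (rule hN[OF Nsub[OF g]]) blast
      have 2: "p ` ({a,b,c} \<inter> h) = p' ` ({a,b,c} \<inter> h)" by (rule pim[symmetric]) (use abc in auto)
      show ?thesis unfolding 1 hI[OF f hF] 2 ..
    qed
    also have "\<dots> = convex hull (p' ` ((g \<inter> {a,b,c}) \<inter> ({a,b,c} \<inter> h)))"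
      by (rule hN) auto
    also have "(g \<inter> {a,b,c}) \<inter> ({a,b,c} \<inter> h) = g \<inter> h" using Nsub[OF g] Fn[OF hF] by auto
    finally show ?thesis .
  qed
  have hFF: "convex hull (p' ` g) \<inter> convex hull (p' ` h) = convex hull (p' ` (g \<inter> h))" if "g \<in> F" "h \<in> F" for g h
  proof -
    have 1: "p' ` (g \<inter> h) = p ` (g \<inter> h)" by (rule pim) (use Fn[OF that(1)] in blast)
    show ?thesis unfolding 1 pim[OF Fn[OF that(1)]] pim[OF Fn[OF that(2)]] by (rule hI[OF that])
  qed
  define R where "R = (\<Union>g\<in>F - {{a,b,c}}. convex hull (p ` g))"
  have frR: "frontier S = convex hull {p a, p b, p c} \<union> R" 
  proof -
    have "F = insert {a,b,c} (F - {{a,b,c}})" using f by blast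
    then have "(\<Union>g\<in>F. convex hull (p ` g)) = convex hull (p ` {a,b,c}) \<union> R" unfolding R_def by (metis UN_insert)
    then show ?thesis unfolding fr Tim(2) .
  qed
  have clR: "closed R" unfolding R_def
  proof (rule closed_UN)
    show "finite (F - {{a,b,c}})" using fin by simp
    show "\<forall>g\<in>F - {{a,b,c}}. closed (convex hull (p ` g))"
    proof
      fix g assume "g \<in> F - {{a,b,c}}"
      then have "finite g" using Fn finite_subset by blast
      then show "closed (convex hull (p ` g))" by (intro compact_imp_closed finite_imp_compact_convex_hull finite_imageI)
    qed
  qed
  have RT: "R \<inter> convex hull {p a, p b, p c} \<subseteq> convex hull {p a, p b} \<union> convex hull {p a, p c} \<union> convex hull {p b, p c}"
  proof
    fix y assume y: "y \<in> R \<inter> convex hull {p a, p b, p c}"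
    then obtain g where g: "g \<in> F" "g \<noteq> {a,b,c}" "y \<in> convex hull (p ` g)" unfolding R_def by blast
    then have "y \<in> convex hull (p ` g) \<inter> convex hull (p ` {a,b,c})" using y unfolding Tim(2) by blast
    then have "y \<in> convex hull (p ` (g \<inter> {a,b,c}))" unfolding hI[OF g(1) f] .
    moreover have "g \<inter> {a,b,c} \<subset> {a,b,c}" by (rule card_3_Int_psubset[OF c3[OF g(1)] c3[OF f] g(2)])
    then have "g \<inter> {a,b,c} \<subseteq> {a,b} \<or> g \<inter> {a,b,c} \<subseteq> {a,c} \<or> g \<inter> {a,b,c} \<subseteq> {b,c}" by (rule proper_subset_triple)
    then have "p ` (g \<inter> {a,b,c}) \<subseteq> {p a, p b} \<or> p ` (g \<inter> {a,b,c}) \<subseteq> {p a, p c} \<or> p ` (g \<inter> {a,b,c}) \<subseteq> {p b, p c}" by auto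
    ultimately show "y \<in> convex hull {p a, p b} \<union> convex hull {p a, p c} \<union> convex hull {p b, p c}"
      using hull_mono by blast
  qed
  obtain v where v: "orient (p a) (p b) (p c) v \<noteq> 0" "convex hull {p a, p b, p c, v} \<subseteq> S"
  proof -
    obtain v where "\<not> coplanar (insert v (p ` {a,b,c}))" "convex hull (insert v (p ` {a,b,c})) \<subseteq> S"
      using rm f unfolding rooms_def by blast
    moreover have "insert v (p ` {a,b,c}) = {p a, p b, p c, v}" by auto
    ultimately show thesis using that coplanar_iff_orient by metis
  qed
  have fr': "frontier (S \<union> K) = R \<union> (convex hull {p a, p b, x} \<union> convex hull {p a, p c, x} \<union> convex hull {p b, p c, x})"
    unfolding K_def by (rule frontier_Un_tetrahedron[OF clS frR RT D v(1) KS v(2)])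
  have KT: "K \<inter> S = convex hull {p a, p b, p c}" unfolding K_def by (rule KS)
  have Eim: "(\<Union>g\<in>N. convex hull (p' ` g)) = convex hull {p a, p b, x} \<union> convex hull {p a, p c, x} \<union> convex hull {p b, p c, x}"
    unfolding N_def by (simp add: pn Un_assoc)
  have R': "R = (\<Union>g\<in>F - {{a,b,c}}. convex hull (p' ` g))" unfolding R_def using pim Fn by (intro SUP_cong) auto
  have frF': "frontier (S \<union> K) = (\<Union>g\<in>F'. convex hull (p' ` g))"
    unfolding fr' Eim[symmetric] R' F'_def by (simp add: Un_commute)
  have nc': "\<not> collinear (p' ` g)" if g: "g \<in> F'" for g
  proof (cases "g \<in> N")
    case True
    have "\<not> coplanar {p a, p b, p c, x}" using D by (rule orient_imp_not_coplanar)
    then have "\<not> affine_dependent {p a, p b, p c, x}" using affine_independent_orient(1)[OF D] by simp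
    then have i: "\<not> affine_dependent (p' ` g)" using affine_dependent_subset Nim[OF Nsub[OF True]] by blast
    have "card (p' ` g) = card g" by (rule card_image) (rule inj_on_subset[OF inj' sub4[OF Nsub[OF True]]])
    then have c: "card (p' ` g) = 3" using s.N_props(3) True unfolding N by simp
    then obtain u1 u2 u3 where "p' ` g = {u1,u2,u3}" "distinct [u1,u2,u3]" by (auto simp: card_3_iff)
    then show ?thesis using i by (simp add: collinear_3_eq_affine_dependent)
  next
    case False
    then show ?thesis using g nc pim Fn unfolding F'_def by auto
  qed
  have T': "is_tri_polyhedron p' (Suc n) F' (S \<union> K)"
    unfolding is_tri_polyhedron_def
  proof (intro conjI ballI)
    show "compact (S \<union> K)" using cS unfolding K_def by (intro compact_Un finite_imp_compact_convex_hull) auto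
    show "finite F'" using s.finite_F' unfolding F' .
    show "inj_on p' {..<Suc n}" by (rule inj')
    show "\<Union>F' = {..<Suc n}"
    proof -
      have "\<Union>F' = \<Union>(F - {{a,b,c}}) \<union> {a,b,c,n}" unfolding F'_def N_def by auto
      also have "\<dots> = \<Union>F \<union> {n}" using f by auto
      finally show ?thesis unfolding U by auto
    qed
    show "card g = 3" if "g \<in> F'" for g using that c3 s.N_props(3) unfolding F'_def N by auto
    show "\<not> collinear (p' ` g)" if "g \<in> F'" for g by (rule nc'[OF that])
    show "frontier (S \<union> K) = (\<Union>g\<in>F'. convex hull (p' ` g))" by (rule frF')
    show "card {g\<in>F'. e \<subseteq> g} = 2" if "e \<in> tri_edges F'" for e using s.two_faces that unfolding F' by blast
    show "convex hull (p' ` g) \<inter> convex hull (p' ` h) = convex hull (p' ` (g \<inter> h))" if gh: "g \<in> F'" "h \<in> F'" for g h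
    proof (cases "g \<in> N")
      case True
      show ?thesis
      proof (cases "h \<in> N")
        case True then show ?thesis using hN Nsub \<open>g \<in> N\<close> by blast
      next
        case False then show ?thesis using hNF[OF \<open>g \<in> N\<close>] gh unfolding F'_def by blast
      qed
    next
      case gF: False
      show ?thesis
      proof (cases "h \<in> N")
        case True then show ?thesis using hNF[OF True, of g] gF gh unfolding F'_def by (auto simp: Int_commute)
      next
        case False then show ?thesis using hFF[of g h] gF gh unfolding F'_def by blast
      qed
    qed
  qed
  have st': "stacked p' (Suc n) F' (S \<union> K)"
  proof -
    have 1: "stacked p' n F S" by (rule stacked_cong[OF st pn(5)])
    \<comment> \<open>The base triangle, which is all of \<open>K\<close> that meets
      \<open>S\<close>, is on the frontier of \<open>K\<close>, so the interior of \<open>K\<close>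
      misses \<open>S\<close>.\<close>
    have Tf: "convex hull {p a, p b, p c} \<subseteq> frontier K" unfolding K_def frontier_tetrahedron[OF D] by blast
    have "interior K \<inter> S \<subseteq> interior K \<inter> frontier K" using Tf KT interior_subset[of K] by blast
    then have "interior K \<inter> S = {}" unfolding frontier_def by blast
    then show ?thesis unfolding F'_def N_def K_def
      using stacked.step[OF 1 f] T'[unfolded F'_def N_def K_def] orient_imp_not_coplanar[OF D] unfolding pn K_def by simp
  qed
  have tc': "topologically_convex p' (Suc n) F' (S \<union> K)"
    unfolding topologically_convex_def
  proof
    define E where "E = convex hull {p a, p b, x} \<union> convex hull {p a, p c, x} \<union> convex hull {p b, p c, x}"
    have "R \<inter> E \<subseteq> convex hull {p a, p b, p c}"
    proof -
      have "E \<subseteq> K" unfolding E_def K_def by (auto intro: hull_mono[THEN subsetD, rotated])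
      moreover have "R \<subseteq> S" using frR frontier_subset_closed[OF clS] by blast
      ultimately show ?thesis using KT by blast
    qed
    from homeomorphic_raise_triangle[OF D clR RT this[unfolded E_def]]
    have "frontier S homeomorphic frontier (S \<union> K)" unfolding frR fr' by (simp add: Un_commute)
    moreover have "frontier S homeomorphic sphere (0::real^3) 1" using tc unfolding topologically_convex_def by blast
    ultimately show "frontier (S \<union> K) homeomorphic sphere (0::real^3) 1"
      using homeomorphic_sym homeomorphic_trans by blast
    show "three_connected {..<Suc n} (poly_adj F')"
      using s.three_connected_step tc U unfolding topologically_convex_def F' by blast
  qed
  \<comment> \<open>A new face shares an edge with an old one only along a side of
    \<open>abc\<close>. The union is then the old face with \<open>n\<close> added, and coplanarity
    would put \<open>x\<close> into the plane of the old face.\<close>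
  have mix: "\<not> coplanar (p' ` (g \<union> h))" if g: "g \<in> N" and h: "h \<in> F - {{a,b,c}}" and c: "card (g \<inter> h) = 2" for g h
  proof -
    have hF: "h \<in> F" using h by simp
    have nh: "n \<notin> h" using Fn[OF hF] by auto
    have ghT: "g \<inter> h \<subseteq> h \<inter> {a,b,c}" using Nsub[OF g] nh by blast
    have "h \<inter> {a,b,c} \<subset> {a,b,c}" using card_3_Int_psubset[OF c3[OF hF] c3[OF f]] h by blast
    then have "card (h \<inter> {a,b,c}) < 3" using psubset_card_mono[of "{a,b,c}" "h \<inter> {a,b,c}"] c3[OF f] by simp
    moreover have "2 \<le> card (h \<inter> {a,b,c})" using card_mono[OF _ ghT] c by simp
    ultimately have c2: "card (h \<inter> {a,b,c}) = 2" by simp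
    have xa: "x \<notin> affine hull (p ` h)" using gen[OF hF _ c2] h by blast
    have gn: "n \<in> g" using g unfolding N_def by blast
    have "g - {n} = g \<inter> h"
    proof -
      have "g \<inter> h \<subseteq> g - {n}" using nh by blast
      moreover have "card (g - {n}) = 2" using s.N_props(3)[of g] g gn unfolding N by simp
      ultimately show ?thesis using c by (metis card.infinite card_subset_eq zero_neq_numeral)
    qed
    then have "g \<union> h = insert n h" using gn by blast
    then have im: "p' ` (g \<union> h) = insert x (p ` h)" using pn(1) pim[OF Fn[OF hF]] by simp
    obtain i j k where ijk: "h = {i,j,k}" using c3[OF hF] by (auto simp: card_3_iff)
    have ncl: "\<not> collinear {p i, p j, p k}" using nc[OF hF] ijk by simp
    show ?thesis
    proof
      assume "coplanar (p' ` (g \<union> h))"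
      moreover have "insert x (p ` h) = {p i, p j, p k, x}" unfolding ijk by auto
      ultimately have "coplanar {p i, p j, p k, x}" unfolding im by simp
      then have "x \<in> affine hull {p i, p j, p k}" using orient_eq_0_affine_hull[OF ncl] coplanar_iff_orient by blast
      then show False using xa ijk by simp
    qed
  qed
  have ft': "faces_are_triangles p' F'"
    unfolding faces_are_triangles_def
  proof (intro ballI impI)
    fix g h assume gh: "g \<in> F'" "h \<in> F'" and "g \<noteq> h \<and> card (g \<inter> h) = 2"
    then have ne: "g \<noteq> h" and c: "card (g \<inter> h) = 2" by auto
    show "\<not> coplanar (p' ` (g \<union> h))"
    proof (cases "g \<in> N")
      case gN: True
      show ?thesis
      proof (cases "h \<in> N")
        case True
        have "g \<union> h = {a,b,c,n}" using gN True ne unfolding N_def by auto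
        then have "p' ` (g \<union> h) = {p a, p b, p c, x}" using pn by auto
        then show ?thesis using orient_imp_not_coplanar[OF D] by simp
      next
        case False then show ?thesis using mix[OF gN _ c] gh unfolding F'_def by blast
      qed
    next
      case gF: False
      show ?thesis
      proof (cases "h \<in> N")
        case True then show ?thesis using mix[of h g] c gF gh unfolding F'_def by (auto simp: Int_commute Un_commute)
      next
        case False
        then have "g \<in> F" "h \<in> F" using gF gh unfolding F'_def by auto
        then show ?thesis using ft ne c pim[of "g \<union> h"] Fn unfolding faces_are_triangles_def by auto
      qed
    qed
  qed
  have rm': "rooms p' F' (S \<union> K)"
    unfolding rooms_def
  proof
    fix g assume g: "g \<in> F'"
    show "\<exists>v. \<not> coplanar (insert v (p' ` g)) \<and> convex hull (insert v (p' ` g)) \<subseteq> S \<union> K"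
    proof (cases "g \<in> N")
      case True
      then obtain i where "insert (p i) (p' ` g) = {p a, p b, p c, x}"
      proof -
        assume r: "\<And>i. insert (p i) (p' ` g) = {p a, p b, p c, x} \<Longrightarrow> thesis"
        from True consider "g = {a,b,n}" | "g = {a,c,n}" | "g = {b,c,n}" unfolding N_def by blast
        then show thesis
        proof cases
          case 1 then show ?thesis using r[of c] pn by auto
        next
          case 2 then show ?thesis using r[of b] pn by auto
        next
          case 3 then show ?thesis using r[of a] pn by auto
        qed
      qed
      then show ?thesis using orient_imp_not_coplanar[OF D] unfolding K_def by (metis Un_upper2)
    next
      case False
      then have gF: "g \<in> F" using g unfolding F'_def by blast
      then obtain v where "\<not> coplanar (insert v (p ` g))" "convex hull (insert v (p ` g)) \<subseteq> S" using rm unfolding rooms_def by blast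
      then show ?thesis unfolding pim[OF Fn[OF gF]] by blast
    qed
  qed
  have "good p' (Suc n) F' (S \<union> K)"
    unfolding good_def using st' T' tc' ft' rm' s.card_F' s.card_edges cF cE unfolding F' by simp
  then show ?thesis unfolding p'_def F'_def N_def K_def .
qed

section \<open>A free apex over every face\<close>

text \<open>The bound only has to hold at the finitely many vertices of \<open>P\<close>.\<close>

lemma polytope_linear_bound:
  fixes l m :: "'a::euclidean_space \<Rightarrow> real"
  assumes P: "polytope P" and l: "\<And>A u. finite A \<Longrightarrow> sum u A = 1 \<Longrightarrow> l (\<Sum>v\<in>A. u v *\<^sub>R v) = (\<Sum>v\<in>A. u v * l v)"
    and m: "\<And>A u. finite A \<Longrightarrow> sum u A = 1 \<Longrightarrow> m (\<Sum>v\<in>A. u v *\<^sub>R v) = (\<Sum>v\<in>A. u v * m v)"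
    and nn: "\<And>x. x \<in> P \<Longrightarrow> 0 \<le> m x" and z: "\<And>x. x \<in> P \<Longrightarrow> m x = 0 \<Longrightarrow> l x \<le> 0"
  obtains M where "M > 0" "\<And>x. x \<in> P \<Longrightarrow> l x \<le> M * m x"
proof -
  obtain A where A: "finite A" "P = convex hull A" using P unfolding polytope_def by blast
  have AP: "v \<in> P" if "v \<in> A" for v using that A(2) by (simp add: hull_inc)
  \<comment> \<open>A vertex with \<open>m v = 0\<close> contributes 0, as division by 0 gives 0;
    there the bound comes from \<open>z\<close> instead. The summand 1 keeps \<open>M\<close>
    positive.\<close>
  define M where "M = 1 + (\<Sum>v\<in>A. \<bar>l v\<bar> / m v)"
  have nnq: "0 \<le> \<bar>l v\<bar> / m v" if "v \<in> A" for v using nn[OF AP[OF that]] by simp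
  have "0 \<le> (\<Sum>v\<in>A. \<bar>l v\<bar> / m v)" by (rule sum_nonneg) (rule nnq)
  then have M: "M > 0" unfolding M_def by linarith
  have Av: "l v \<le> M * m v" if v: "v \<in> A" for v
  proof (cases "m v = 0")
    case True then show ?thesis using z[OF AP[OF v]] by simp
  next
    case False
    then have p: "m v > 0" using nn[OF AP[OF v]] by simp
    have "\<bar>l v\<bar> / m v \<le> (\<Sum>v\<in>A. \<bar>l v\<bar> / m v)" by (rule member_le_sum[OF v _ A(1)]) (use nnq in auto)
    then have "\<bar>l v\<bar> / m v \<le> M" unfolding M_def by simp
    then have "\<bar>l v\<bar> \<le> M * m v" using p by (simp add: divide_le_eq)
    then show ?thesis by linarith
  qed
  show ?thesis
  proof (rule that[OF M])
    fix x assume "x \<in> P"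
    then obtain u where u: "\<And>v. v \<in> A \<Longrightarrow> 0 \<le> u v" "sum u A = 1" "(\<Sum>v\<in>A. u v *\<^sub>R v) = x"
      unfolding A(2) convex_hull_finite[OF A(1)] by blast
    have "l x = (\<Sum>v\<in>A. u v * l v)" unfolding u(3)[symmetric] by (rule l[OF A(1) u(2)])
    also have "\<dots> \<le> (\<Sum>v\<in>A. u v * (M * m v))" using u(1) Av by (intro sum_mono mult_left_mono) auto
    also have "\<dots> = M * (\<Sum>v\<in>A. u v * m v)" by (simp add: sum_distrib_left mult.left_commute)
    also have "(\<Sum>v\<in>A. u v * m v) = m x" unfolding u(3)[symmetric] by (rule m[OF A(1) u(2), symmetric])
    finally show "l x \<le> M * m x" .
  qed
qed

lemma orient_sum_affine:
  assumes "sum u A = 1"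
  shows "orient a b c (\<Sum>v\<in>A. u v *\<^sub>R v) = (\<Sum>v\<in>A. u v * orient a b c v)"
proof -
  have "(\<Sum>v\<in>A. u v *\<^sub>R v) - a = (\<Sum>v\<in>A. u v *\<^sub>R (v - a))"
    using assms by (simp add: scaleR_diff_right sum_subtractf scaleR_left.sum[symmetric])
  then show ?thesis unfolding orient_def by (simp add: inner_sum_right)
qed

lemma orient_perm: "orient x b c d = - orient d b c x" "orient a x c d = - orient a d c x" "orient a b x d = - orient a b d x"
  by (simp_all add: orient_def cross3_simps)

text \<open>The apex has to be low enough: with \<open>\<delta>\<close> the height coordinate and \<open>\<lambda>\<close> the sum of the
  coordinates of the vertices of \<open>abc\<close> outside \<open>G\<close>, the part of \<open>G\<close> above \<open>abc\<close> satisfies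
  \<open>\<lambda> \<le> M \<delta>\<close>, whereas the low tetrahedron satisfies \<open>\<lambda> \<ge> c (1 - h) / h \<cdot> \<delta>\<close>.\<close>

lemma low_tetrahedron_avoids_triangle:
  fixes a b c z :: "real^3"
  assumes D: "orient a b c z \<noteq> 0" and y: "y = u *\<^sub>R a + v *\<^sub>R b + w *\<^sub>R c" "0 < u" "0 < v" "0 < w" "u + v + w = 1"
    and G: "polytope G" and s: "s \<subset> {a,b,c}" and GT: "G \<inter> convex hull {a,b,c} \<subseteq> convex hull s"
  shows "\<forall>\<^sub>F h in at_right (0::real). convex hull {a,b,c,(1 - h) *\<^sub>R y + h *\<^sub>R z} \<inter> G \<subseteq> convex hull {a,b,c}"
proof -
  define D' where "D' = orient a b c z"
  have d: "distinct [a,b,c,z]" by (rule affine_independent_orient(2)[OF D])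
  define \<alpha> where "\<alpha> = (\<lambda>x. orient x b c z / D')"
  define \<beta> where "\<beta> = (\<lambda>x. orient a x c z / D')"
  define \<gamma> where "\<gamma> = (\<lambda>x. orient a b x z / D')"
  define \<delta> where "\<delta> = (\<lambda>x. orient a b c x / D')"
  have co: "\<alpha> x = u" "\<beta> x = v" "\<gamma> x = w" "\<delta> x = t"
    if "x = u *\<^sub>R a + v *\<^sub>R b + w *\<^sub>R c + t *\<^sub>R z" "u + v + w + t = 1" for x u v w t
    unfolding \<alpha>_def \<beta>_def \<gamma>_def \<delta>_def that(1) orient_combination[OF that(2)] D'_def using D by simp_all
  have aff: "\<alpha> (\<Sum>v\<in>A. u v *\<^sub>R v) = (\<Sum>v\<in>A. u v * \<alpha> v)" "\<beta> (\<Sum>v\<in>A. u v *\<^sub>R v) = (\<Sum>v\<in>A. u v * \<beta> v)"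
    "\<gamma> (\<Sum>v\<in>A. u v *\<^sub>R v) = (\<Sum>v\<in>A. u v * \<gamma> v)" "\<delta> (\<Sum>v\<in>A. u v *\<^sub>R v) = (\<Sum>v\<in>A. u v * \<delta> v)"
    if "sum u A = 1" for u and A :: "(real^3) set"
    unfolding \<alpha>_def \<beta>_def \<gamma>_def \<delta>_def
    by (simp_all add: orient_perm(1)[of _ b c z] orient_perm(2)[of a _ c z] orient_perm(3)[of a b _ z]
        orient_sum_affine[OF that] sum_divide_distrib sum_negf)
  have half: "polyhedron {x. 0 \<le> orient p q r x / e}" for p q r and e :: real
  proof -
    define n where "n = (1 / e) *\<^sub>R cross3 (q - p) (r - p)"
    have "orient p q r x / e = n \<bullet> x - n \<bullet> p" for x unfolding orient_def n_def by (simp add: inner_diff_right diff_divide_distrib)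
    then have "{x. 0 \<le> orient p q r x / e} = {x. n \<bullet> x \<ge> n \<bullet> p}" by auto
    then show ?thesis using polyhedron_halfspace_ge by metis
  qed
  \<comment> \<open>The tetrahedron \<open>abcz\<close>, written with half-spaces so that its
    intersection with \<open>G\<close> is again a polytope.\<close>
  define Q where "Q = {x. 0 \<le> \<alpha> x} \<inter> {x. 0 \<le> \<beta> x} \<inter> {x. 0 \<le> \<gamma> x} \<inter> {x. 0 \<le> \<delta> x}"
  have "polyhedron Q"
  proof -
    have "\<alpha> x = orient z b c x / - D'" "\<beta> x = orient a z c x / - D'" "\<gamma> x = orient a b z x / - D'" for x
      unfolding \<alpha>_def \<beta>_def \<gamma>_def by (simp_all add: orient_perm(1)[of x b c z] orient_perm(2)[of a x c z] orient_perm(3)[of a b x z])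
    then show ?thesis unfolding Q_def \<delta>_def by (simp add: half polyhedron_Int del: divide_minus_right)
  qed
  then have P: "polytope (G \<inter> Q)" by (rule polytope_Int_polyhedron[OF G])
  \<comment> \<open>The coordinates belonging to vertices outside \<open>s\<close> vanish on the
    hull of \<open>s\<close>, hence on the part of \<open>G\<close> in the triangle. As
    \<open>s\<close> is a proper subset, at least one coordinate is present.\<close>
  define lam where "lam = (\<lambda>x. (if a \<in> s then 0 else \<alpha> x) + (if b \<in> s then 0 else \<beta> x) + (if c \<in> s then 0 else \<gamma> x))"
  have QT: "x \<in> convex hull {a,b,c}" if "x \<in> Q" "\<delta> x = 0" for x
  proof -
    have "x \<in> convex hull {a,b,c,z}" unfolding in_tetrahedron_iff[OF D]
      using that(1) unfolding Q_def \<alpha>_def \<beta>_def \<gamma>_def \<delta>_def D'_def by blast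
    then obtain u v w t where x: "x = u *\<^sub>R a + v *\<^sub>R b + w *\<^sub>R c + t *\<^sub>R z" "0 \<le> u" "0 \<le> v" "0 \<le> w" "u + v + w + t = 1"
      unfolding convex_hull_4 by blast
    have "t = 0" using co(4)[OF x(1,5)] that(2) by simp
    then have "x = u *\<^sub>R a + v *\<^sub>R b + w *\<^sub>R c" "u + v + w = 1" using x by simp_all
    then show ?thesis unfolding convex_hull_3 using x(2-4) by blast
  qed
  have ls: "lam x = 0" if "x \<in> convex hull s" for x
  proof -
    have fs: "finite s" using s finite_subset by blast
    obtain t where t: "sum t s = 1" "(\<Sum>i\<in>s. t i *\<^sub>R i) = x" using \<open>x \<in> convex hull s\<close> unfolding convex_hull_finite[OF fs] by blast
    have val: "\<alpha> a = 1" "\<alpha> b = 0" "\<alpha> c = 0" "\<beta> a = 0" "\<beta> b = 1" "\<beta> c = 0" "\<gamma> a = 0" "\<gamma> b = 0" "\<gamma> c = 1"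
      using co[of a 1 0 0 0] co[of b 0 1 0 0] co[of c 0 0 1 0] by simp_all
    have "a \<notin> s \<Longrightarrow> \<alpha> x = 0" unfolding t(2)[symmetric] aff(1)[OF t(1)] using s val by (intro sum.neutral ballI) auto
    moreover have "b \<notin> s \<Longrightarrow> \<beta> x = 0" unfolding t(2)[symmetric] aff(2)[OF t(1)] using s val by (intro sum.neutral ballI) auto
    moreover have "c \<notin> s \<Longrightarrow> \<gamma> x = 0" unfolding t(2)[symmetric] aff(3)[OF t(1)] using s val by (intro sum.neutral ballI) auto
    ultimately show ?thesis unfolding lam_def by simp
  qed
  obtain M where M: "M > 0" "\<And>x. x \<in> G \<inter> Q \<Longrightarrow> lam x \<le> M * \<delta> x"
  proof (rule polytope_linear_bound[OF P, of lam \<delta>])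
    show "lam (\<Sum>v\<in>A. u v *\<^sub>R v) = (\<Sum>v\<in>A. u v * lam v)" if "finite A" "sum u A = 1" for A u
      unfolding lam_def by (simp add: aff[OF that(2)] sum.distrib[symmetric] distrib_left)
    show "\<delta> (\<Sum>v\<in>A. u v *\<^sub>R v) = (\<Sum>v\<in>A. u v * \<delta> v)" if "finite A" "sum u A = 1" for A u
      by (rule aff(4)[OF that(2)])
    show "0 \<le> \<delta> x" if "x \<in> G \<inter> Q" for x using that unfolding Q_def by blast
    show "lam x \<le> 0" if "x \<in> G \<inter> Q" "\<delta> x = 0" for x using QT[of x] GT ls[of x] that by fastforce
  qed (blast intro: that)
  \<comment> \<open>A point of the low tetrahedron with weight \<open>t\<close> at the apex has base
    coordinates at least t (1 - h) Y, whereas its height is only t h. For small \<open>h\<close>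
    this contradicts the bound by \<open>M\<close> unless \<open>t\<close> is 0.\<close>
  define Y where "Y = min u (min v w)"
  have Y: "Y > 0" unfolding Y_def using y by simp
  have "((\<lambda>h. (1 - h) * Y - M * h) \<longlongrightarrow> (1 - 0) * Y - M * 0) (at_right 0)" by (intro tendsto_intros)
  then have "\<forall>\<^sub>F h in at_right 0. (1 - h) * Y - M * h > 0" by (rule order_tendstoD(1)) (use Y in simp)
  moreover have "\<forall>\<^sub>F h in at_right (0::real). h < 1" by (rule eventually_at_right_real[THEN eventually_mono, of 0 1]) auto
  moreover have "\<forall>\<^sub>F h in at_right (0::real). 0 < h" by (simp add: eventually_at_right_less)
  ultimately show ?thesis
  proof eventually_elim
    case (elim h)
    show ?case
    proof
      fix x assume x: "x \<in> convex hull {a,b,c,(1 - h) *\<^sub>R y + h *\<^sub>R z} \<inter> G"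
      then obtain p q r t where pq: "x = p *\<^sub>R a + q *\<^sub>R b + r *\<^sub>R c + t *\<^sub>R ((1 - h) *\<^sub>R y + h *\<^sub>R z)"
        and nn: "0 \<le> p" "0 \<le> q" "0 \<le> r" "0 \<le> t" and sum1: "p + q + r + t = 1"
        unfolding convex_hull_4 by blast
      define k where "k = t * (1 - h)"
      have k0: "k \<ge> 0" unfolding k_def using nn elim by simp
      have e: "x = (p + k * u) *\<^sub>R a + (q + k * v) *\<^sub>R b + (r + k * w) *\<^sub>R c + (t * h) *\<^sub>R z"
        unfolding pq y(1) k_def by (simp add: algebra_simps)
      have s1: "(p + k * u) + (q + k * v) + (r + k * w) + t * h = 1"
      proof -
        have "(p + k * u) + (q + k * v) + (r + k * w) + t * h = p + q + r + k * (u + v + w) + t * h" by (simp add: algebra_simps)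
        also have "\<dots> = 1" unfolding y(5) k_def using sum1 by (simp add: algebra_simps)
        finally show ?thesis .
      qed
      note C = co[OF e s1]
      have xQ: "x \<in> Q" unfolding Q_def using C nn k0 y elim by simp
      then have "lam x \<le> M * \<delta> x" using M(2) x by blast
      moreover have "lam x \<ge> k * Y"
      proof -
        have "k * Y \<le> k * u" "k * Y \<le> k * v" "k * Y \<le> k * w" unfolding Y_def using k0 by (intro mult_left_mono; simp)+
        then have 1: "k * Y \<le> \<alpha> x" "k * Y \<le> \<beta> x" "k * Y \<le> \<gamma> x" unfolding C using nn by linarith+
        have 0: "0 \<le> \<alpha> x" "0 \<le> \<beta> x" "0 \<le> \<gamma> x" using xQ unfolding Q_def by auto
        have "a \<notin> s \<or> b \<notin> s \<or> c \<notin> s" using s by blast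
        then show ?thesis unfolding lam_def using 0 1 by auto
      qed
      ultimately have "k * Y \<le> M * (t * h)" unfolding C by linarith
      then have "t * ((1 - h) * Y - M * h) \<le> 0" unfolding k_def by (simp add: algebra_simps)
      then have "t = 0" using elim(1) nn(4) by (simp add: mult_le_0_iff)
      then have "x = p *\<^sub>R a + q *\<^sub>R b + r *\<^sub>R c" "p + q + r = 1" using pq sum1 by simp_all
      then show "x \<in> convex hull {a,b,c}" unfolding convex_hull_3 using nn by blast
    qed
  qed
qed

lemma orient_0_face:
  assumes D: "orient a b c z \<noteq> 0" and x: "x \<in> convex hull {a,b,c,z}" "orient a b c x = 0"
  shows "x \<in> convex hull {a,b,c}"
proof -
  obtain u v w t where e: "x = u *\<^sub>R a + v *\<^sub>R b + w *\<^sub>R c + t *\<^sub>R z" "0 \<le> u" "0 \<le> v" "0 \<le> w" "u + v + w + t = 1"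
    using x(1) unfolding convex_hull_4 by blast
  have "t = 0" using orient_combination(1)[OF e(5), of a b c z] x(2) D unfolding e(1) by simp
  then have "x = u *\<^sub>R a + v *\<^sub>R b + w *\<^sub>R c" "u + v + w = 1" using e by simp_all
  then show ?thesis unfolding convex_hull_3 using e(2-4) by blast
qed

text \<open>The faces other than \<open>abc\<close> are avoided once the tetrahedron is low. Its
  part off the base is then connected and misses the frontier, so it lies wholly inside or wholly
  outside \<open>S\<close>. Inside is impossible: together with the room on the other side it would
  make the frontier point \<open>y\<close> interior.\<close>

lemma free_apex:
  assumes G: "good p n F S" and f: "{a,b,c} \<in> F"
    and y: "y = u *\<^sub>R p a + v *\<^sub>R p b + w *\<^sub>R p c" "0 < u" "0 < v" "0 < w" "u + v + w = 1"
  obtains N where "N \<noteq> 0" "N \<bullet> (p b - p a) = 0" "N \<bullet> (p c - p a) = 0"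
    "\<forall>\<^sub>F h in at_right (0::real). orient (p a) (p b) (p c) (y + h *\<^sub>R N) \<noteq> 0 \<and>
       convex hull {p a, p b, p c, y + h *\<^sub>R N} \<inter> S = convex hull {p a, p b, p c}"
proof -
  define A B C where "A = p a" and "B = p b" and "C = p c"
  have T: "is_tri_polyhedron p n F S" and rm: "rooms p F S" using G unfolding good_def by auto
  have cS: "compact S" and fin: "finite F"
    and c3: "\<And>g. g \<in> F \<Longrightarrow> card g = 3" and nc: "\<And>g. g \<in> F \<Longrightarrow> \<not> collinear (p ` g)"
    and fr: "frontier S = (\<Union>g\<in>F. convex hull (p ` g))"
    and hI: "\<And>g h. g \<in> F \<Longrightarrow> h \<in> F \<Longrightarrow> convex hull (p ` g) \<inter> convex hull (p ` h) = convex hull (p ` (g \<inter> h))"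
    using T unfolding is_tri_polyhedron_def by simp_all
  have clS: "closed S" using cS by (rule compact_imp_closed)
  have im: "p ` {a,b,c} = {A,B,C}" unfolding A_def B_def C_def by simp
  have fT: "convex hull {A,B,C} \<subseteq> frontier S" unfolding im[symmetric] fr by (rule UN_upper[OF f])
  obtain r where r: "orient A B C r \<noteq> 0" "convex hull {A,B,C,r} \<subseteq> S"
  proof -
    obtain r where "\<not> coplanar (insert r (p ` {a,b,c}))" "convex hull (insert r (p ` {a,b,c})) \<subseteq> S"
      using rm f unfolding rooms_def by blast
    moreover have "insert r (p ` {a,b,c}) = {A,B,C,r}" unfolding im by auto
    ultimately show thesis using that coplanar_iff_orient by metis
  qed
  have "\<not> collinear {A,B,C}" using nc[OF f] im by simp
  from exists_orient[OF this] obtain M where M: "M \<noteq> 0" "M \<bullet> (B - A) = 0" "M \<bullet> (C - A) = 0"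
    "\<And>t. orient A B C (A + t *\<^sub>R M) = t * (M \<bullet> M)" by blast
  \<comment> \<open>The sign makes the normal point away from the room with apex \<open>r\<close>,
    that is, out of the solid.\<close>
  define N where "N = - sgn (orient A B C r) *\<^sub>R M"
  have N0: "N \<noteq> 0" "N \<bullet> (B - A) = 0" "N \<bullet> (C - A) = 0" unfolding N_def using M r(1) by (auto simp: sgn_zero_iff)
  have y': "y = u *\<^sub>R A + v *\<^sub>R B + w *\<^sub>R C" unfolding A_def B_def C_def by (rule y(1))
  have yT: "y \<in> convex hull {A,B,C}" unfolding convex_hull_3
    by (rule CollectI, rule exI[of _ u], rule exI[of _ v], rule exI[of _ w]) (use y' y(2-5) in simp)
  have y0: "orient A B C y = 0" by (rule hull3_orient_0[OF yT])
  have oN: "orient A B C (y + h *\<^sub>R N) = - h * sgn (orient A B C r) * (M \<bullet> M)" for h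
  proof -
    have "orient A B C (y + h *\<^sub>R N) = orient A B C y + (orient A B C (A + h *\<^sub>R N) - orient A B C A)"
      unfolding orient_def by (simp add: inner_diff_right inner_add_right)
    also have "orient A B C (A + h *\<^sub>R N) = - h * sgn (orient A B C r) * (M \<bullet> M)"
      using M(4)[of "- h * sgn (orient A B C r)"] unfolding N_def by simp
    also have "orient A B C A = 0" unfolding orient_def by simp
    finally show ?thesis using y0 by simp
  qed
  define z where "z = y + N"
  have Dz: "orient A B C z \<noteq> 0" using oN[of 1] M(1) r(1) unfolding z_def by (simp add: sgn_zero_iff)
  have opp: "orient A B C r / orient A B C z < 0"
    using oN[of 1] M(1) r(1) unfolding z_def by (cases "orient A B C r > 0") (auto simp: divide_less_0_iff sgn_if)
  have zh: "(1 - h) *\<^sub>R y + h *\<^sub>R z = y + h *\<^sub>R N" for h unfolding z_def by (simp add: algebra_simps)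
  have ev: "\<forall>\<^sub>F h in at_right (0::real). convex hull {A,B,C,y + h *\<^sub>R N} \<inter> convex hull (p ` g) \<subseteq> convex hull {A,B,C}"
    if g: "g \<in> F - {{a,b,c}}" for g
  proof -
    have gF: "g \<in> F" using g by simp
    have "finite g" using c3[OF gF] by (metis card.infinite zero_neq_numeral)
    then have pg: "polytope (convex hull (p ` g))" unfolding polytope_def by blast
    have "g \<inter> {a,b,c} \<subset> {a,b,c}" by (rule card_3_Int_psubset[OF c3[OF gF] c3[OF f]]) (use g in blast)
    moreover have "inj_on p {a,b,c}"
    proof (rule inj_on_subset)
      show "{a,b,c} \<subseteq> {..<n}" using is_tri_polyhedron_vertices[OF T] f by blast
      show "inj_on p {..<n}" using T unfolding is_tri_polyhedron_def by simp
    qed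
    ultimately have "p ` (g \<inter> {a,b,c}) \<subset> {A,B,C}"
      unfolding im[symmetric] using inj_on_image_Int by (metis image_strict_mono)
    from low_tetrahedron_avoids_triangle[OF Dz y' y(2-5) pg this] show ?thesis
      unfolding zh using hI[OF gF f] unfolding im by simp
  qed
  have all: "\<forall>\<^sub>F h in at_right (0::real). \<forall>g\<in>F - {{a,b,c}}. convex hull {A,B,C,y + h *\<^sub>R N} \<inter> convex hull (p ` g) \<subseteq> convex hull {A,B,C}"
    by (rule eventually_ball_finite) (use fin ev in auto)
  have "\<forall>\<^sub>F h in at_right (0::real). orient A B C (y + h *\<^sub>R N) \<noteq> 0 \<and>
       convex hull {A,B,C, y + h *\<^sub>R N} \<inter> S = convex hull {A,B,C}"
    using all eventually_at_right_less[of 0]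
  proof eventually_elim
    case (elim h)
    have h: "h > 0" by fact
    define x where "x = y + h *\<^sub>R N"
    define K where "K = convex hull {A,B,C,x}"
    have ox: "orient A B C x = h * orient A B C z" using oN[of h] oN[of 1] unfolding x_def z_def by simp
    have Dx: "orient A B C x \<noteq> 0" unfolding ox using h Dz by simp
    have oppx: "orient A B C r / orient A B C x < 0" using opp h Dz unfolding ox
      by (auto simp: divide_less_0_iff zero_less_mult_iff mult_less_0_iff)
    \<comment> \<open>The tetrahedron without its base. It is convex, and a frontier point of
      \<open>S\<close> in it would lie in the base plane.\<close>
    define P where "P = {q \<in> K. 0 < orient A B C q / orient A B C x}"
    have TS: "convex hull {A,B,C} \<subseteq> S"
      using fT frontier_subset_closed[OF clS] by (rule subset_trans)
    have Pf: "P \<inter> frontier S = {}"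
    proof -
      have qT: "q \<in> convex hull {A,B,C}" if q: "q \<in> P" "q \<in> frontier S" for q
      proof -
        obtain g where g: "g \<in> F" "q \<in> convex hull (p ` g)" using q(2) fr by blast
        show ?thesis
        proof (cases "g = {a,b,c}")
          case True then show ?thesis using g(2) im by simp
        next
          case False then show ?thesis using elim(1) g q(1) unfolding P_def K_def x_def by blast
        qed
      qed
      have False if q: "q \<in> P" "q \<in> frontier S" for q
        using hull3_orient_0[OF qT[OF q]] q(1) unfolding P_def by simp
      then show ?thesis by blast
    qed
    have convP: "convex P"
    proof -
      have "P = K \<inter> {q. 0 < orient A B C q / orient A B C x}" unfolding P_def by blast
      moreover have "convex {q. 0 < orient A B C q / orient A B C x}"
      proof -
        define n where "n = (1 / orient A B C x) *\<^sub>R cross3 (B - A) (C - A)"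
        have "orient A B C q / orient A B C x = n \<bullet> q - n \<bullet> A" for q
          unfolding n_def orient_def[of A B C q] by (simp add: inner_diff_right diff_divide_distrib)
        then have "{q. 0 < orient A B C q / orient A B C x} = {q. n \<bullet> q > n \<bullet> A}" by auto
        then show ?thesis using convex_halfspace_gt by metis
      qed
      ultimately show ?thesis unfolding K_def by (simp add: convex_Int)
    qed
    have "P \<inter> S = {}"
    proof (rule ccontr)
      assume ne: "P \<inter> S \<noteq> {}"
      have PS: "P \<subseteq> S"
      proof (rule ccontr)
        assume "\<not> P \<subseteq> S"
        then have "P - S \<noteq> {}" by blast
        then have "P \<inter> frontier S \<noteq> {}" using connected_Int_frontier[OF convex_connected[OF convP] ne] by blast
        then show False using Pf by blast
      qed
      \<comment> \<open>Near \<open>y\<close> the points strictly above the plane lie in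
        \<open>P\<close>, and all the others in the room below, so a ball around \<open>y\<close>
        would be contained in \<open>S\<close>.\<close>
      obtain s where s: "s > 0" "\<And>q. q \<in> ball y s \<Longrightarrow> 0 \<le> orient A B C q / orient A B C x \<Longrightarrow> q \<in> convex hull {A,B,C,x}"
        using tetrahedron_neighbourhood[OF Dx y' y(2-5)] by metis
      obtain t where t: "t > 0" "\<And>q. q \<in> ball y t \<Longrightarrow> 0 \<le> orient A B C q / orient A B C r \<Longrightarrow> q \<in> convex hull {A,B,C,r}"
        using tetrahedron_neighbourhood[OF r(1) y' y(2-5)] by metis
      have "ball y (min s t) \<subseteq> S"
      proof
        fix q assume q: "q \<in> ball y (min s t)"
        show "q \<in> S"
        proof (cases "0 < orient A B C q / orient A B C x")
          case True
          then have "q \<in> P" unfolding P_def K_def using s(2)[of q] q by simp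
          then show ?thesis using PS by blast
        next
          case False
          then have "0 \<le> orient A B C q / orient A B C r" using oppx by (auto simp: zero_le_divide_iff zero_less_divide_iff divide_less_0_iff)
          then show ?thesis using t(2)[of q] q r(2) by auto
        qed
      qed
      then have "y \<in> interior S" unfolding mem_interior using s(1) t(1) by (intro exI[of _ "min s t"]) simp
      moreover have "y \<in> frontier S" using yT fT by blast
      ultimately show False unfolding frontier_def by blast
    qed
    have "K \<inter> S \<subseteq> convex hull {A,B,C}"
    proof
      fix q assume q: "q \<in> K \<inter> S"
      then have "0 \<le> orient A B C q / orient A B C x" using in_tetrahedron_iff[OF Dx] unfolding K_def by blast
      moreover have "\<not> 0 < orient A B C q / orient A B C x" using q \<open>P \<inter> S = {}\<close> unfolding P_def by blast
      ultimately have "orient A B C q = 0" using Dx by simp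
      then show "q \<in> convex hull {A,B,C}" using orient_0_face[OF Dx] q unfolding K_def by blast
    qed
    moreover have "convex hull {A,B,C} \<subseteq> K" unfolding K_def by (rule hull_mono) auto
    ultimately show ?case using Dx TS unfolding x_def K_def by blast
  qed
  then show thesis unfolding A_def B_def C_def by (rule that[OF N0[unfolded A_def B_def C_def]])
qed

section \<open>The starting tetrahedron\<close>

lemma lessThan_4_nat: "{..<4} = {0,1,2,3::nat}"
  by auto

lemma good_tetrahedron:
  assumes D: "orient (p 0) (p 1) (p 2) (p 3) \<noteq> 0"
  shows "good p 4 {{0,1,2},{0,1,3},{0,2,3},{1,2,3}} (convex hull {p 0, p 1, p 2, p (3::nat)})"
proof -
  define F where "F = {{0,1,2},{0,1,3},{0,2,3},{1,2,3::nat}}"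
  define S where "S = convex hull {p 0, p 1, p 2, p 3}"
  have d: "distinct [p 0, p 1, p 2, p 3]" by (rule affine_independent_orient(2)[OF D])
  have inj: "inj_on p {..<4}" unfolding lessThan_4_nat using d by (auto simp: inj_on_def)
  have Fsub: "g \<subseteq> {0,1,2,3}" if "g \<in> F" for g using that unfolding F_def by auto
  have F4: "g \<subseteq> {..<4}" if "g \<in> F" for g unfolding lessThan_4_nat by (rule Fsub[OF that])
  have Fim: "p ` g \<subseteq> {p 0, p 1, p 2, p 3}" if "g \<in> F" for g using Fsub[OF that] by auto
  have c3: "card g = 3" if "g \<in> F" for g using that unfolding F_def by auto
  have E: "tri_edges F = {{0,1},{0,2},{0,3},{1,2},{1,3},{2,3}}"
  proof
    show "{{0,1},{0,2},{0,3},{1,2},{1,3},{2,3}} \<subseteq> tri_edges F" unfolding tri_edges_def F_def by auto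
    show "tri_edges F \<subseteq> {{0,1},{0,2},{0,3},{1,2},{1,3},{2,3}}"
    proof
      fix e assume "e \<in> tri_edges F"
      then obtain g where g: "g \<in> F" "e \<subseteq> g" "card e = 2" unfolding tri_edges_def by blast
      from g(1) consider "g = {0,1,2}" | "g = {0,1,3}" | "g = {0,2,3}" | "g = {1,2,3}" unfolding F_def by blast
      then show "e \<in> {{0,1},{0,2},{0,3},{1,2},{1,3},{2,3}}"
      proof cases
        case 1 from doubleton_subset_triple[OF g(2)[unfolded 1] g(3)] show ?thesis by (elim disjE) simp_all
      next
        case 2 from doubleton_subset_triple[OF g(2)[unfolded 2] g(3)] show ?thesis by (elim disjE) simp_all
      next
        case 3 from doubleton_subset_triple[OF g(2)[unfolded 3] g(3)] show ?thesis by (elim disjE) simp_all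
      next
        case 4 from doubleton_subset_triple[OF g(2)[unfolded 4] g(3)] show ?thesis by (elim disjE) simp_all
      qed
    qed
  qed
  have all: "g \<union> h = {0,1,2,3}" if "g \<in> F" "h \<in> F" "g \<noteq> h" for g h using that unfolding F_def by auto
  \<comment> \<open>The faces have the distinct vertex sums 3, 4, 5 and 6.\<close>
  have ne: "{0,1,2} \<noteq> {0,1,3::nat}" "{0,1,2} \<noteq> {0,2,3::nat}" "{0,1,2} \<noteq> {1,2,3::nat}" "{0,1,3} \<noteq> {0,2,3::nat}"
    "{0,1,3} \<noteq> {1,2,3::nat}" "{0,2,3} \<noteq> {1,2,3::nat}"
    by (rule notI, drule arg_cong[where f = "\<lambda>A. \<Sum>A"], simp)+
  have ncop: "\<not> coplanar {p 0, p 1, p 2, p 3}" using D by (rule orient_imp_not_coplanar)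
  have tri: "is_tri_polyhedron p 4 F S"
    unfolding is_tri_polyhedron_def
  proof (intro conjI ballI)
    show "compact S" unfolding S_def by (simp add: finite_imp_compact_convex_hull)
    show "finite F" unfolding F_def by simp
    show "inj_on p {..<4}" by (rule inj)
    show "\<Union>F = {..<4}" unfolding lessThan_4_nat F_def by auto
    show "card g = 3" if "g \<in> F" for g by (rule c3[OF that])
    show "\<not> collinear (p ` g)" if g: "g \<in> F" for g
    proof -
      have "\<not> affine_dependent (p ` g)" using affine_dependent_subset Fim[OF g] affine_independent_orient(1)[OF D] by blast
      moreover have "card (p ` g) = card g"
        by (rule card_image, rule inj_on_subset[OF inj F4[OF g]])
      then have "card (p ` g) = 3" using c3[OF g] by simp
      then obtain u1 u2 u3 where "p ` g = {u1,u2,u3}" "distinct [u1,u2,u3]" by (auto simp: card_3_iff)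
      ultimately show ?thesis by (simp add: collinear_3_eq_affine_dependent)
    qed
    show "frontier S = (\<Union>g\<in>F. convex hull (p ` g))"
      unfolding S_def frontier_tetrahedron[OF D] F_def by (simp add: Un_assoc)
    show "convex hull (p ` g) \<inter> convex hull (p ` h) = convex hull (p ` (g \<inter> h))" if g: "g \<in> F" and h: "h \<in> F" for g h
    proof -
      have "p ` (g \<inter> h) = p ` g \<inter> p ` h"
        by (rule inj_on_image_Int[OF inj F4[OF g] F4[OF h]])
      then show ?thesis using tetrahedron_hull_Int[OF D Fim[OF g] Fim[OF h]] by simp
    qed
    show "card {g\<in>F. e \<subseteq> g} = 2" if "e \<in> tri_edges F" for e
    proof -
      show ?thesis using that unfolding E unfolding F_def Collect_filter_insert
        by (elim insertE emptyE) (simp_all add: ne del: One_nat_def)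
    qed
  qed
  have stk: "stacked p 4 F S" unfolding F_def S_def by (rule stacked.base[OF ncop])
  have adj: "poly_adj F i j" if "i < 4" "j < 4" "i \<noteq> j" for i j
  proof -
    have "i \<in> {0,1,2,3}" "j \<in> {0,1,2,3}" using that by auto
    then show ?thesis unfolding poly_adj_def E using that(3)
      by (elim insertE emptyE) (simp_all add: doubleton_eq_iff del: One_nat_def)
  qed
  have top: "topologically_convex p 4 F S"
    unfolding topologically_convex_def
  proof
    have i: "\<not> affine_dependent {p 0, p 1, p 2, p 3}" by (rule affine_independent_orient(1)[OF D])
    have "card {p 0, p 1, p 2, p 3} = 4" using d by simp
    then have "aff_dim {p 0, p 1, p 2, p 3} = 3" using aff_dim_affine_independent[OF i] by simp
    then have dS: "aff_dim S = 3" unfolding S_def by (simp add: aff_dim_convex_hull)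
    then have "affine hull S = UNIV" using aff_dim_eq_full[of S] by simp
    then have rS: "rel_frontier S = frontier S" by (rule rel_frontier_frontier)
    have rC: "rel_frontier (cball (0::real^3) 1) = sphere 0 1"
      by (simp add: rel_frontier_cball)
    have "rel_frontier S homeomorphic rel_frontier (cball (0::real^3) 1)"
    proof (rule homeomorphic_rel_frontiers_convex_bounded_sets)
      show "convex S" "bounded S" unfolding S_def by (simp_all add: compact_imp_bounded finite_imp_compact_convex_hull)
      show "aff_dim S = aff_dim (cball (0::real^3) 1)" using dS by (simp add: aff_dim_cball)
    qed auto
    then show "frontier S homeomorphic sphere (0::real^3) 1" unfolding rS rC .
    show "three_connected {..<4} (poly_adj F)"
      unfolding three_connected_def
    proof (intro conjI allI impI ballI)
      fix X and u v :: nat assume uv: "u \<in> {..<4} - X" "v \<in> {..<4} - X"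
      show "(\<lambda>x y. poly_adj F x y \<and> x \<in> {..<4} - X \<and> y \<in> {..<4} - X)\<^sup>*\<^sup>* u v"
      proof (cases "u = v")
        case False
        then show ?thesis using uv adj[of u v] by (intro r_into_rtranclp) auto
      qed simp
    qed auto
  qed
  have "faces_are_triangles p F"
    unfolding faces_are_triangles_def
  proof (intro ballI impI)
    fix g h assume "g \<in> F" "h \<in> F" "g \<noteq> h \<and> card (g \<inter> h) = 2"
    then have "g \<union> h = {0,1,2,3}" using all by blast
    then show "\<not> coplanar (p ` (g \<union> h))" using ncop by simp
  qed
  moreover have "rooms p F S"
    unfolding rooms_def
  proof
    fix g assume "g \<in> F"
    then consider "g = {0,1,2}" | "g = {0,1,3}" | "g = {0,2,3}" | "g = {1,2,3}" unfolding F_def by blast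
    then have "\<exists>i. insert (p i) (p ` g) = {p 0, p 1, p 2, p 3}"
    proof cases
      case 1 then show ?thesis by (intro exI[of _ 3]) auto
    next
      case 2 then show ?thesis by (intro exI[of _ 2]) auto
    next
      case 3 then show ?thesis by (intro exI[of _ 1]) auto
    next
      case 4 then show ?thesis by (intro exI[of _ 0]) auto
    qed
    then show "\<exists>v. \<not> coplanar (insert v (p ` g)) \<and> convex hull (insert v (p ` g)) \<subseteq> S"
      using ncop unfolding S_def by (metis order_refl)
  qed
  moreover have "card F = 4"
  proof -
    show ?thesis unfolding F_def by (simp add: ne del: One_nat_def)
  qed
  moreover have "card (tri_edges F) = 6" unfolding E by (simp add: doubleton_eq_iff)
  ultimately have "good p 4 F S" unfolding good_def using stk tri top by simp
  then show ?thesis unfolding F_def S_def .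
qed

lemma exists_good_tetrahedron: "\<exists>p F S. good p 4 F S"
proof -
  define p where "p = (\<lambda>i::nat. if i = 0 then 0 else if i = 1 then vector [1,0,0] else if i = 2 then vector [0,1,0]
    else (vector [0,0,1] :: real^3) :: real^3) "
  have "orient (p 0) (p 1) (p 2) (p (3::nat)) \<noteq> 0"
    unfolding orient_def p_def by (simp add: cross3_def inner_vec_def sum_3)
  then show ?thesis using good_tetrahedron by blast
qed

section \<open>Angles of a hat\<close>

lemma angle_between_scaleR: "c > 0 \<Longrightarrow> angle_between u (c *\<^sub>R v) = angle_between u v"
  by (simp add: angle_between_def)

lemma angle_between_scaleR_left: "c > 0 \<Longrightarrow> angle_between (c *\<^sub>R u) v = angle_between u v"
  by (simp add: angle_between_def)

lemma angle_between_minus: "angle_between u (- v) = pi - angle_between u v"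
proof -
  have "u \<bullet> (- v) / (norm u * norm (- v)) = - (u \<bullet> v / (norm u * norm v))" by simp
  then show ?thesis unfolding angle_between_def
    using arccos_minus[OF angle_between_arg, of u v] by simp
qed

text \<open>Cosine and sine of both parts are explicit, and the addition theorems give the cosine
  \<open>c\<close> and a positive sine for their sum. Positivity of the sine keeps the sum below pi,
  where the cosine determines the angle.\<close>

lemma angle_between_split_unit:
  fixes u v :: "'a::real_inner"
  assumes n: "norm u = 1" "norm v = 1" and c: "\<bar>u \<bullet> v\<bar> < 1" and xy: "x > 0" "y > 0"
  shows "angle_between u (x *\<^sub>R u + y *\<^sub>R v) + angle_between (x *\<^sub>R u + y *\<^sub>R v) v = angle_between u v"
proof -
  define c where "c = u \<bullet> v"
  define s where "s = x *\<^sub>R u + y *\<^sub>R v"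
  define k where "k = norm s"
  define a where "a = angle_between u s"
  define b where "b = angle_between s v"
  have uu: "u \<bullet> u = 1" "v \<bullet> v = 1" using n by (simp_all add: dot_square_norm)
  have k2: "k\<^sup>2 = x\<^sup>2 + y\<^sup>2 + 2 * x * y * c"
    unfolding k_def s_def power2_norm_eq_inner c_def
    by (simp add: inner_add_left inner_add_right uu inner_commute[of v u]) (simp add: algebra_simps power2_eq_square)
  have c1: "-1 < c" "c < 1" using c unfolding c_def by auto
  have "x\<^sup>2 + y\<^sup>2 + 2 * x * y * c > x\<^sup>2 + y\<^sup>2 - 2 * x * y"
    using mult_strict_left_mono[OF c1(1), of "2 * x * y"] xy by simp
  moreover have "x\<^sup>2 + y\<^sup>2 - 2 * x * y = (x - y)\<^sup>2" by (simp add: power2_diff)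
  ultimately have "k\<^sup>2 > 0" unfolding k2 using zero_le_power2[of "x - y"] by linarith
  then have k: "k > 0" unfolding k_def by simp
  have us: "u \<bullet> s = x + y * c" "s \<bullet> v = x * c + y" unfolding s_def c_def by (simp_all add: inner_add_left inner_add_right uu)
  have ca: "cos a = (x + y * c) / k" unfolding a_def angle_between_def
    using angle_between_arg[of u s] by (simp add: n us k_def)
  have cb: "cos b = (x * c + y) / k" unfolding b_def angle_between_def
    using angle_between_arg[of s v] by (simp add: n us k_def)
  have ab: "0 \<le> a" "a \<le> pi" "0 \<le> b" "b \<le> pi" unfolding a_def b_def angle_between_def
    using arccos_lbound[OF angle_between_arg] arccos_ubound[OF angle_between_arg] by auto
  \<comment> \<open>\<open>r\<close> is the sine of the angle between \<open>u\<close> and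
    \<open>v\<close>.\<close>
  define r where "r = sqrt (1 - c\<^sup>2)"
  have "\<bar>c\<bar> < 1" using c1 by linarith
  then have "c\<^sup>2 < 1" by (simp add: abs_square_less_1)
  then have r2: "r\<^sup>2 = 1 - c\<^sup>2" "r > 0" unfolding r_def by simp_all
  have sa: "sin a = y * r / k"
  proof -
    have "(sin a)\<^sup>2 = 1 - ((x + y * c) / k)\<^sup>2" using sin_squared_eq[of a] ca by simp
    also have "\<dots> = (k\<^sup>2 - (x + y * c)\<^sup>2) / k\<^sup>2" using k by (simp add: power_divide diff_divide_distrib)
    also have "k\<^sup>2 - (x + y * c)\<^sup>2 = (y * r)\<^sup>2" unfolding k2 power_mult_distrib r2(1) by (simp add: power2_eq_square algebra_simps)
    finally have "(sin a)\<^sup>2 = (y * r / k)\<^sup>2" by (simp add: power_divide)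
    then show ?thesis using sin_ge_zero[OF ab(1,2)] xy r2(2) k by (simp add: power2_eq_iff_nonneg)
  qed
  have sb: "sin b = x * r / k"
  proof -
    have "(sin b)\<^sup>2 = 1 - ((x * c + y) / k)\<^sup>2" using sin_squared_eq[of b] cb by simp
    also have "\<dots> = (k\<^sup>2 - (x * c + y)\<^sup>2) / k\<^sup>2" using k by (simp add: power_divide diff_divide_distrib)
    also have "k\<^sup>2 - (x * c + y)\<^sup>2 = (x * r)\<^sup>2" unfolding k2 power_mult_distrib r2(1) by (simp add: power2_eq_square algebra_simps)
    finally have "(sin b)\<^sup>2 = (x * r / k)\<^sup>2" by (simp add: power_divide)
    then show ?thesis using sin_ge_zero[OF ab(3,4)] xy r2(2) k by (simp add: power2_eq_iff_nonneg)
  qed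
  have "cos (a + b) = ((x + y * c) * (x * c + y) - (y * r) * (x * r)) / k\<^sup>2"
    unfolding cos_add ca cb sa sb by (simp add: diff_divide_distrib power2_eq_square)
  also have "(x + y * c) * (x * c + y) - (y * r) * (x * r) = c * k\<^sup>2"
  proof -
    have "(y * r) * (x * r) = x * y * r\<^sup>2" by (simp add: power2_eq_square)
    then show ?thesis unfolding r2(1) k2 by (simp add: power2_eq_square algebra_simps)
  qed
  finally have cos: "cos (a + b) = c" using k by simp
  have "sin (a + b) = ((y * r) * (x * c + y) + (x + y * c) * (x * r)) / k\<^sup>2"
    unfolding sin_add ca cb sa sb using k by (simp add: field_simps power2_eq_square)
  also have "(y * r) * (x * c + y) + (x + y * c) * (x * r) = r * k\<^sup>2"
    unfolding k2 by (simp add: power2_eq_square algebra_simps)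
  finally have "sin (a + b) = r" using k by simp
  then have sp: "sin (a + b) > 0" using r2 by simp
  have "a + b \<le> pi"
  proof (rule ccontr)
    assume "\<not> a + b \<le> pi"
    then have "sin (a + b) \<le> 0" using sin_le_zero[of "a + b"] ab by (cases "a + b = 2 * pi") auto
    then show False using sp by simp
  qed
  then have "arccos (cos (a + b)) = a + b" using ab by (intro arccos_cos) auto
  then have "a + b = arccos c" using cos by simp
  then show ?thesis unfolding a_def b_def s_def c_def angle_between_def[of u v] using n by simp
qed

lemma angle_between_split:
  fixes u v :: "'a::real_inner"
  assumes indep: "\<And>x y. x *\<^sub>R u + y *\<^sub>R v = 0 \<Longrightarrow> x = 0 \<and> y = 0" and xy: "x > 0" "y > 0"
  shows "angle_between u (x *\<^sub>R u + y *\<^sub>R v) + angle_between (x *\<^sub>R u + y *\<^sub>R v) v = angle_between u v"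
proof -
  have nz: "u \<noteq> 0" "v \<noteq> 0" using indep[of 1 0] indep[of 0 1] by auto
  define u' where "u' = (1 / norm u) *\<^sub>R u"
  define v' where "v' = (1 / norm v) *\<^sub>R v"
  have n: "norm u' = 1" "norm v' = 1" unfolding u'_def v'_def using nz by simp_all
  have u: "u = norm u *\<^sub>R u'" "v = norm v *\<^sub>R v'" unfolding u'_def v'_def using nz by simp_all
  have "\<bar>u' \<bullet> v'\<bar> \<noteq> 1"
  proof
    assume "\<bar>u' \<bullet> v'\<bar> = 1"
    then have "\<bar>u' \<bullet> v'\<bar> = norm u' * norm v'" using n by simp
    then have "norm u' *\<^sub>R v' = norm v' *\<^sub>R u' \<or> norm u' *\<^sub>R v' = - norm v' *\<^sub>R u'" by (simp add: norm_cauchy_schwarz_abs_eq)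
    then have "v' = u' \<or> v' = - u'" using n by simp
    then have "(1 / norm u) *\<^sub>R u + (- 1 / norm v) *\<^sub>R v = 0 \<or> (1 / norm u) *\<^sub>R u + (1 / norm v) *\<^sub>R v = 0"
      unfolding u'_def v'_def by auto
    then show False using indep[of "1 / norm u" "- 1 / norm v"] indep[of "1 / norm u" "1 / norm v"] nz by auto
  qed
  moreover have "\<bar>u' \<bullet> v'\<bar> \<le> 1" using Cauchy_Schwarz_ineq2[of u' v'] n by simp
  ultimately have c: "\<bar>u' \<bullet> v'\<bar> < 1" by linarith
  have s: "x *\<^sub>R u + y *\<^sub>R v = (x * norm u) *\<^sub>R u' + (y * norm v) *\<^sub>R v'" using u by (metis scaleR_scaleR)
  have A: "angle_between u w = angle_between u' w" "angle_between w v = angle_between w v'" for w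
    unfolding u'_def v'_def using nz by (simp_all add: angle_between_scaleR angle_between_scaleR_left)
  show ?thesis unfolding A s by (rule angle_between_split_unit[OF n c]) (use xy nz in auto)
qed

text \<open>The vector opposite to \<open>w\<close> lies in the sector of \<open>u\<close> and
  \<open>v\<close> and splits their angle into two parts, which are supplementary to the angles of
  \<open>u\<close> and \<open>v\<close> with \<open>w\<close>.\<close>

lemma angle_between_around:
  fixes u v w :: "'a::real_inner"
  assumes indep: "\<And>x y. x *\<^sub>R u + y *\<^sub>R v = 0 \<Longrightarrow> x = 0 \<and> y = 0"
    and z: "x *\<^sub>R u + y *\<^sub>R v + t *\<^sub>R w = 0" and pos: "x > 0" "y > 0" "t > 0"
  shows "angle_between u v + angle_between v w + angle_between w u = 2 * pi"
proof -
  have e: "x *\<^sub>R u + y *\<^sub>R v = t *\<^sub>R (- w)" using z by (simp add: add_eq_0_iff2)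
  have "angle_between u (- w) + angle_between (- w) v = angle_between u v"
  proof -
    have "angle_between u (x *\<^sub>R u + y *\<^sub>R v) + angle_between (x *\<^sub>R u + y *\<^sub>R v) v = angle_between u v"
      by (rule angle_between_split[OF _ pos(1,2)]) (rule indep)
    then show ?thesis unfolding e angle_between_scaleR[OF pos(3)] angle_between_scaleR_left[OF pos(3)] .
  qed
  then show ?thesis using angle_between_minus[of u w] angle_between_minus[of v w]
    by (simp add: angle_between_commute[of w u] angle_between_commute[of "- w" v])
qed

text \<open>Adding the perpendicular \<open>m\<close> leaves the inner product with \<open>r\<close>
  alone but lengthens the vector, so a positive cosine drops. The factor 1/2 fits an apex above the
  midpoint of the segment along \<open>d\<close>.\<close>

lemma angle_between_tilt:
  fixes d r m :: "'a::real_inner"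
  assumes perp: "m \<bullet> d = 0" "m \<bullet> r = 0" and ac: "0 < r \<bullet> d" and m: "m \<noteq> 0"
  shows "angle_between d r < angle_between ((1/2) *\<^sub>R d + m) r"
proof -
  have nz: "norm d > 0" "norm r > 0" using ac by auto
  define k where "k = norm ((1/2) *\<^sub>R d + m)"
  have dm: "d \<bullet> m = 0" using perp(1) by (simp add: inner_commute)
  have "k\<^sup>2 = (norm d / 2)\<^sup>2 + (norm m)\<^sup>2"
    unfolding k_def power2_norm_eq_inner power_divide
    by (simp add: inner_add_left inner_add_right perp dm)
  moreover have "(norm m)\<^sup>2 > 0" using m by simp
  ultimately have k2: "(norm d / 2)\<^sup>2 < k\<^sup>2" by simp
  have kk: "norm d / 2 < k" by (rule power2_less_imp_less[OF k2]) (simp add: k_def)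
  have k0: "k > 0" using kk nz by linarith
  have e: "((1/2) *\<^sub>R d + m) \<bullet> r = (r \<bullet> d) / 2" by (simp add: inner_add_left perp(2) inner_commute[of d r])
  have "(r \<bullet> d) / 2 / (k * norm r) < (r \<bullet> d) / 2 / ((norm d / 2) * norm r)"
    using ac kk nz k0 by (intro divide_strict_left_mono mult_strict_right_mono mult_pos_pos) auto
  also have "\<dots> = d \<bullet> r / (norm d * norm r)" by (simp add: inner_commute)
  finally show ?thesis unfolding angle_between_def e k_def[symmetric]
    using angle_between_arg[of "(1/2) *\<^sub>R d + m" r, unfolded e k_def[symmetric]] angle_between_arg(2)[of d r]
    by (intro arccos_less_arccos) auto
qed

lemma tendsto_angle_between:
  fixes f g :: "'b \<Rightarrow> 'a::real_inner"
  assumes "(f \<longlongrightarrow> u) F" "(g \<longlongrightarrow> v) F" "u \<noteq> 0" "v \<noteq> 0"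
  shows "((\<lambda>t. angle_between (f t) (g t)) \<longlongrightarrow> angle_between u v) F"
proof -
  have "((\<lambda>t. f t \<bullet> g t / (norm (f t) * norm (g t))) \<longlongrightarrow> u \<bullet> v / (norm u * norm v)) F"
    using assms by (intro tendsto_intros) auto
  then show ?thesis unfolding angle_between_def
    by (rule continuous_on_tendsto_compose[OF continuous_on_arccos'])
      (use angle_between_arg in \<open>auto intro!: always_eventually\<close>)
qed

section \<open>The tetrahedra of a hat\<close>

definition frame_point :: "'a::real_vector \<Rightarrow> 'a \<Rightarrow> 'a \<Rightarrow> 'a \<Rightarrow> real \<Rightarrow> real \<Rightarrow> real \<Rightarrow> 'a" where
  "frame_point A B C Z b c d = A + b *\<^sub>R (B - A) + c *\<^sub>R (C - A) + d *\<^sub>R (Z - A)"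

text \<open>In the affine frame with origin \<open>A\<close> and axes towards \<open>B\<close>,
  \<open>C\<close>, \<open>Z\<close> an oriented volume is the determinant of coordinate
  differences, measured in units of \<open>orient A B C Z\<close>.\<close>

lemma orient_frame_point:
  "orient (frame_point A B C Z b0 c0 d0) (frame_point A B C Z b1 c1 d1) (frame_point A B C Z b2 c2 d2) (frame_point A B C Z b3 c3 d3)
   = ((b1 - b0) * ((c2 - c0) * (d3 - d0) - (d2 - d0) * (c3 - c0))
    - (c1 - c0) * ((b2 - b0) * (d3 - d0) - (d2 - d0) * (b3 - b0))
    + (d1 - d0) * ((b2 - b0) * (c3 - c0) - (c2 - c0) * (b3 - b0))) * orient A B C Z"
proof -
  have d: "frame_point A B C Z b c d - frame_point A B C Z b0 c0 d0
      = (b - b0) *\<^sub>R (B - A) + (c - c0) *\<^sub>R (C - A) + (d - d0) *\<^sub>R (Z - A)" for b c d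
    by (simp add: frame_point_def algebra_simps)
  show ?thesis unfolding orient_def d triple_combination ..
qed

lemma frame_point_vertices:
  "frame_point A B C Z 0 0 0 = A" "frame_point A B C Z 1 0 0 = B" "frame_point A B C Z 0 1 0 = C" "frame_point A B C Z 0 0 1 = Z"
  by (simp_all add: frame_point_def)

lemma frame_point_raise:
  "(1 - t) *\<^sub>R frame_point A B C Z b c 0 + t *\<^sub>R Z = frame_point A B C Z ((1 - t) * b) ((1 - t) * c) t"
  by (simp add: frame_point_def algebra_simps)

text \<open>The second vertex is lifted \<open>4/\<tau>\<close> times as fast as the first one, so that it lies above all
  three faces of the first tetrahedron.\<close>

lemma hat_orientations:
  fixes A B C Z :: "real^3"
  assumes \<tau>: "0 < \<tau>" "\<tau> \<le> 1/4" and s: "0 < s" "s < 1" and \<eta>: "0 < \<eta>" "\<eta> \<le> 1/2" and D: "orient A B C Z \<noteq> 0"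
    and x: "x = (1 - \<eta> * \<tau> / 4) *\<^sub>R frame_point A B C Z \<tau> \<tau> 0 + (\<eta> * \<tau> / 4) *\<^sub>R Z"
    and y: "y = (1 - \<eta>) *\<^sub>R frame_point A B C Z (\<tau>/4 + 3 * s / 4) (\<tau>/4) 0 + \<eta> *\<^sub>R Z"
  shows "\<exists>k>0. orient A B C x = k * orient A B C Z" "\<exists>k>0. orient A B C y = k * orient A B C Z"
    "\<exists>k>0. orient A B x C = - k * orient A B C Z" "\<exists>k>0. orient A B x y = k * orient A B C Z"
    "\<exists>k>0. orient A B x Z = k * orient A B C Z" "\<exists>k>0. orient A x y B = k * orient A B C Z"
    "\<exists>k>0. orient A x y Z = - k * orient A B C Z" "orient A C x y \<noteq> 0" "orient B C x y \<noteq> 0"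
    "orient A C x Z \<noteq> 0" "orient A B y Z \<noteq> 0" "orient B x y Z \<noteq> 0"
proof -
  define \<epsilon> where "\<epsilon> = \<eta> * \<tau> / 4"
  define e1 where "e1 = 1 - \<epsilon>"
  define e2 where "e2 = 1 - \<eta>"
  define \<beta> where "\<beta> = \<tau>/4 + 3 * s / 4"
  have \<epsilon>: "0 < \<epsilon>" "\<epsilon> \<le> 1/32"
  proof -
    show "0 < \<epsilon>" unfolding \<epsilon>_def using \<tau> \<eta> by simp
    have "\<eta> * \<tau> \<le> (1/2) * (1/4)" using \<tau> \<eta> by (intro mult_mono) auto
    then show "\<epsilon> \<le> 1/32" unfolding \<epsilon>_def by simp
  qed
  have e: "e1 \<ge> 31/32" "e1 < 1" "e2 \<ge> 1/2" "e2 < 1" unfolding e1_def e2_def using \<epsilon> \<eta> by auto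
  have \<beta>: "0 < \<beta>" "\<beta> < 1" unfolding \<beta>_def using \<tau> s by auto
  have X: "x = frame_point A B C Z (e1 * \<tau>) (e1 * \<tau>) \<epsilon>" unfolding x frame_point_raise e1_def \<epsilon>_def ..
  have Y: "y = frame_point A B C Z (e2 * \<beta>) (e2 * (\<tau>/4)) \<eta>" unfolding y frame_point_raise e2_def \<beta>_def ..
  note o = orient_frame_point[of A B C Z]
  note v = frame_point_vertices[of A B C Z]
  have 1: "orient A B C x = \<epsilon> * orient A B C Z"
    using o[of 0 0 0 1 0 0 0 1 0 "e1 * \<tau>" "e1 * \<tau>" \<epsilon>] unfolding v X by simp
  show "\<exists>k>0. orient A B C x = k * orient A B C Z" using 1 \<epsilon> by blast
  have 2: "orient A B C y = \<eta> * orient A B C Z"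
    using o[of 0 0 0 1 0 0 0 1 0 "e2 * \<beta>" "e2 * (\<tau>/4)" \<eta>] unfolding v Y by simp
  show "\<exists>k>0. orient A B C y = k * orient A B C Z" using 2 \<eta> by blast
  have 3: "orient A B x C = - \<epsilon> * orient A B C Z"
    using o[of 0 0 0 1 0 0 "e1 * \<tau>" "e1 * \<tau>" \<epsilon> 0 1 0] unfolding v X by simp
  show "\<exists>k>0. orient A B x C = - k * orient A B C Z" using 3 \<epsilon> by blast
  have "e2 * \<tau> \<le> 1 * (1/4)" using e \<tau> by (intro mult_mono) auto
  then have k2: "e1 - e2 * \<tau> / 16 > 0" using e by simp
  \<comment> \<open>With the lift of \<open>x\<close> proportional to that of \<open>y\<close> the
    product \<eta> \<tau> factors out, and the remaining factor stays close to 1 however small the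
    lift is.\<close>
  have k2': "e1 * \<tau> * \<eta> - \<epsilon> * (e2 * (\<tau>/4)) = \<eta> * \<tau> * (e1 - e2 * \<tau> / 16)" unfolding \<epsilon>_def by (simp add: algebra_simps)
  have kp: "\<eta> * \<tau> * (e1 - e2 * \<tau> / 16) > 0" using \<eta> \<tau> k2 by simp
  have 4: "orient A B x y = (e1 * \<tau> * \<eta> - \<epsilon> * (e2 * (\<tau>/4))) * orient A B C Z"
    using o[of 0 0 0 1 0 0 "e1 * \<tau>" "e1 * \<tau>" \<epsilon> "e2 * \<beta>" "e2 * (\<tau>/4)" \<eta>] unfolding v X Y by simp
  show "\<exists>k>0. orient A B x y = k * orient A B C Z" using 4 kp unfolding k2' by blast
  have 5: "orient A B x Z = (e1 * \<tau>) * orient A B C Z"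
    using o[of 0 0 0 1 0 0 "e1 * \<tau>" "e1 * \<tau>" \<epsilon> 0 0 1] unfolding v X by simp
  moreover have "e1 * \<tau> > 0" using e \<tau> by simp
  ultimately show "\<exists>k>0. orient A B x Z = k * orient A B C Z" by blast
  have 6: "orient A x y B = (e1 * \<tau> * \<eta> - \<epsilon> * (e2 * (\<tau>/4))) * orient A B C Z"
    using o[of 0 0 0 "e1 * \<tau>" "e1 * \<tau>" \<epsilon> "e2 * \<beta>" "e2 * (\<tau>/4)" \<eta> 1 0 0] unfolding v X Y by (simp add: algebra_simps)
  show "\<exists>k>0. orient A x y B = k * orient A B C Z" using 6 kp unfolding k2' by blast
  have "orient A x y Z = (e1 * \<tau> * (e2 * (\<tau>/4)) - e1 * \<tau> * (e2 * \<beta>)) * orient A B C Z"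
    using o[of 0 0 0 "e1 * \<tau>" "e1 * \<tau>" \<epsilon> "e2 * \<beta>" "e2 * (\<tau>/4)" \<eta> 0 0 1] unfolding v X Y by simp
  also have "e1 * \<tau> * (e2 * (\<tau>/4)) - e1 * \<tau> * (e2 * \<beta>) = - (3/4 * e1 * e2 * \<tau> * s)"
    unfolding \<beta>_def by (simp add: algebra_simps)
  finally have 7: "orient A x y Z = - (3/4 * e1 * e2 * \<tau> * s) * orient A B C Z" .
  moreover have "3/4 * e1 * e2 * \<tau> * s > 0" using e \<tau> s by simp
  ultimately show "\<exists>k>0. orient A x y Z = - k * orient A B C Z" by blast
  \<comment> \<open>From here on the volumes serve only to show that neighbouring faces are not
    coplanar, so being nonzero is enough.\<close>
  have 8: "orient A C x y = - (e1 * \<tau> * \<eta> - \<epsilon> * (e2 * \<beta>)) * orient A B C Z"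
    using o[of 0 0 0 0 1 0 "e1 * \<tau>" "e1 * \<tau>" \<epsilon> "e2 * \<beta>" "e2 * (\<tau>/4)" \<eta>] unfolding v X Y by simp
  have k8: "e1 * \<tau> * \<eta> - \<epsilon> * (e2 * \<beta>) = \<eta> * \<tau> * (e1 - e2 * \<beta> / 4)" unfolding \<epsilon>_def by (simp add: algebra_simps)
  have "e2 * \<beta> \<le> 1 * 1" using e \<beta> by (intro mult_mono) auto
  then have "e1 - e2 * \<beta> / 4 > 0" using e by simp
  then show "orient A C x y \<noteq> 0" unfolding 8 k8 using D \<eta> \<tau> by simp
  have 9: "orient B C x y = (\<eta> * (1 - 2 * (e1 * \<tau>)) - \<epsilon> * (1 - e2 * \<beta> - e2 * (\<tau>/4))) * orient A B C Z"
    using o[of 1 0 0 0 1 0 "e1 * \<tau>" "e1 * \<tau>" \<epsilon> "e2 * \<beta>" "e2 * (\<tau>/4)" \<eta>] unfolding v X Y by (simp add: algebra_simps)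
  have k9: "\<eta> * (1 - 2 * (e1 * \<tau>)) - \<epsilon> * (1 - e2 * \<beta> - e2 * (\<tau>/4))
    = \<eta> * ((1 - 2 * (e1 * \<tau>)) - \<tau> / 4 * (1 - e2 * \<beta> - e2 * (\<tau>/4)))" unfolding \<epsilon>_def by (simp add: algebra_simps)
  have "e1 * \<tau> \<le> 1 * (1/4)" using e \<tau> by (intro mult_mono) auto
  moreover have "\<tau> / 4 * (1 - e2 * \<beta> - e2 * (\<tau>/4)) \<le> \<tau> / 4 * 1"
  proof (rule mult_left_mono)
    have "0 \<le> e2 * \<beta>" "0 \<le> e2 * (\<tau>/4)" using \<tau> \<beta> e by simp_all
    then show "1 - e2 * \<beta> - e2 * (\<tau>/4) \<le> 1" by linarith
  qed (use \<tau> in simp)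
  ultimately have "(1 - 2 * (e1 * \<tau>)) - \<tau> / 4 * (1 - e2 * \<beta> - e2 * (\<tau>/4)) > 0" using \<tau> by linarith
  then show "orient B C x y \<noteq> 0" unfolding 9 k9 using D \<eta> by simp
  have 10: "orient A C x Z = - (e1 * \<tau>) * orient A B C Z"
    using o[of 0 0 0 0 1 0 "e1 * \<tau>" "e1 * \<tau>" \<epsilon> 0 0 1] unfolding v X by simp
  show "orient A C x Z \<noteq> 0" unfolding 10 using D e \<tau> by simp
  have 11: "orient A B y Z = (e2 * (\<tau>/4)) * orient A B C Z"
    using o[of 0 0 0 1 0 0 "e2 * \<beta>" "e2 * (\<tau>/4)" \<eta> 0 0 1] unfolding v Y by simp
  show "orient A B y Z \<noteq> 0" unfolding 11 using D e \<tau> by simp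
  define g where "g = e2 * (\<tau>/4)"
  have 12: "orient B x y Z = (e1 * \<tau> * (1 - e2 * \<beta> - \<eta>) - e2 * (\<tau>/4) * (1 - e1 * \<tau> - \<epsilon>)) * orient A B C Z"
    using o[of 1 0 0 "e1 * \<tau>" "e1 * \<tau>" \<epsilon> "e2 * \<beta>" g \<eta> 0 0 1]
    unfolding v X Y g_def[symmetric] by (simp add: algebra_simps)
  have a: "1 - e2 * \<beta> - \<eta> = e2 * (1 - \<beta>)" "1 - e1 * \<tau> - \<epsilon> = e1 * (1 - \<tau>)"
    unfolding e1_def e2_def by (simp_all add: algebra_simps)
  have k12: "e1 * \<tau> * (1 - e2 * \<beta> - \<eta>) - e2 * (\<tau>/4) * (1 - e1 * \<tau> - \<epsilon>) = 3/4 * e1 * e2 * \<tau> * (1 - s)"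
    unfolding a unfolding \<beta>_def by (simp add: field_simps)
  show "orient B x y Z \<noteq> 0" unfolding 12 k12 using D e \<tau> s by simp
qed

lemma hull_Int_separated_subset:
  assumes "finite X" "finite Y" and "\<And>v. v \<in> X \<Longrightarrow> 0 \<le> orient a b c v / D" and "\<And>v. v \<in> Y \<Longrightarrow> orient a b c v / D \<le> 0"
    and "\<And>v. v \<in> X \<Longrightarrow> orient a b c v / D = 0 \<Longrightarrow> v \<in> X'"
  shows "convex hull X \<inter> convex hull Y \<subseteq> convex hull X'"
proof -
  have "convex hull X \<inter> convex hull Y \<subseteq> convex hull {v\<in>X. (1/D) * orient a b c v = 0}"
    using convex_hull_Int_separated[OF assms(1,2), of "1/D" a b c] assms(3,4) by simp
  also have "\<dots> \<subseteq> convex hull X'" by (rule hull_mono) (use assms(5) in auto)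
  finally show ?thesis .
qed

text \<open>All three tetrahedra lie in \<open>ABCZ\<close>, so their contact with \<open>S\<close>
  reduces to contact with the triangle \<open>ABC\<close>. The planes \<open>ABC\<close>,
  \<open>ABx\<close> and \<open>Axy\<close> then separate each tetrahedron from whatever was placed
  before it.\<close>

lemma hat_tetrahedra_Int:
  fixes A B C Z :: "real^3"
  assumes D: "orient A B C Z \<noteq> 0" and TS: "convex hull {A,B,C} \<subseteq> S"
    and QS: "convex hull {A,B,C,Z} \<inter> S = convex hull {A,B,C}"
    and xQ: "x \<in> convex hull {A,B,C,Z}" and yQ: "y \<in> convex hull {A,B,C,Z}"
    and h: "k1 > 0" "orient A B C x = k1 * orient A B C Z" "k2 > 0" "orient A B C y = k2 * orient A B C Z"
      "k3 > 0" "orient A B x C = - k3 * orient A B C Z" "k4 > 0" "orient A B x y = k4 * orient A B C Z"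
      "k5 > 0" "orient A B x Z = k5 * orient A B C Z" "k6 > 0" "orient A x y B = k6 * orient A B C Z"
      "k7 > 0" "orient A x y Z = - k7 * orient A B C Z"
  shows "convex hull {A,B,C,x} \<inter> S = convex hull {A,B,C}"
    "convex hull {A,B,x,y} \<inter> (S \<union> convex hull {A,B,C,x}) = convex hull {A,B,x}"
    "convex hull {A,x,y,Z} \<inter> (S \<union> convex hull {A,B,C,x} \<union> convex hull {A,B,x,y}) = convex hull {A,x,y}"
proof -
  define D' where "D' = orient A B C Z"
  have d: "D' \<noteq> 0" unfolding D'_def by (rule D)
  note h' = h[folded D'_def]
  have ABC0: "orient A B C A = 0" "orient A B C B = 0" "orient A B C C = 0"
    and ABx0: "orient A B x A = 0" "orient A B x B = 0" "orient A B x x = 0"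
    and Axy0: "orient A x y A = 0" "orient A x y x = 0" "orient A x y y = 0"
    unfolding orient_def by (simp_all add: dot_cross_self)
  have vQ: "A \<in> convex hull {A,B,C,Z}" "B \<in> convex hull {A,B,C,Z}" "C \<in> convex hull {A,B,C,Z}" "Z \<in> convex hull {A,B,C,Z}"
    by (simp_all add: hull_inc)
  have Q1: "convex hull {A,B,C,x} \<subseteq> convex hull {A,B,C,Z}" by (rule hull_minimal) (use vQ xQ in auto)
  have Q2: "convex hull {A,B,x,y} \<subseteq> convex hull {A,B,C,Z}" by (rule hull_minimal) (use vQ xQ yQ in auto)
  have Q3: "convex hull {A,x,y,Z} \<subseteq> convex hull {A,B,C,Z}" by (rule hull_minimal) (use vQ xQ yQ in auto)
  have sub: "convex hull {A,B,C} \<subseteq> convex hull {A,B,C,x}" "convex hull {A,B,x} \<subseteq> convex hull {A,B,C,x}"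
    "convex hull {A,B,x} \<subseteq> convex hull {A,B,x,y}" "convex hull {A,x,y} \<subseteq> convex hull {A,B,x,y}"
    "convex hull {A,x,y} \<subseteq> convex hull {A,x,y,Z}" "convex hull {A,B} \<subseteq> convex hull {A,B,x}"
    "convex hull {A,x} \<subseteq> convex hull {A,x,y}" "convex hull {A} \<subseteq> convex hull {A,x,y}"
    by (rule hull_mono, blast)+
  show "convex hull {A,B,C,x} \<inter> S = convex hull {A,B,C}" using Q1 QS sub(1) TS by blast
  have 1: "convex hull {A,B,x,y} \<inter> convex hull {A,B,C} \<subseteq> convex hull {A,B}"
    by (rule hull_Int_separated_subset[where D = D' and a = A and b = B and c = C]) (use ABC0 h' d in auto)
  have 2: "convex hull {A,B,x,y} \<inter> convex hull {A,B,C,x} \<subseteq> convex hull {A,B,x}"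
    by (rule hull_Int_separated_subset[where D = D' and a = A and b = B and c = x]) (use ABx0 h' d in auto)
  show "convex hull {A,B,x,y} \<inter> (S \<union> convex hull {A,B,C,x}) = convex hull {A,B,x}"
    using 1 2 Q2 QS sub by blast
  have 3: "convex hull {A,x,y,Z} \<inter> convex hull {A,B,C} \<subseteq> convex hull {A}"
    by (rule hull_Int_separated_subset[where D = D' and a = A and b = B and c = C]) (use ABC0 h' d D'_def in auto)
  have 4: "convex hull {A,x,y,Z} \<inter> convex hull {A,B,C,x} \<subseteq> convex hull {A,x}"
    by (rule hull_Int_separated_subset[where D = D' and a = A and b = B and c = x]) (use ABx0 h' d in auto)
  \<comment> \<open>Relative to the plane \<open>Axy\<close> the sign of \<open>Z\<close> is
    opposite to that of \<open>D'\<close>, hence the reversed divisor.\<close>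
  have 5: "convex hull {A,x,y,Z} \<inter> convex hull {A,B,x,y} \<subseteq> convex hull {A,x,y}"
    by (rule hull_Int_separated_subset[where D = "- D'" and a = A and b = x and c = y]) (use Axy0 h' d in auto)
  show "convex hull {A,x,y,Z} \<inter> (S \<union> convex hull {A,B,C,x} \<union> convex hull {A,B,x,y}) = convex hull {A,x,y}"
    using 3 4 5 Q3 QS sub by blast
qed

section \<open>The hat with two vertices flattened into the base plane\<close>

lemma noncollinear_independent:
  assumes "\<not> collinear {A, B, C :: real^3}" and e: "x *\<^sub>R (B - A) + y *\<^sub>R (C - A) = 0"
  shows "x = 0 \<and> y = 0"
proof -
  have n: "cross3 (B - A) (C - A) \<noteq> 0" using assms(1) cross_0_imp_collinear by blast
  have "x *\<^sub>R cross3 (B - A) (C - A) = cross3 (x *\<^sub>R (B - A) + y *\<^sub>R (C - A)) (C - A)"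
    by (simp add: cross_add_left cross_mult_left)
  then have "x *\<^sub>R cross3 (B - A) (C - A) = 0" unfolding e by simp
  moreover have "y *\<^sub>R cross3 (B - A) (C - A) = cross3 (B - A) (x *\<^sub>R (B - A) + y *\<^sub>R (C - A))"
    by (simp add: cross_add_right cross_mult_right)
  then have "y *\<^sub>R cross3 (B - A) (C - A) = 0" unfolding e by simp
  ultimately show ?thesis using n by simp
qed

lemma frame_barycentric:
  fixes A B C :: "'a::real_vector"
  shows "A + b *\<^sub>R (B - A) + c *\<^sub>R (C - A) = (1 - b - c) *\<^sub>R A + b *\<^sub>R B + c *\<^sub>R C"
  by (simp add: algebra_simps)

lemma barycentric_centre:
  fixes A B C Y :: "'a::real_vector"
  assumes "Y = u *\<^sub>R A + v *\<^sub>R B + w *\<^sub>R C" "u + v + w = 1"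
  shows "u *\<^sub>R (A - Y) + v *\<^sub>R (B - Y) + w *\<^sub>R (C - Y) = 0"
proof -
  have "u *\<^sub>R (A - Y) + v *\<^sub>R (B - Y) + w *\<^sub>R (C - Y) = (u *\<^sub>R A + v *\<^sub>R B + w *\<^sub>R C) - (u + v + w) *\<^sub>R Y"
    by (simp add: algebra_simps)
  then show ?thesis using assms by simp
qed

text \<open>The vectors \<open>r\<close> and \<open>q\<close> are equal legs, and the foot of the
  altitude on the base is its midpoint. The base angle at \<open>r\<close> is acute, and so is the
  angle towards \<open>r\<close> at the point three quarters along the base, because this point is
  beyond the foot.\<close>

lemma isosceles_base_acute:
  fixes r q :: "'a::real_inner"
  assumes "norm r = norm q" "r \<noteq> q"
  shows "0 < r \<bullet> (r - q)" "0 < (r + 3 *\<^sub>R q) \<bullet> (q - r)"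
proof -
  have e: "r \<bullet> r = q \<bullet> q" using assms(1) by (simp add: norm_eq)
  have "0 < (r - q) \<bullet> (r - q)" using assms(2) by simp
  then have "2 * (r \<bullet> q) < 2 * (r \<bullet> r)" using e by (simp add: inner_diff_left inner_diff_right inner_commute[of q r])
  then have k: "r \<bullet> q < r \<bullet> r" by simp
  then show "0 < r \<bullet> (r - q)" by (simp add: inner_diff_right)
  have "(r + 3 *\<^sub>R q) \<bullet> (q - r) = 2 * (r \<bullet> r) - 2 * (r \<bullet> q)"
    by (simp add: inner_add_left inner_diff_right inner_commute[of q r] e)
  then show "0 < (r + 3 *\<^sub>R q) \<bullet> (q - r)" using k by simp
qed

text \<open>The flat angles at \<open>y1\<close> towards \<open>A\<close>, \<open>C\<close>,
  \<open>B\<close> sum to 2 pi, as do those at \<open>y2\<close> towards \<open>A\<close>,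
  \<open>B\<close>, \<open>y1\<close>. At \<open>y1\<close> the arm to \<open>y2\<close> splits the
  angle between \<open>B\<close> and \<open>A\<close>. Replacing the arm between \<open>y1\<close>
  and \<open>y2\<close> by the arm to \<open>Z\<close> in the angle with \<open>A\<close> widens it
  strictly, since that angle is acute at both ends.\<close>

lemma hat_limit_angles:
  fixes A B C :: "real^3"
  assumes nc: "\<not> collinear {A,B,C}" and \<tau>: "0 < \<tau>" "\<tau> \<le> 1/4" and s: "0 < s" "s < 1"
    and iso: "s * norm (B - A) = \<tau> * norm ((B - A) + (C - A))"
    and y1: "y1 = A + \<tau> *\<^sub>R (B - A) + \<tau> *\<^sub>R (C - A)"
    and y2: "y2 = A + (\<tau>/4 + 3 * s / 4) *\<^sub>R (B - A) + (\<tau>/4) *\<^sub>R (C - A)"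
    and N: "n \<noteq> 0" "n \<bullet> (B - A) = 0" "n \<bullet> (C - A) = 0" and Z: "Z = (1/2) *\<^sub>R (y1 + y2) + n"
  shows "2 * pi < angle_between (Z - y1) (A - y1) + angle_between (A - y1) (C - y1)
      + angle_between (C - y1) (B - y1) + angle_between (B - y1) (y2 - y1)"
    and "2 * pi < angle_between (Z - y2) (A - y2) + angle_between (A - y2) (B - y2) + angle_between (B - y2) (y1 - y2)"
    and "A \<noteq> y1" "B \<noteq> y1" "C \<noteq> y1" "Z \<noteq> y1" "A \<noteq> y2" "B \<noteq> y2" "Z \<noteq> y2" "y1 \<noteq> y2"
proof -
  define U V where "U = B - A" and "V = C - A"
  have indep: "x = 0 \<and> y = 0" if "x *\<^sub>R U + y *\<^sub>R V = 0" for x y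
    using noncollinear_independent[OF nc] that unfolding U_def V_def by blast
  define \<beta> where "\<beta> = \<tau>/4 + 3 * s / 4"
  have B: "B = A + U" "C = A + V" unfolding U_def V_def by simp_all
  have e1: "y1 = A + \<tau> *\<^sub>R U + \<tau> *\<^sub>R V" and e2: "y2 = A + \<beta> *\<^sub>R U + (\<tau>/4) *\<^sub>R V"
    unfolding y1 y2 U_def V_def \<beta>_def by simp_all
  have nU: "n \<bullet> U = 0" "n \<bullet> V = 0" using N unfolding U_def V_def by simp_all
  define r where "r = \<tau> *\<^sub>R U + \<tau> *\<^sub>R V"
  define q where "q = s *\<^sub>R U"
  have nr: "norm r = norm q"
  proof -
    have "r = \<tau> *\<^sub>R (U + V)" unfolding r_def by (simp add: scaleR_add_right)
    then show ?thesis unfolding q_def using iso \<tau> s unfolding U_def V_def by simp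
  qed
  have rq: "r \<noteq> q"
  proof
    assume "r = q"
    then have "(\<tau> - s) *\<^sub>R U + \<tau> *\<^sub>R V = 0" unfolding r_def q_def by (simp add: algebra_simps)
    then show False using indep \<tau> by blast
  qed
  have d1: "y1 - A = r" unfolding e1 r_def by simp
  \<comment> \<open>Thus \<open>y2\<close> is three quarters of the way from \<open>y1\<close> to
    \<open>A + q\<close>, the point of the side \<open>AB\<close> as far from \<open>A\<close> as
    \<open>y1\<close> is.\<close>
  have d2: "y2 - A = (1/4) *\<^sub>R (r + 3 *\<^sub>R q)" unfolding e2 r_def q_def \<beta>_def by (simp add: algebra_simps)
  have d21: "y2 - y1 = (3/4) *\<^sub>R (q - r)"
  proof -
    have "y2 - y1 = (y2 - A) - (y1 - A)" by simp
    also have "\<dots> = (1/4) *\<^sub>R (r + 3 *\<^sub>R q) - r" unfolding d1 d2 ..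
    also have "\<dots> = (3/4) *\<^sub>R (q - r)"
    proof -
      have k: "(1/4) *\<^sub>R r - r = (- 3/4) *\<^sub>R r" using scaleR_left_diff_distrib[of "1/4" 1 r] by simp
      have "(1/4) *\<^sub>R (r + 3 *\<^sub>R q) - r = ((1/4) *\<^sub>R r - r) + (3/4) *\<^sub>R q" by (simp add: scaleR_add_right)
      then show ?thesis unfolding k by (simp add: scaleR_diff_right)
    qed
    finally show ?thesis .
  qed
  have ac1: "0 < (A - y1) \<bullet> (y2 - y1)"
  proof -
    have "(A - y1) \<bullet> (y2 - y1) = (- r) \<bullet> ((3/4) *\<^sub>R (q - r))" using d1 d21 by (metis minus_diff_eq)
    also have "\<dots> = (3/4) * (r \<bullet> (r - q))" by (simp add: inner_diff_right)
    finally show ?thesis using isosceles_base_acute(1)[OF nr rq] by simp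
  qed
  have ac2: "0 < (A - y2) \<bullet> (y1 - y2)"
  proof -
    have "(A - y2) \<bullet> (y1 - y2) = (- (y2 - A)) \<bullet> (- (y2 - y1))" by simp
    also have "\<dots> = (3/16) * ((r + 3 *\<^sub>R q) \<bullet> (q - r))" unfolding d2 d21 by simp
    finally show ?thesis using isosceles_base_acute(2)[OF nr rq] by simp
  qed
  have nd: "n \<bullet> (y2 - y1) = 0" "n \<bullet> (A - y1) = 0" "n \<bullet> (y1 - y2) = 0" "n \<bullet> (A - y2) = 0"
    unfolding e1 e2 by (simp_all add: inner_diff_right inner_add_right nU)
  have Z1: "Z - y1 = (1/2) *\<^sub>R (y2 - y1) + n" "Z - y2 = (1/2) *\<^sub>R (y1 - y2) + n"
    unfolding Z by (simp_all add: scaleR_add_right scaleR_diff_right)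
  have tilt1: "angle_between (y2 - y1) (A - y1) < angle_between (Z - y1) (A - y1)"
    unfolding Z1 by (rule angle_between_tilt[OF nd(1,2) ac1 N(1)])
  have tilt2: "angle_between (y1 - y2) (A - y2) < angle_between (Z - y2) (A - y2)"
    unfolding Z1 by (rule angle_between_tilt[OF nd(3,4) ac2 N(1)])
  have iAC: "x = 0 \<and> y = 0" if "x *\<^sub>R (A - y1) + y *\<^sub>R (C - y1) = 0" for x y
  proof -
    have "(- \<tau> * (x + y)) *\<^sub>R U + (y - \<tau> * (x + y)) *\<^sub>R V = x *\<^sub>R (A - y1) + y *\<^sub>R (C - y1)"
      unfolding e1 B by (simp add: algebra_simps)
    then have "- \<tau> * (x + y) = 0" "y - \<tau> * (x + y) = 0" using indep that by metis+
    then show ?thesis using \<tau> by auto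
  qed
  have iBA: "x = 0 \<and> y = 0" if "x *\<^sub>R (B - y1) + y *\<^sub>R (A - y1) = 0" for x y
  proof -
    have "(x - \<tau> * (x + y)) *\<^sub>R U + (- \<tau> * (x + y)) *\<^sub>R V = x *\<^sub>R (B - y1) + y *\<^sub>R (A - y1)"
      unfolding e1 B by (simp add: algebra_simps)
    then have "- \<tau> * (x + y) = 0" "x - \<tau> * (x + y) = 0" using indep that by metis+
    then show ?thesis using \<tau> by auto
  qed
  have iAB: "x = 0 \<and> y = 0" if "x *\<^sub>R (A - y2) + y *\<^sub>R (B - y2) = 0" for x y
  proof -
    have "(y - \<beta> * (x + y)) *\<^sub>R U + (- (\<tau>/4) * (x + y)) *\<^sub>R V = x *\<^sub>R (A - y2) + y *\<^sub>R (B - y2)"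
      unfolding e2 B by (simp add: algebra_simps add_divide_distrib)
    then have "- (\<tau>/4) * (x + y) = 0" "y - \<beta> * (x + y) = 0" using indep that by metis+
    then show ?thesis using \<tau> by auto
  qed
  have S1: "angle_between (A - y1) (C - y1) + angle_between (C - y1) (B - y1) + angle_between (B - y1) (A - y1) = 2 * pi"
  proof (rule angle_between_around[of _ _ "1 - \<tau> - \<tau>" \<tau> \<tau>])
    have "y1 = (1 - \<tau> - \<tau>) *\<^sub>R A + \<tau> *\<^sub>R C + \<tau> *\<^sub>R B" unfolding y1 frame_barycentric by simp
    then show "(1 - \<tau> - \<tau>) *\<^sub>R (A - y1) + \<tau> *\<^sub>R (C - y1) + \<tau> *\<^sub>R (B - y1) = 0"
      by (rule barycentric_centre) simp
  qed (use \<tau> iAC in auto)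
  have sp: "angle_between (B - y1) (y2 - y1) + angle_between (y2 - y1) (A - y1) = angle_between (B - y1) (A - y1)"
  proof -
    have By: "B - y1 = U - r" "A - y1 = - r" unfolding B e1 r_def by (simp_all add: algebra_simps)
    \<comment> \<open>The direction from \<open>y1\<close> to \<open>y2\<close> points to
      \<open>A + q\<close>, which divides \<open>AB\<close> with weights \<open>s\<close> at
      \<open>B\<close> and 1 - s at \<open>A\<close>; the factor 3/4 is the fraction
      travelled.\<close>
    have "(3/4 * s) *\<^sub>R (B - y1) + (3/4 * (1 - s)) *\<^sub>R (A - y1) = (3/4) *\<^sub>R (s *\<^sub>R (U - r) + (1 - s) *\<^sub>R (- r))"
      unfolding By by (simp only: scaleR_add_right scaleR_scaleR)
    also have "s *\<^sub>R (U - r) + (1 - s) *\<^sub>R (- r) = q - r" unfolding q_def by (simp add: algebra_simps)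
    finally have "y2 - y1 = (3/4 * s) *\<^sub>R (B - y1) + (3/4 * (1 - s)) *\<^sub>R (A - y1)" unfolding d21 by simp
    then show ?thesis using angle_between_split[of "B - y1" "A - y1" "3/4 * s" "3/4 * (1 - s)"] iBA s by simp
  qed
  have S2: "angle_between (A - y2) (B - y2) + angle_between (B - y2) (y1 - y2) + angle_between (y1 - y2) (A - y2) = 2 * pi"
  \<comment> \<open>These are the barycentric coordinates of \<open>y2\<close> in the triangle
    \<open>A\<close>, \<open>B\<close>, \<open>y1\<close>.\<close>
  proof (rule angle_between_around[of _ _ "3/4 * (1 - s)" "3/4 * s" "1/4"])
    have "(3/4 * (1 - s)) *\<^sub>R A + (3/4 * s) *\<^sub>R (A + U) + (1/4) *\<^sub>R (A + r)
      = (3/4 * (1 - s) + 3/4 * s + 1/4) *\<^sub>R A + ((3/4 * s) *\<^sub>R U + (1/4) *\<^sub>R r)"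
      by (simp only: scaleR_add_right scaleR_add_left add_ac)
    also have "3/4 * (1 - s) + 3/4 * s + 1/4 = 1" by (simp add: field_simps)
    also have "1 *\<^sub>R A + ((3/4 * s) *\<^sub>R U + (1/4) *\<^sub>R r) = y2"
      using d2 unfolding q_def by (simp add: scaleR_add_right algebra_simps)
    finally have "y2 = (3/4 * (1 - s)) *\<^sub>R A + (3/4 * s) *\<^sub>R B + (1/4) *\<^sub>R y1"
      unfolding B(1) using d1 by (metis add.commute diff_add_cancel)
    then show "(3/4 * (1 - s)) *\<^sub>R (A - y2) + (3/4 * s) *\<^sub>R (B - y2) + (1/4) *\<^sub>R (y1 - y2) = 0"
      by (rule barycentric_centre) (simp add: field_simps)
  qed (use s iAB in auto)
  show "2 * pi < angle_between (Z - y1) (A - y1) + angle_between (A - y1) (C - y1)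
      + angle_between (C - y1) (B - y1) + angle_between (B - y1) (y2 - y1)" using S1 sp tilt1 by linarith
  show "2 * pi < angle_between (Z - y2) (A - y2) + angle_between (A - y2) (B - y2) + angle_between (B - y2) (y1 - y2)"
    using S2 tilt2 by linarith
  show "A \<noteq> y1" "A \<noteq> y2" "y1 \<noteq> y2" using ac1 ac2 by auto
  show "B \<noteq> y1" using iBA[of 1 0] by auto
  show "C \<noteq> y1" using iAC[of 0 1] by auto
  show "B \<noteq> y2" using iAB[of 0 1] by auto
  have "n \<bullet> (Z - y1) = n \<bullet> n" "n \<bullet> (Z - y2) = n \<bullet> n" unfolding Z1 by (simp_all add: inner_add_right nd)
  then show "Z \<noteq> y1" "Z \<noteq> y2" using N(1) by auto
qed

lemma affine_third_vertex:
  assumes y: "y = u *\<^sub>R a + v *\<^sub>R b + w *\<^sub>R c" "w \<noteq> 0" "u + v + w = 1" and H: "affine H" "a \<in> H" "b \<in> H" "y \<in> H"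
  shows "c \<in> H"
proof -
  have "c = (1/w) *\<^sub>R (y - u *\<^sub>R a - v *\<^sub>R b)" unfolding y(1) using y(2) by simp
  then have "c = (1/w) *\<^sub>R y + (- u/w) *\<^sub>R a + (- v/w) *\<^sub>R b" by (simp add: scaleR_diff_right)
  moreover have "1/w + (- u/w) + (- v/w) = 1"
  proof -
    have "1/w + (- u/w) + (- v/w) = (1 - u - v) / w" by (simp add: diff_divide_distrib)
    also have "1 - u - v = w" using y(3) by simp
    finally show ?thesis using y(2) by simp
  qed
  then have "(1/w) *\<^sub>R y + (- u/w) *\<^sub>R a + (- v/w) *\<^sub>R b \<in> H"
    by (rule mem_affine_3[OF H(1) H(4) H(2) H(3)])
  ultimately show ?thesis by metis
qed

text \<open>Together with the two shared vertices, \<open>y\<close> spans the plane of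
  \<open>abc\<close>. If the plane of the neighbour contained \<open>y\<close>, it would contain the
  third vertex too, and the two faces would be coplanar.\<close>

lemma interior_point_off_adjacent_plane:
  assumes ft: "faces_are_triangles p F" and c3: "\<And>g. g \<in> F \<Longrightarrow> card g = 3"
    and f: "{a,b,c} \<in> F" and g: "g \<in> F" "g \<noteq> {a,b,c}" "card (g \<inter> {a,b,c}) = 2"
    and y: "y = u *\<^sub>R p a + v *\<^sub>R p b + w *\<^sub>R p c" "u \<noteq> 0" "v \<noteq> 0" "w \<noteq> 0" "u + v + w = 1"
  shows "y \<notin> affine hull (p ` g)"
proof
  define H where "H = affine hull (p ` g)"
  assume "y \<in> affine hull (p ` g)"
  then have yH: "y \<in> H" unfolding H_def .
  have aH: "affine H" unfolding H_def by simp
  have inH: "p i \<in> H" if "i \<in> g" for i unfolding H_def using that by (simp add: hull_inc)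
  have "p a \<in> H \<and> p b \<in> H \<and> p c \<in> H"
  proof -
    from doubleton_subset_triple[OF Int_lower2 g(3)]
    consider "a \<in> g" "b \<in> g" | "a \<in> g" "c \<in> g" | "b \<in> g" "c \<in> g" by blast
    then show ?thesis
    proof cases
      case 1
      then show ?thesis using affine_third_vertex[OF y(1,4,5) aH] yH inH by blast
    next
      case 2
      have "y = u *\<^sub>R p a + w *\<^sub>R p c + v *\<^sub>R p b" "u + w + v = 1" using y by simp_all
      from affine_third_vertex[OF this(1) y(3) this(2) aH] show ?thesis using 2 yH inH by blast
    next
      case 3
      have "y = v *\<^sub>R p b + w *\<^sub>R p c + u *\<^sub>R p a" "v + w + u = 1" using y by simp_all
      from affine_third_vertex[OF this(1) y(2) this(2) aH] show ?thesis using 3 yH inH by blast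
    qed
  qed
  then have "p ` ({a,b,c} \<union> g) \<subseteq> H" using inH by auto
  moreover obtain i j k where "g = {i,j,k}" using c3[OF g(1)] by (auto simp: card_3_iff)
  then have "H = affine hull {p i, p j, p k}" unfolding H_def by simp
  ultimately have "coplanar (p ` ({a,b,c} \<union> g))" unfolding coplanar_def by blast
  moreover have "card ({a,b,c} \<inter> g) = 2" using g(3) by (simp add: Int_commute)
  ultimately show False using ft f g(1,2) unfolding faces_are_triangles_def by metis
qed

section \<open>Hats on all faces\<close>

lemma exists_small_parameter:
  assumes "\<forall>\<^sub>F e in at_right (0::real). P e" obtains e where "0 < e" "e \<le> 1/2" "P e"
proof -
  have "\<forall>\<^sub>F e in at_right (0::real). e < 1/2" by (rule order_tendstoD(2)[OF tendsto_ident_at]) simp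
  then have "\<forall>\<^sub>F e in at_right (0::real). P e \<and> e < 1/2 \<and> 0 < e"
    using assms eventually_at_right_less[of 0] by eventually_elim simp
  then obtain e where "P e \<and> e < 1/2 \<and> 0 < e"
    using eventually_happens[of _ "at_right (0::real)"] trivial_limit_at_right_real by blast
  then show ?thesis using that[of e] by simp
qed

lemma stack_thrice_faces:
  assumes "k \<notin> A" "k \<noteq> u" "k \<noteq> v" "k' \<notin> A" "k' \<noteq> u" "k' \<noteq> v" "k' \<noteq> w" "k' \<noteq> r"
  shows "((A \<union> {k,u,v}) - {k} \<union> {w,k',r}) - {k'} \<union> {i,j,l} = A \<union> {v,u,r,w,l,i,j}"
  using assms by auto

text \<open>The tip \<open>Z\<close>, stacked last, is chosen first: \<open>free_apex\<close> places
  it above the midpoint \<open>m\<close> of the flat positions, and the tetrahedron on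
  \<open>abc\<close> with apex \<open>Z\<close> is the space reserved for the whole hat. With
  \<open>Z\<close> fixed, the angle inequalities and the avoidance of adjacent planes are open
  conditions that hold at \<open>y1\<close> and \<open>y2\<close>, hence also for a small lift
  \<open>t\<close>.\<close>

lemma attach_hat:
  assumes G: "good p n F S" and f: "{a,b,c} \<in> F"
  shows "\<exists>p' S'. (\<forall>i<n. p' i = p i) \<and>
    good p' (n + 3) ((F - {{a,b,c}}) \<union> hat_faces a b c n (n+1) (n+2)) S' \<and> hat_shape p' a b c n (n+1) (n+2)"
proof -
  define A B C where "A = p a" and "B = p b" and "C = p c"
  have T: "is_tri_polyhedron p n F S" and ft: "faces_are_triangles p F" using G unfolding good_def by auto
  have fin: "finite F" and c3: "\<And>g. g \<in> F \<Longrightarrow> card g = 3" and nc0: "\<And>g. g \<in> F \<Longrightarrow> \<not> collinear (p ` g)"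
    and fr: "frontier S = (\<Union>g\<in>F. convex hull (p ` g))" and cS: "compact S"
    using T unfolding is_tri_polyhedron_def by simp_all
  have Fn: "g \<subseteq> {..<n}" if "g \<in> F" for g using is_tri_polyhedron_vertices[OF T] that by blast
  have abc: "a < n" "b < n" "c < n" using Fn[OF f] by auto
  have im: "p ` {a,b,c} = {A,B,C}" unfolding A_def B_def C_def by simp
  have nc: "\<not> collinear {A,B,C}" using nc0[OF f] unfolding im .
  have TS: "convex hull {A,B,C} \<subseteq> S"
  proof -
    have "convex hull {A,B,C} \<subseteq> frontier S" unfolding im[symmetric] fr by (rule UN_upper[OF f])
    then show ?thesis using frontier_subset_closed[OF compact_imp_closed[OF cS]] by (rule subset_trans)
  qed
  have indep: "x = 0 \<and> y = 0" if "x *\<^sub>R (B - A) + y *\<^sub>R (C - A) = 0" for x y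
    by (rule noncollinear_independent[OF nc that])
  have nz: "norm (B - A) > 0" "norm ((B - A) + (C - A)) > 0"
    using indep[of 1 0] indep[of 1 1] by (auto simp del: diff_add_eq add_diff_eq)
  define \<kappa> where "\<kappa> = norm ((B - A) + (C - A)) / norm (B - A)"
  have \<kappa>: "\<kappa> > 0" unfolding \<kappa>_def using nz by simp
  \<comment> \<open>The second bound gives s \<le> 1/2, so the point at distance \<tau> |(B - A) +
    (C - A)| from \<open>A\<close> stays inside the side \<open>AB\<close>; the first keeps
    \<open>y1\<close> inside the triangle.\<close>
  define \<tau> where "\<tau> = min (1/4) (1 / (2 * \<kappa>))"
  have \<tau>: "0 < \<tau>" "\<tau> \<le> 1/4" "\<tau> \<le> 1 / (2 * \<kappa>)" unfolding \<tau>_def using \<kappa> by auto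
  define s where "s = \<tau> * \<kappa>"
  have s: "0 < s" "s < 1"
  proof -
    show "0 < s" unfolding s_def using \<tau> \<kappa> by simp
    have "\<tau> * \<kappa> \<le> 1 / (2 * \<kappa>) * \<kappa>" using \<tau> \<kappa> by (intro mult_right_mono) auto
    then show "s < 1" unfolding s_def using \<kappa> by simp
  qed
  have iso: "s * norm (B - A) = \<tau> * norm ((B - A) + (C - A))" unfolding s_def \<kappa>_def using nz by simp
  define \<beta> where "\<beta> = \<tau>/4 + 3 * s / 4"
  define y1 where "y1 = A + \<tau> *\<^sub>R (B - A) + \<tau> *\<^sub>R (C - A)"
  define y2 where "y2 = A + \<beta> *\<^sub>R (B - A) + (\<tau>/4) *\<^sub>R (C - A)"
  define m where "m = (1/2) *\<^sub>R (y1 + y2)"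
  have y1c: "y1 = (1 - \<tau> - \<tau>) *\<^sub>R A + \<tau> *\<^sub>R B + \<tau> *\<^sub>R C" unfolding y1_def by (rule frame_barycentric)
  have y2c: "y2 = (1 - \<beta> - \<tau>/4) *\<^sub>R A + \<beta> *\<^sub>R B + (\<tau>/4) *\<^sub>R C" unfolding y2_def by (rule frame_barycentric)
  have \<beta>: "0 < \<beta>" "\<beta> + \<tau>/4 < 1" unfolding \<beta>_def using \<tau> s by auto
  define v w where "v = (\<tau> + \<beta>) / 2" and "w = (\<tau> + \<tau>/4) / 2"
  have mc: "m = (1 - v - w) *\<^sub>R A + v *\<^sub>R B + w *\<^sub>R C"
  proof -
    have "y1 + y2 = 2 *\<^sub>R A + (\<tau> + \<beta>) *\<^sub>R (B - A) + (\<tau> + \<tau>/4) *\<^sub>R (C - A)"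
      unfolding y1_def y2_def scaleR_2 by (simp only: scaleR_add_left add_ac)
    then have "m = (1/2) *\<^sub>R (2 *\<^sub>R A + (\<tau> + \<beta>) *\<^sub>R (B - A) + (\<tau> + \<tau>/4) *\<^sub>R (C - A))" unfolding m_def by (rule arg_cong)
    also have "\<dots> = A + v *\<^sub>R (B - A) + w *\<^sub>R (C - A)" unfolding v_def w_def by (simp only: scaleR_add_right scaleR_scaleR) simp
    also have "\<dots> = (1 - v - w) *\<^sub>R A + v *\<^sub>R B + w *\<^sub>R C" by (rule frame_barycentric)
    finally show ?thesis .
  qed
  have "\<beta> < 1 - \<tau>/4" using \<beta> by simp
  then have vw: "v + w < 1" unfolding v_def w_def add_divide_distrib using \<tau>(1,2) by linarith
  have "0 < v" "0 < w" using \<tau>(1) \<beta>(1) unfolding v_def w_def by simp_all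
  with vw have pos: "0 < 1 - v - w" "0 < v" "0 < w" "(1 - v - w) + v + w = 1"
    by simp_all
  obtain N where N: "N \<noteq> 0" "N \<bullet> (B - A) = 0" "N \<bullet> (C - A) = 0"
    and evN: "\<forall>\<^sub>F h in at_right (0::real). orient A B C (m + h *\<^sub>R N) \<noteq> 0 \<and>
       convex hull {A,B,C, m + h *\<^sub>R N} \<inter> S = convex hull {A,B,C}"
    using free_apex[OF G f mc[unfolded A_def B_def C_def] pos] unfolding A_def B_def C_def by blast
  obtain h where h: "0 < h" and D: "orient A B C (m + h *\<^sub>R N) \<noteq> 0"
    and QS: "convex hull {A,B,C, m + h *\<^sub>R N} \<inter> S = convex hull {A,B,C}"
    using exists_small_parameter[OF evN] by blast
  define Z where "Z = m + h *\<^sub>R N"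
  note D = D[folded Z_def] and QS = QS[folded Z_def]
  have N': "h *\<^sub>R N \<noteq> 0" "(h *\<^sub>R N) \<bullet> (B - A) = 0" "(h *\<^sub>R N) \<bullet> (C - A) = 0" using N h by simp_all
  note lim = hat_limit_angles[OF nc \<tau>(1,2) s iso y1_def y2_def[unfolded \<beta>_def] N' Z_def[unfolded m_def]]
  define x1 where "x1 = (\<lambda>t. (1 - t * \<tau> / 4) *\<^sub>R y1 + (t * \<tau> / 4) *\<^sub>R Z)"
  define x2 where "x2 = (\<lambda>t. (1 - t) *\<^sub>R y2 + t *\<^sub>R Z)"
  have l1: "(x1 \<longlongrightarrow> y1) (at_right 0)"
  proof -
    have "(x1 \<longlongrightarrow> (1 - 0 * \<tau> / 4) *\<^sub>R y1 + (0 * \<tau> / 4) *\<^sub>R Z) (at_right 0)" unfolding x1_def by (intro tendsto_intros) auto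
    then show ?thesis by simp
  qed
  have l2: "(x2 \<longlongrightarrow> y2) (at_right 0)"
  proof -
    have "(x2 \<longlongrightarrow> (1 - 0) *\<^sub>R y2 + 0 *\<^sub>R Z) (at_right 0)" unfolding x2_def by (intro tendsto_intros)
    then show ?thesis by simp
  qed
  have ev1: "\<forall>\<^sub>F t in at_right 0. 2 * pi < angle_between (Z - x1 t) (A - x1 t) + angle_between (A - x1 t) (C - x1 t)
      + angle_between (C - x1 t) (B - x1 t) + angle_between (B - x1 t) (x2 t - x1 t)"
    by (rule order_tendstoD(1)[OF _ lim(1)])
      (intro tendsto_add tendsto_angle_between tendsto_diff tendsto_const l1 l2; use lim(3-10) in simp)
  have ev2: "\<forall>\<^sub>F t in at_right 0. 2 * pi < angle_between (Z - x2 t) (A - x2 t) + angle_between (A - x2 t) (B - x2 t)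
      + angle_between (B - x2 t) (x1 t - x2 t)"
    by (rule order_tendstoD(1)[OF _ lim(2)])
      (intro tendsto_add tendsto_angle_between tendsto_diff tendsto_const l1 l2; use lim(3-10) in simp)
  have off: "\<forall>\<^sub>F t in at_right 0. x1 t \<notin> affine hull (p ` g) \<and> x2 t \<notin> affine hull (p ` g)"
    if g: "g \<in> F" "g \<noteq> {a,b,c}" "card (g \<inter> {a,b,c}) = 2" for g
  proof -
    have o: "open (- (affine hull (p ` g)))" by (rule open_Compl[OF closed_affine_hull])
    have "y1 \<in> - (affine hull (p ` g))"
      using interior_point_off_adjacent_plane[OF ft c3 f g y1c[unfolded A_def B_def C_def]] \<tau> by simp
    from topological_tendstoD[OF l1 o this] have 1: "\<forall>\<^sub>F t in at_right 0. x1 t \<notin> affine hull (p ` g)" by simp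
    have "y2 \<in> - (affine hull (p ` g))"
      using interior_point_off_adjacent_plane[OF ft c3 f g y2c[unfolded A_def B_def C_def]] \<tau> \<beta> by simp
    from topological_tendstoD[OF l2 o this] have 2: "\<forall>\<^sub>F t in at_right 0. x2 t \<notin> affine hull (p ` g)" by simp
    from 1 2 show ?thesis by eventually_elim simp
  qed
  have ev3: "\<forall>\<^sub>F t in at_right 0. \<forall>g\<in>{g\<in>F. g \<noteq> {a,b,c} \<and> card (g \<inter> {a,b,c}) = 2}.
      x1 t \<notin> affine hull (p ` g) \<and> x2 t \<notin> affine hull (p ` g)"
    by (rule eventually_ball_finite) (use fin off in auto)
  obtain t where t: "0 < t" "t \<le> 1/2"
    and ang1: "2 * pi < angle_between (Z - x1 t) (A - x1 t) + angle_between (A - x1 t) (C - x1 t)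
      + angle_between (C - x1 t) (B - x1 t) + angle_between (B - x1 t) (x2 t - x1 t)"
    and ang2: "2 * pi < angle_between (Z - x2 t) (A - x2 t) + angle_between (A - x2 t) (B - x2 t)
      + angle_between (B - x2 t) (x1 t - x2 t)"
    and gen: "\<forall>g\<in>{g\<in>F. g \<noteq> {a,b,c} \<and> card (g \<inter> {a,b,c}) = 2}.
      x1 t \<notin> affine hull (p ` g) \<and> x2 t \<notin> affine hull (p ` g)"
    using exists_small_parameter[OF eventually_conj[OF ev1 eventually_conj[OF ev2 ev3]]] by blast
  define x y where "x = x1 t" and "y = x2 t"
  note ang1 = ang1[folded x_def y_def] and ang2 = ang2[folded x_def y_def]
  have gx: "x \<notin> affine hull (p ` g)" and gy: "y \<notin> affine hull (p ` g)"
    if "g \<in> F" "g \<noteq> {a,b,c}" "card (g \<inter> {a,b,c}) = 2" for g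
    using gen that unfolding x_def y_def by blast+
  have xf: "x = (1 - t * \<tau> / 4) *\<^sub>R frame_point A B C Z \<tau> \<tau> 0 + (t * \<tau> / 4) *\<^sub>R Z"
    unfolding x_def x1_def y1_def frame_point_def by simp
  have yf: "y = (1 - t) *\<^sub>R frame_point A B C Z (\<tau>/4 + 3 * s / 4) (\<tau>/4) 0 + t *\<^sub>R Z"
    unfolding y_def x2_def y2_def frame_point_def \<beta>_def by simp
  note O = hat_orientations[OF \<tau>(1,2) s t D xf yf]
  obtain k1 k2 k3 k4 k5 k6 k7 where k: "k1 > 0" "orient A B C x = k1 * orient A B C Z" "k2 > 0" "orient A B C y = k2 * orient A B C Z"
      "k3 > 0" "orient A B x C = - k3 * orient A B C Z" "k4 > 0" "orient A B x y = k4 * orient A B C Z"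
      "k5 > 0" "orient A B x Z = k5 * orient A B C Z" "k6 > 0" "orient A x y B = k6 * orient A B C Z"
      "k7 > 0" "orient A x y Z = - k7 * orient A B C Z"
    using O(1-7) by metis
  have hullT: "u1 *\<^sub>R A + u2 *\<^sub>R B + u3 *\<^sub>R C \<in> convex hull {A,B,C,Z}" if "0 \<le> u1" "0 \<le> u2" "0 \<le> u3" "u1 + u2 + u3 = 1" for u1 u2 u3
    using convex_hull_4I[of u1 u2 u3 0 A B C Z] that by simp
  have ZQ: "Z \<in> convex hull {A,B,C,Z}" by (simp add: hull_inc)
  have y1Q: "y1 \<in> convex hull {A,B,C,Z}" unfolding y1c by (rule hullT) (use \<tau> in auto)
  have y2Q: "y2 \<in> convex hull {A,B,C,Z}" unfolding y2c by (rule hullT) (use \<tau> \<beta> in auto)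
  have t4: "0 \<le> t * \<tau> / 4" "t * \<tau> / 4 \<le> 1"
  proof -
    have "t * \<tau> \<le> (1/2) * (1/4)" using t \<tau> by (intro mult_mono) auto
    then show "0 \<le> t * \<tau> / 4" "t * \<tau> / 4 \<le> 1" using t \<tau> by auto
  qed
  have xQ: "x \<in> convex hull {A,B,C,Z}" unfolding x_def x1_def
    by (rule convexD_alt[OF convex_convex_hull y1Q ZQ]) (use t4 in auto)
  have yQ: "y \<in> convex hull {A,B,C,Z}" unfolding y_def x2_def
    by (rule convexD_alt[OF convex_convex_hull y2Q ZQ]) (use t in auto)
  note I = hat_tetrahedra_Int[OF D TS QS xQ yQ k]
  define p1 where "p1 = p(n := x)"
  define p2 where "p2 = p1(Suc n := y)"
  define p3 where "p3 = p2(Suc (Suc n) := Z)"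
  define F0 where "F0 = F - {{a,b,c}}"
  define F1 where "F1 = F0 \<union> {{a,b,n},{a,c,n},{b,c,n}}"
  define F2 where "F2 = (F1 - {{a,b,n}}) \<union> {{a,b,Suc n},{a,n,Suc n},{b,n,Suc n}}"
  define F3 where "F3 = (F2 - {{a,n,Suc n}}) \<union> {{a,n,Suc (Suc n)},{a,Suc n,Suc (Suc n)},{n,Suc n,Suc (Suc n)}}"
  have p1: "p1 n = x" "\<And>i. i < n \<Longrightarrow> p1 i = p i" "p1 a = A" "p1 b = B" "p1 c = C"
    unfolding p1_def A_def B_def C_def using abc by auto
  have p2: "p2 n = x" "p2 (Suc n) = y" "\<And>i. i < n \<Longrightarrow> p2 i = p i" "p2 a = A" "p2 b = B" "p2 c = C"
    unfolding p2_def using p1 abc by auto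
  have p3: "p3 n = x" "p3 (Suc n) = y" "p3 (Suc (Suc n)) = Z" "\<And>i. i < n \<Longrightarrow> p3 i = p i" "p3 a = A" "p3 b = B" "p3 c = C"
    unfolding p3_def using p2 abc by auto
  have F0n: "g \<subseteq> {..<n}" if "g \<in> F0" for g using that Fn unfolding F0_def by blast
  have pim: "q ` g = p ` g" if "g \<subseteq> {..<n}" "\<And>i. i < n \<Longrightarrow> q i = p i" for q :: "nat \<Rightarrow> real^3" and g
    using that by (intro image_cong) auto
  define S1 where "S1 = S \<union> convex hull {A,B,C,x}"
  define S2 where "S2 = S1 \<union> convex hull {A,B,x,y}"
  define S3 where "S3 = S2 \<union> convex hull {A,x,y,Z}"
  have G1: "good p1 (Suc n) F1 S1"
    unfolding p1_def F1_def F0_def S1_def A_def B_def C_def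
  proof (rule good_step[OF G f])
    show "orient (p a) (p b) (p c) x \<noteq> 0" using k(1,2) D unfolding A_def B_def C_def by simp
    show "convex hull {p a, p b, p c, x} \<inter> S = convex hull {p a, p b, p c}" using I(1) unfolding A_def B_def C_def .
    show "x \<notin> affine hull (p ` g)" if "g \<in> F" "g \<noteq> {a,b,c}" "card (g \<inter> {a,b,c}) = 2" for g by (rule gx[OF that])
  qed
  have f1: "{a,b,n} \<in> F1" unfolding F1_def by blast
  have ne: "a \<noteq> n" "b \<noteq> n" "c \<noteq> n" "a \<noteq> Suc n" "b \<noteq> Suc n" "c \<noteq> Suc n" "a \<noteq> Suc (Suc n)" "b \<noteq> Suc (Suc n)" "c \<noteq> Suc (Suc n)"
    using abc by auto
  have abd: "a \<noteq> b" "a \<noteq> c" "b \<noteq> c" using c3[OF f] by (auto simp: card_insert_if split: if_splits)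
  have G2: "good p2 (Suc (Suc n)) F2 S2"
    unfolding p2_def F2_def S2_def p1(1,3,4)[symmetric]
  proof (rule good_step[OF G1 f1])
    show "orient (p1 a) (p1 b) (p1 n) y \<noteq> 0" unfolding p1 using k(7,8) D by simp
    show "convex hull {p1 a, p1 b, p1 n, y} \<inter> S1 = convex hull {p1 a, p1 b, p1 n}" unfolding p1 S1_def by (rule I(2))
    show "y \<notin> affine hull (p1 ` g)" if g: "g \<in> F1" "g \<noteq> {a,b,n}" "card (g \<inter> {a,b,n}) = 2" for g
    proof -
      \<comment> \<open>An old face can meet \<open>abn\<close> in an edge only along
        \<open>ab\<close>, so it is also a neighbour of \<open>abc\<close>, whose plane
        \<open>y\<close> avoids. For the two faces from the first stacking a nonzero volume
        decides.\<close>
      from g(1,2) consider "g \<in> F0" | "g = {a,c,n}" | "g = {b,c,n}" unfolding F1_def by blast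
      then show ?thesis
      proof cases
        case 1
        have gn: "g \<subseteq> {..<n}" by (rule F0n[OF 1])
        have gF: "g \<in> F" "g \<noteq> {a,b,c}" using 1 unfolding F0_def by auto
        have sub: "g \<inter> {a,b,n} \<subseteq> g \<inter> {a,b,c}" using gn by auto
        have "g \<inter> {a,b,c} \<subset> {a,b,c}" by (rule card_3_Int_psubset[OF c3[OF gF(1)] c3[OF f] gF(2)])
        then have "card (g \<inter> {a,b,c}) < 3" using psubset_card_mono[of "{a,b,c}" "g \<inter> {a,b,c}"] c3[OF f] by simp
        moreover have "2 \<le> card (g \<inter> {a,b,c})" using card_mono[OF _ sub] g(3) by simp
        ultimately have "card (g \<inter> {a,b,c}) = 2" by simp
        have im: "p1 ` g = p ` g" by (rule pim[OF gn]) (rule p1(2))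
        show ?thesis unfolding im by (rule gy[OF gF]) fact
      next
        case 2
        have "p1 ` g = {A,C,x}" unfolding 2 using p1 by simp
        then show ?thesis using affine_hull_3_orient O(8) by metis
      next
        case 3
        have "p1 ` g = {B,C,x}" unfolding 3 using p1 by simp
        then show ?thesis using affine_hull_3_orient O(9) by metis
      qed
    qed
  qed
  have f2: "{a,n,Suc n} \<in> F2" unfolding F2_def by blast
  have G3: "good p3 (Suc (Suc (Suc n))) F3 S3"
    unfolding p3_def F3_def S3_def p2(1,2,4)[symmetric]
  proof (rule good_step[OF G2 f2])
    show "orient (p2 a) (p2 n) (p2 (Suc n)) Z \<noteq> 0" unfolding p2 using k(13,14) D by simp
    show "convex hull {p2 a, p2 n, p2 (Suc n), Z} \<inter> S2 = convex hull {p2 a, p2 n, p2 (Suc n)}"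
      unfolding p2(1,2,4) S2_def S1_def by (rule I(3))
    show "Z \<notin> affine hull (p2 ` g)" if g: "g \<in> F2" "g \<noteq> {a,n,Suc n}" "card (g \<inter> {a,n,Suc n}) = 2" for g
    proof -
      have "g \<in> F0 \<or> g = {a,c,n} \<or> g = {b,c,n} \<or> g = {a,b,Suc n} \<or> g = {b,n,Suc n}"
        using g(1,2) unfolding F2_def F1_def Un_iff Diff_iff insert_iff empty_iff by argo
      then consider "g \<in> F0" | "g = {a,c,n}" | "g = {b,c,n}" | "g = {a,b,Suc n}" | "g = {b,n,Suc n}" by argo
      then show ?thesis
      proof cases
        case 1
        \<comment> \<open>An old face shares at most the vertex \<open>a\<close> with the face being
          stacked on, so it is not a neighbour.\<close>
        have "g \<inter> {a,n,Suc n} \<subseteq> {a}" using F0n[OF 1] by auto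
        then have "card (g \<inter> {a,n,Suc n}) \<le> card {a}" by (rule card_mono[rotated]) simp
        then show ?thesis using g(3) by simp
      next
        case 2
        have "p2 ` g = {A,C,x}" unfolding 2 using p2 by simp
        then show ?thesis using affine_hull_3_orient O(10) by metis
      next
        case 3
        have "g \<inter> {a,n,Suc n} \<subseteq> {n}" unfolding 3 using ne abd by auto
        then have "card (g \<inter> {a,n,Suc n}) \<le> card {n}" by (rule card_mono[rotated]) simp
        then show ?thesis using g(3) by simp
      next
        case 4
        have "p2 ` g = {A,B,y}" unfolding 4 using p2 by simp
        then show ?thesis using affine_hull_3_orient O(11) by metis
      next
        case 5
        have "p2 ` g = {B,x,y}" unfolding 5 using p2 by simp
        then show ?thesis using affine_hull_3_orient O(12) by metis
      qed
    qed
  qed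
  have F3: "F3 = F0 \<union> hat_faces a b c n (n+1) (n+2)"
  proof -
    have n0: "{a,b,n} \<notin> F0" "{a,n,Suc n} \<notin> F0" using F0n[of "{a,b,n}"] F0n[of "{a,n,Suc n}"] by auto
    have n1: "{a,b,n} \<noteq> {a,c,n}" "{a,b,n} \<noteq> {b,c,n}"
      by (rule notI, drule arg_cong[where f = "\<lambda>S. c \<in> S"], use abd ne in auto)+
    have n2: "{a,n,Suc n} \<noteq> {a,c,n}" "{a,n,Suc n} \<noteq> {b,c,n}"
      by (rule notI, drule arg_cong[where f = "\<lambda>S. c \<in> S"], use abd ne in auto)+
    have n3: "{a,n,Suc n} \<noteq> {a,b,Suc n}" "{a,n,Suc n} \<noteq> {b,n,Suc n}"
      by (rule notI, drule arg_cong[where f = "\<lambda>S. b \<in> S"], use abd ne in auto)+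
    have perm: "{a,c,n} = {n,a,c}" "{b,c,n} = {n,b,c}" "{a,b,Suc n} = {Suc n,a,b}" "{b,n,Suc n} = {n,b,Suc n}"
      "{a,n,Suc (Suc n)} = {n,a,Suc (Suc n)}" "{a,Suc n,Suc (Suc n)} = {Suc n,a,Suc (Suc n)}" by blast+
    have suc: "n + 1 = Suc n" "n + 2 = Suc (Suc n)" by simp_all
    show ?thesis unfolding F3_def F2_def F1_def stack_thrice_faces[OF n0(1) n1 n0(2) n2 n3] unfolding perm hat_faces_def suc ..
  qed
  have hs: "hat_shape p3 a b c n (n+1) (n+2)"
  proof -
    have suc: "n + 1 = Suc n" "n + 2 = Suc (Suc n)" by simp_all
    have "orient Z A x y \<noteq> 0"
    proof
      assume "orient Z A x y = 0"
      then have "coplanar {Z,A,x,y}" by (simp add: coplanar_iff_orient)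
      moreover have "{Z,A,x,y} = {A,x,y,Z}" by blast
      ultimately have "orient A x y Z = 0" using coplanar_iff_orient by metis
      then show False using k(13,14) D by simp
    qed
    then show ?thesis unfolding hat_shape_def suc p3 using ang1 ang2 by simp
  qed
  have n3: "n + 3 = Suc (Suc (Suc n))" by simp
  show ?thesis unfolding n3 F0_def[symmetric] F3[symmetric] using G3 hs p3(4) by blast
qed

lemma good_face:
  assumes "good p n F S" "f \<in> F" obtains a b c where "f = {a,b,c}" "distinct [a,b,c]"
proof -
  have "card f = 3" using assms unfolding good_def is_tri_polyhedron_def by simp
  then show thesis using that by (auto simp: card_3_iff)
qed

text \<open>Only size matters here: a hat is a convenient way to gain three vertices while keeping
  the invariant.\<close>

lemma exists_large_good: "\<exists>p n F S. good p n F S \<and> k \<le> n"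
proof (induction k)
  case 0 then show ?case using exists_good_tetrahedron by blast
next
  case (Suc k)
  then obtain p n F S where G: "good p n F S" and k: "k \<le> n" by blast
  have "F \<noteq> {}"
  proof
    assume "F = {}"
    then have "n = 2" using G unfolding good_def by simp
    moreover have "\<Union>F = {..<n}" using G is_tri_polyhedron_vertices unfolding good_def by blast
    ultimately have "0 \<in> \<Union>F" by simp
    then show False using \<open>F = {}\<close> by simp
  qed
  then obtain f where f: "f \<in> F" by blast
  obtain a b c where "f = {a,b,c}" using good_face[OF G f] by metis
  then obtain p' S' where "good p' (n + 3) ((F - {{a,b,c}}) \<union> hat_faces a b c n (n+1) (n+2)) S'"
    using attach_hat[OF G] f by blast
  moreover have "Suc k \<le> n + 3" using k by simp
  ultimately show ?case by blast
qed

lemma hat_face_edges: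
  assumes "g \<in> hat_faces a b c x y z" "e \<subseteq> g" "card e = 2"
  shows "e \<in> hat_edges a b c x y z \<or> e \<subseteq> {a,b,c}"
proof -
  from assms(1) consider "g = {x,b,c}" | "g = {x,a,c}" | "g = {x,b,y}" | "g = {y,a,b}" | "g = {x,y,z}" | "g = {x,a,z}" | "g = {y,a,z}"
    unfolding hat_faces_def insert_iff empty_iff by argo
  then show ?thesis
  proof cases
    case 1 from doubleton_subset_triple[OF assms(2)[unfolded 1] assms(3)] show ?thesis
      unfolding hat_edges_def by (elim disjE) (simp_all add: doubleton_eq_iff)
  next
    case 2 from doubleton_subset_triple[OF assms(2)[unfolded 2] assms(3)] show ?thesis
      unfolding hat_edges_def by (elim disjE) (simp_all add: doubleton_eq_iff)
  next
    case 3 from doubleton_subset_triple[OF assms(2)[unfolded 3] assms(3)] show ?thesis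
      unfolding hat_edges_def by (elim disjE) (simp_all add: doubleton_eq_iff)
  next
    case 4 from doubleton_subset_triple[OF assms(2)[unfolded 4] assms(3)] show ?thesis
      unfolding hat_edges_def by (elim disjE) (simp_all add: doubleton_eq_iff)
  next
    case 5 from doubleton_subset_triple[OF assms(2)[unfolded 5] assms(3)] show ?thesis
      unfolding hat_edges_def by (elim disjE) (simp_all add: doubleton_eq_iff)
  next
    case 6 from doubleton_subset_triple[OF assms(2)[unfolded 6] assms(3)] show ?thesis
      unfolding hat_edges_def by (elim disjE) (simp_all add: doubleton_eq_iff)
  next
    case 7 from doubleton_subset_triple[OF assms(2)[unfolded 7] assms(3)] show ?thesis
      unfolding hat_edges_def by (elim disjE) (simp_all add: doubleton_eq_iff)
  qed
qed

section \<open>Bookkeeping for hats on all faces\<close>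

definition hat_in :: "(nat \<Rightarrow> real^3) \<Rightarrow> nat set set \<Rightarrow> nat \<times> nat \<times> nat \<times> nat \<times> nat \<times> nat \<Rightarrow> bool" where
  "hat_in p F = (\<lambda>(a,b,c,x,y,z). hat_faces a b c x y z \<subseteq> F \<and> distinct [a,b,c,x,y,z] \<and> hat_shape p a b c x y z)"

definition edges_of_hat :: "nat \<times> nat \<times> nat \<times> nat \<times> nat \<times> nat \<Rightarrow> nat set set" where
  "edges_of_hat = (\<lambda>(a,b,c,x,y,z). hat_edges a b c x y z)"

definition faces_of_hat :: "nat \<times> nat \<times> nat \<times> nat \<times> nat \<times> nat \<Rightarrow> nat set set" where
  "faces_of_hat = (\<lambda>(a,b,c,x,y,z). hat_faces a b c x y z)"

text \<open>The shape of a hat depends only on the positions of its own vertices, and later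
  stackings place vertices at fresh indices; it remains to know that no face of the hat has been
  removed.\<close>

lemma hat_in_persists:
  assumes h: "hat_in p F h" and V: "\<Union>F \<subseteq> {..<n}" and p: "\<And>i. i < n \<Longrightarrow> p' i = p i" and F: "faces_of_hat h \<subseteq> F'"
  shows "hat_in p' F' h"
proof -
  obtain a b c x y z where e: "h = (a,b,c,x,y,z)" by (cases h)
  have hf: "hat_faces a b c x y z \<subseteq> F" using h unfolding hat_in_def e by simp
  have "a \<in> \<Union>(hat_faces a b c x y z)" "b \<in> \<Union>(hat_faces a b c x y z)" "c \<in> \<Union>(hat_faces a b c x y z)"
    "x \<in> \<Union>(hat_faces a b c x y z)" "y \<in> \<Union>(hat_faces a b c x y z)" "z \<in> \<Union>(hat_faces a b c x y z)"
    unfolding hat_faces_def by simp_all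
  then have "a < n" "b < n" "c < n" "x < n" "y < n" "z < n" using Union_mono[OF hf] V by blast+
  then have "p' a = p a" "p' b = p b" "p' c = p c" "p' x = p x" "p' y = p y" "p' z = p z" using p by blast+
  then show ?thesis using h F unfolding hat_in_def e faces_of_hat_def hat_shape_def by simp
qed

text \<open>Each hat removes just one face of \<open>F0\<close>. Requiring that no hat has a face in
  \<open>F0\<close> therefore protects the earlier hats in the induction on the set \<open>D\<close>
  of faces already covered.\<close>

lemma hat_all_faces:
  assumes G0: "good p0 n0 F0 S0" and DF: "finite D" "D \<subseteq> F0"
  shows "\<exists>p n F S Hs. good p n F S \<and> n0 \<le> n \<and> F0 - D \<subseteq> F \<and> card F = card F0 + 6 * card D \<and>
    finite Hs \<and> card Hs \<le> card D \<and> (\<forall>h\<in>Hs. hat_in p F h \<and> faces_of_hat h \<inter> F0 = {}) \<and>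
    tri_edges F \<subseteq> tri_edges F0 \<union> (\<Union>h\<in>Hs. edges_of_hat h)"
  using DF
proof (induction D rule: finite_induct)
  case empty
  show ?case
    by (rule exI[of _ p0], rule exI[of _ n0], rule exI[of _ F0], rule exI[of _ S0], rule exI[of _ "{}"]) (use G0 in simp)
next
  case (insert f D)
  have "D \<subseteq> F0" using insert.prems by simp
  from insert.IH[OF this] obtain p n F S Hs where G: "good p n F S" and n0: "n0 \<le> n" and F0D: "F0 - D \<subseteq> F" and cF: "card F = card F0 + 6 * card D"
    and fH: "finite Hs" and cH: "card Hs \<le> card D" and H: "\<forall>h\<in>Hs. hat_in p F h \<and> faces_of_hat h \<inter> F0 = {}"
    and E: "tri_edges F \<subseteq> tri_edges F0 \<union> (\<Union>h\<in>Hs. edges_of_hat h)" by - (elim exE conjE, rule that; assumption)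
  have f0: "f \<in> F0" and fF: "f \<in> F" using insert.prems insert.hyps F0D by auto
  obtain a b c where abc: "f = {a,b,c}" "distinct [a,b,c]" using good_face[OF G fF] by blast
  have V: "\<Union>F = {..<n}" using G is_tri_polyhedron_vertices unfolding good_def by metis
  have V0: "\<Union>F0 = {..<n0}" using G0 is_tri_polyhedron_vertices unfolding good_def by metis
  define F' where "F' = (F - {{a,b,c}}) \<union> hat_faces a b c n (n+1) (n+2)"
  define h where "h = (a,b,c,n,n+1,n+2)"
  obtain p' S' where p': "\<And>i. i < n \<Longrightarrow> p' i = p i" and G': "good p' (n+3) F' S'" and hs: "hat_shape p' a b c n (n+1) (n+2)"
    using attach_hat[OF G] fF unfolding abc(1) F'_def by blast
  have lt: "a < n" "b < n" "c < n" using fF V unfolding abc(1) by blast+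
  have newF0: "faces_of_hat h \<inter> F0 = {}"
  proof -
    have "n \<in> g \<or> n + 1 \<in> g" if "g \<in> faces_of_hat h" for g using that unfolding faces_of_hat_def h_def hat_faces_def by auto
    moreover have "n \<notin> g \<and> n + 1 \<notin> g" if "g \<in> F0" for g
    proof -
      have "g \<subseteq> {..<n0}" using that V0 by blast
      then show ?thesis using n0 by auto
    qed
    ultimately show ?thesis by blast
  qed
  have hh: "hat_in p' F' h" unfolding hat_in_def h_def F'_def using hs abc(2) lt by auto
  have H': "hat_in p' F' g \<and> faces_of_hat g \<inter> F0 = {}" if "g \<in> Hs" for g
  proof -
    have g: "hat_in p F g" "faces_of_hat g \<inter> F0 = {}" using H that by auto
    have "faces_of_hat g \<subseteq> F" using g(1) unfolding hat_in_def faces_of_hat_def by (cases g) simp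
    then have "faces_of_hat g \<subseteq> F'" unfolding F'_def using g(2) f0 abc(1) by blast
    then show ?thesis using hat_in_persists[OF g(1) _ p'] V g(2) by blast
  qed
  \<comment> \<open>Read off from the count \<open>card F + 4 = 2 * n\<close> in the invariant:
    three new vertices bring six faces.\<close>
  have cF': "card F' = card F + 6" using G G' unfolding good_def by simp
  have E': "tri_edges F' \<subseteq> tri_edges F \<union> edges_of_hat h"
  proof
    fix e assume "e \<in> tri_edges F'"
    then obtain g where g: "g \<in> F'" "e \<subseteq> g" "card e = 2" unfolding tri_edges_def by blast
    show "e \<in> tri_edges F \<union> edges_of_hat h"
    proof (cases "g \<in> F")
      case True then show ?thesis using g unfolding tri_edges_def by blast
    next
      case False
      then have "g \<in> hat_faces a b c n (n+1) (n+2)" using g(1) unfolding F'_def by blast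
      from hat_face_edges[OF this g(2,3)] have "e \<in> edges_of_hat h \<or> e \<subseteq> f" unfolding edges_of_hat_def h_def abc(1) by simp
      then show ?thesis using fF g(3) unfolding tri_edges_def by blast
    qed
  qed
  show ?case
  proof (rule exI[of _ p'], rule exI[of _ "n+3"], rule exI[of _ F'], rule exI[of _ S'], rule exI[of _ "insert h Hs"], intro conjI)
    show "good p' (n+3) F' S'" by (rule G')
    show "n0 \<le> n + 3" using n0 by simp
    show "F0 - insert f D \<subseteq> F'" unfolding F'_def using F0D abc(1) by blast
    show "card F' = card F0 + 6 * card (insert f D)" using cF' cF insert.hyps by simp
    show "finite (insert h Hs)" using fH by simp
    show "card (insert h Hs) \<le> card (insert f D)" using cH insert.hyps fH by (simp add: card_insert_if)
    show "\<forall>g\<in>insert h Hs. hat_in p' F' g \<and> faces_of_hat g \<inter> F0 = {}" using hh newF0 H' by blast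
    show "tri_edges F' \<subseteq> tri_edges F0 \<union> (\<Union>g\<in>insert h Hs. edges_of_hat g)" using E E' by blast
  qed
qed

theorem theorem4:
  fixes N :: nat
  assumes "0 < N"
  shows "\<exists>p n F S. stacked p n F S \<and> topologically_convex p n F S \<and>
           faces_are_triangles p F \<and>
           (\<forall>C. valid_edge_unfolding p F C \<longrightarrow> N \<le> card (pieces F C))"
proof -
  \<comment> \<open>The offset 2 matches the bound of \<open>n0\<close> - 2 pieces obtained at the
    end.\<close>
  obtain p0 n0 F0 S0 where G0: "good p0 n0 F0 S0" and n0: "N + 2 \<le> n0" using exists_large_good by blast
  have fF0: "finite F0" using G0 unfolding good_def is_tri_polyhedron_def by simp
  obtain p n F S Hs where G: "good p n F S" and cF: "card F = card F0 + 6 * card F0"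
    and fH: "finite Hs" and cH: "card Hs \<le> card F0" and H: "\<And>h. h \<in> Hs \<Longrightarrow> hat_in p F h"
    and E: "tri_edges F \<subseteq> tri_edges F0 \<union> (\<Union>h\<in>Hs. edges_of_hat h)"
    using hat_all_faces[OF G0 fF0 order_refl] by blast
  have T: "is_tri_polyhedron p n F S" using G unfolding good_def by simp
  have fin: "finite F" and c3: "\<And>g. g \<in> F \<Longrightarrow> card g = 3" and nc: "\<And>g. g \<in> F \<Longrightarrow> \<not> collinear (p ` g)"
    and two: "\<And>e. e \<in> tri_edges F \<Longrightarrow> card {g\<in>F. e \<subseteq> g} = 2"
    using T unfolding is_tri_polyhedron_def by simp_all
  have finE: "finite (tri_edges G)" if "finite G" "\<And>g. g \<in> G \<Longrightarrow> card g = 3" for G :: "nat set set"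
  proof -
    have "tri_edges G \<subseteq> Pow (\<Union>G)" unfolding tri_edges_def by blast
    moreover have "finite (\<Union>G)" using that by (intro finite_Union) (metis card.infinite zero_neq_numeral)+
    ultimately show ?thesis by (meson finite_Pow_iff finite_subset)
  qed
  have fE0: "finite (tri_edges F0)" using G0 fF0 unfolding good_def is_tri_polyhedron_def by (intro finE) auto
  have "N \<le> card (pieces F C)" if v: "valid_edge_unfolding p F C" for C
  proof -
    have h5: "card (edges_of_hat h - C) \<le> 5" if "h \<in> Hs" for h
    proof -
      obtain a b c x y z where e: "h = (a,b,c,x,y,z)" by (cases h)
      show ?thesis using H[OF that] hat_uncut_le_5[OF v _ _ nc] unfolding e hat_in_def edges_of_hat_def by simp
    qed
    have fh: "finite (edges_of_hat h)" for h unfolding edges_of_hat_def hat_edges_def by (cases h) simp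
    have "card (tri_edges F - C) \<le> card (tri_edges F0 \<union> (\<Union>h\<in>Hs. edges_of_hat h - C))"
      using E fE0 fH fh by (intro card_mono) auto
    also have "\<dots> \<le> card (tri_edges F0) + card (\<Union>h\<in>Hs. edges_of_hat h - C)" by (rule card_Un_le)
    also have "card (\<Union>h\<in>Hs. edges_of_hat h - C) \<le> (\<Sum>h\<in>Hs. card (edges_of_hat h - C))" by (rule card_UN_le[OF fH])
    also have "(\<Sum>h\<in>Hs. card (edges_of_hat h - C)) \<le> (\<Sum>h\<in>Hs. 5)" by (rule sum_mono) (rule h5)
    also have "(\<Sum>h\<in>Hs. 5::nat) = 5 * card Hs" by simp
    finally have u: "card (tri_edges F - C) \<le> card (tri_edges F0) + 5 * card F0" using cH by linarith
    have "card F \<le> card (pieces F C) + card (tri_edges F - C)"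
      by (rule card_pieces_ge[OF fin c3 two finE[OF fin c3]])
    \<comment> \<open>Seven faces against five uncut edges leave two per face of \<open>F0\<close>.
      By the Euler counts this means at least (4 \<open>n0\<close> - 8) - (3 \<open>n0\<close> - 6)
      = \<open>n0\<close> - 2 pieces.\<close>
    then have "2 * card F0 \<le> card (pieces F C) + card (tri_edges F0)" using u cF by linarith
    moreover have "card F0 + 4 = 2 * n0" "card (tri_edges F0) + 6 \<le> 3 * n0" using G0 unfolding good_def by auto
    ultimately show ?thesis using n0 by linarith
  qed
  then show ?thesis using G unfolding good_def by blast
qed

end
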